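(* For each $\alpha>0$, the following equality of topological spaces holds: $$\mathcal E^{\alpha}_{\mathrm{min}}(\Phi')=\operatorname*{proj\,lim}_{\tau\in T,\,l\in\mathbb N_0}\mathbf E^\alpha_{l}(\mathcal H_{-\tau}).$$
   Context: **Spaces.** $\mathbb N_0=\{0,1,2,\dots\}$. Let $T$ be an arbitrary index set and $(\mathcal H_{\tau,\mathbb R})_{\tau\in T}$ a family of real separable Hilbert spaces such that: for any $\tau_1,\tau_2\in T$ there is $\tau_3\in T$ with $\mathcal H_{\tau_3,\mathbb R}\subset\mathcal H_{\tau_1,\mathbb R}$ and $\mathcal H_{\tau_3,\mathbb R}\subset\mathcal H_{\tau_2,\mathbb R}$, both embeddings continuous; for each $\tau_1\in T$ there is $\tau_2\in T$ with $\mathcal H_{\tau_2,\mathbb R}\subset\mathcal H_{\tau_1,\mathbb R}$ and Hilbert–Schmidt embedding; $\bigcap_{\tau\in T}\mathcal H_{\tau,\mathbb R}$ is dense in each $\mathcal H_{\tau,\mathbb R}$; and there is $\tau_0\in T$ such that every $\mathcal H_{\tau,\mathbb R}$ is continuously embedded into $\mathcal H_{0,\mathbb R}:=\mathcal H_{\tau_0,\mathbb R}$ (the center space). Let $\mathcal H_\tau$, $\mathcal H_0$ be the complexifications, and $\Phi=\bigcap_{\tau\in T}\mathcal H_\tau$ with the projective limit topology (a complex nuclear space). $\mathcal H_{-\tau}$ is the dual of $\mathcal H_\tau$ with respect to the center space $\mathcal H_0$, and $\Phi'=\bigcup_{\tau\in T}\mathcal H_{-\tau}$ is the dual of $\Phi$.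 The bilinear dual pairing $\langle\omega,\xi\rangle$ is the continuous extension of $(\omega,\overline\xi)_{\mathcal H_0}$; the same notation is used for the pairing of $\mathcal H_{-\tau}^{\odot n}$ with $\mathcal H_\tau^{\odot n}$, where $\odot$ is the (Hilbert-space) symmetric tensor product and $\mathcal H_\tau^{\odot0}=\mathbb C$. The norms of $\mathcal H_{\tau}^{\odot n}$ and $\mathcal H_{-\tau}^{\odot n}$ are denoted $\|\cdot\|_\tau$ and $\|\cdot\|_{-\tau}$. $\omega^{\otimes 0}:=1$. **Spaces of entire functions.** Entire on $\mathcal H_{-\tau}$ means continuous and holomorphic along every complex line. For $\alpha>0$, $\tau\in T$, $l\in\mathbb N_0$, $\mathcal E^\alpha_l(\mathcal H_{-\tau})$ is the space of entire $f:\mathcal H_{-\tau}\to\mathbb C$ with norm $\mathbf n_{\tau,l,\alpha}(f)=\sup_{\omega\in\mathcal H_{-\tau}}|f(\omega)|\exp(-2^{-l}\|\omega\|_{-\tau}^\alpha)<\infty$. $\mathcal E^\alpha_{\mathrm{min}}(\Phi')$ is the set of functions $f:\Phi'\to\mathbb C$ whose restriction to $\mathcal H_{-\tau}$ belongs to $\mathcal E^\alpha_l(\mathcal H_{-\tau})$ for all $\tau\in T$, $l\in\mathbb N_0$, with the projective limit topology given by all the norms $\mathbf n_{\tau,l,\alpha}$. $\mathbf E^\alpha_{l}(\mathcal H_{-\tau})$ is the Banach space of all entire functions $f:\mathcal H_{-\tau}\to\mathbb C$ of the form $f(\omega)=\sum_{n=0}^\infty\langle\omega^{\otimes n},\varphi^{(n)}\rangle$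 with $\varphi^{(n)}\in\mathcal H_\tau^{\odot n}$ and $\|f\|_{\tau,l,\alpha}:=\sum_{n=0}^\infty(n!)^{1/\alpha}2^{ln}\|\varphi^{(n)}\|_\tau<\infty$. The projective limit $\operatorname{proj\,lim}_{\tau,l}\mathbf E^\alpha_{l}(\mathcal H_{-\tau})$ is the set of functions $f:\Phi'\to\mathbb C$ whose restriction to $\mathcal H_{-\tau}$ belongs to $\mathbf E^\alpha_{l}(\mathcal H_{-\tau})$ for all $\tau\in T$, $l\in\mathbb N_0$, with the topology generated by all the norms $\|\cdot\|_{\tau,l,\alpha}$. *)

theory Defs
  imports "HOL-Analysis.Analysis"
begin

section \<open>Hilbert spaces on a carrier\<close>

text \<open>The Hilbert spaces of a family are subspaces of one ambient real vector space, each with its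
  own inner product; inclusions between them are inclusions of carriers. The locale
  \<^locale>\<open>Metric_space\<close> asks for a nonnegative and symmetric distance on the whole type, hence
  distances are cut off outside the carrier.\<close>

definition dist_on :: "'b set \<Rightarrow> ('b \<Rightarrow> 'b \<Rightarrow> real) \<Rightarrow> 'b \<Rightarrow> 'b \<Rightarrow> real" where
  "dist_on S d x y = (if x \<in> S \<and> y \<in> S then d x y else 0)"

definition topology_on :: "'b set \<Rightarrow> ('b \<Rightarrow> 'b \<Rightarrow> real) \<Rightarrow> 'b topology" where
  "topology_on S d = Metric_space.mtopology S (dist_on S d)"

definition ip_norm :: "('a \<Rightarrow> 'a \<Rightarrow> real) \<Rightarrow> 'a \<Rightarrow> real" where
  "ip_norm ip x = sqrt (ip x x)"

definition hilbert_topology :: "'a::real_vector set \<Rightarrow> ('a \<Rightarrow> 'a \<Rightarrow> real) \<Rightarrow> 'a topology" where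
  "hilbert_topology S ip = topology_on S (\<lambda>x y. ip_norm ip (x - y))"

definition real_separable_hilbert :: "'a::real_vector set \<Rightarrow> ('a \<Rightarrow> 'a \<Rightarrow> real) \<Rightarrow> bool" where
  "real_separable_hilbert S ip \<longleftrightarrow>
     subspace S \<and>
     (\<forall>x\<in>S. \<forall>y\<in>S. ip x y = ip y x) \<and>
     (\<forall>x\<in>S. \<forall>y\<in>S. \<forall>z\<in>S. \<forall>a b. ip (a *\<^sub>R x + b *\<^sub>R y) z = a * ip x z + b * ip y z) \<and>
     (\<forall>x\<in>S. x \<noteq> 0 \<longrightarrow> ip x x > 0) \<and>
     Metric_space.mcomplete S (dist_on S (\<lambda>x y. ip_norm ip (x - y))) \<and>
     separable_space (hilbert_topology S ip)"

definition orthonormal_basis ::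
    "'a::real_vector set \<Rightarrow> ('a \<Rightarrow> 'a \<Rightarrow> real) \<Rightarrow> 'a set \<Rightarrow> bool" where
  "orthonormal_basis S ip B \<longleftrightarrow>
     B \<subseteq> S \<and> (\<forall>x\<in>B. \<forall>y\<in>B. ip x y = (if x = y then 1 else 0)) \<and>
     hilbert_topology S ip closure_of (span B) = S"

definition continuously_embedded ::
    "'a::real_vector set \<Rightarrow> ('a \<Rightarrow> 'a \<Rightarrow> real) \<Rightarrow> 'a set \<Rightarrow> ('a \<Rightarrow> 'a \<Rightarrow> real) \<Rightarrow> bool" where
  "continuously_embedded S ip S' ip' \<longleftrightarrow>
     S \<subseteq> S' \<and> continuous_map (hilbert_topology S ip) (hilbert_topology S' ip') (\<lambda>x. x)"

definition hilbert_schmidt_embedded ::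
    "'a::real_vector set \<Rightarrow> ('a \<Rightarrow> 'a \<Rightarrow> real) \<Rightarrow> 'a set \<Rightarrow> ('a \<Rightarrow> 'a \<Rightarrow> real) \<Rightarrow> bool" where
  "hilbert_schmidt_embedded S ip S' ip' \<longleftrightarrow>
     continuously_embedded S ip S' ip' \<and>
     (\<exists>B. orthonormal_basis S ip B \<and> (\<lambda>e. (ip_norm ip' e)\<^sup>2) summable_on B)"


section \<open>Complexification\<close>

text \<open>The pair \<open>(x, y)\<close> stands for \<open>x + i y\<close>. The complex inner product is linear in the first and
  antilinear in the second argument.\<close>

definition cscale :: "complex \<Rightarrow> 'a::real_vector \<times> 'a \<Rightarrow> 'a \<times> 'a" where
  "cscale c x = (Re c *\<^sub>R fst x - Im c *\<^sub>R snd x, Re c *\<^sub>R snd x + Im c *\<^sub>R fst x)"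

definition cconj :: "'a::real_vector \<times> 'a \<Rightarrow> 'a \<times> 'a" where
  "cconj x = (fst x, - snd x)"

definition cinner :: "('a \<Rightarrow> 'a \<Rightarrow> real) \<Rightarrow> 'a \<times> 'a \<Rightarrow> 'a \<times> 'a \<Rightarrow> complex" where
  "cinner ip x y = Complex (ip (fst x) (fst y) + ip (snd x) (snd y))
                           (ip (snd x) (fst y) - ip (fst x) (snd y))"

abbreviation cnorm :: "('a \<Rightarrow> 'a \<Rightarrow> real) \<Rightarrow> 'a \<times> 'a \<Rightarrow> real" where
  "cnorm ip \<equiv> ip_norm (\<lambda>x y. Re (cinner ip x y))"

definition corthonormal :: "('a \<Rightarrow> 'a \<Rightarrow> real) \<Rightarrow> ('a \<times> 'a) set \<Rightarrow> bool" where
  "corthonormal ip F \<longleftrightarrow> (\<forall>x\<in>F. \<forall>y\<in>F. cinner ip x y = (if x = y then 1 else 0))"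


section \<open>The spaces \<open>\<Phi>\<close>, \<open>\<H>\<^sub>-\<^sub>\<tau>\<close> and \<open>\<Phi>'\<close>\<close>

locale hilbert_family =
  fixes T :: "'t set"
    and H :: "'t \<Rightarrow> 'a::real_vector set"
    and ip :: "'t \<Rightarrow> 'a \<Rightarrow> 'a \<Rightarrow> real"
begin

definition Hc :: "'t \<Rightarrow> ('a \<times> 'a) set" where
  "Hc \<tau> = H \<tau> \<times> H \<tau>"

definition Hc_topology :: "'t \<Rightarrow> ('a \<times> 'a) topology" where
  "Hc_topology \<tau> = hilbert_topology (Hc \<tau>) (\<lambda>x y. Re (cinner (ip \<tau>) x y))"

definition Phi :: "('a \<times> 'a) set" where
  "Phi = (\<Inter>\<tau>\<in>T. Hc \<tau>)"

definition dual :: "'t \<Rightarrow> ('a \<times> 'a \<Rightarrow> complex) set" where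
  "dual \<tau> = {w \<in> extensional (Hc \<tau>).
     (\<forall>x\<in>Hc \<tau>. \<forall>y\<in>Hc \<tau>. \<forall>a b. w (cscale a x + cscale b y) = a * w x + b * w y) \<and>
     continuous_map (Hc_topology \<tau>) euclidean w}"

text \<open>Elements of \<open>\<Phi>'\<close> are functionals on \<open>\<Phi>\<close>. Since \<open>\<Phi>\<close> is dense in \<open>\<H>\<^sub>\<tau>\<close>, a functional in the
  dual of \<open>\<H>\<^sub>\<tau>\<close> is determined by its restriction to \<open>\<Phi>\<close>, and \<open>\<H>\<^sub>-\<^sub>\<tau>\<close> consists of these restrictions;
  in this way all \<open>\<H>\<^sub>-\<^sub>\<tau>\<close> lie in one space. The center space embeds by sending \<open>h\<close> to the functional
  \<open>\<xi> \<mapsto> (h, cconj \<xi>)\<close> with the inner product of the center space; see \<open>center_in_Hneg\<close> below.\<close>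

definition Hneg :: "'t \<Rightarrow> ('a \<times> 'a \<Rightarrow> complex) set" where
  "Hneg \<tau> = (\<lambda>w. restrict w Phi) ` dual \<tau>"

definition Phi_dual :: "('a \<times> 'a \<Rightarrow> complex) set" where
  "Phi_dual = (\<Union>\<tau>\<in>T. Hneg \<tau>)"

definition pairing :: "'t \<Rightarrow> ('a \<times> 'a \<Rightarrow> complex) \<Rightarrow> 'a \<times> 'a \<Rightarrow> complex" where
  "pairing \<tau> \<omega> = (THE w. w \<in> dual \<tau> \<and> restrict w Phi = \<omega>)"

definition dual_norm :: "'t \<Rightarrow> ('a \<times> 'a \<Rightarrow> complex) \<Rightarrow> real" where
  "dual_norm \<tau> \<omega> = (SUP \<xi>\<in>{\<xi> \<in> Hc \<tau>. cnorm (ip \<tau>) \<xi> \<le> 1}. cmod (pairing \<tau> \<omega> \<xi>))"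

definition lin_comb ::
    "complex \<Rightarrow> ('a \<times> 'a \<Rightarrow> complex) \<Rightarrow> complex \<Rightarrow> ('a \<times> 'a \<Rightarrow> complex) \<Rightarrow> ('a \<times> 'a \<Rightarrow> complex)" where
  "lin_comb a \<omega> b \<eta> = (\<lambda>\<xi>\<in>Phi. a * \<omega> \<xi> + b * \<eta> \<xi>)"

definition Hneg_topology :: "'t \<Rightarrow> ('a \<times> 'a \<Rightarrow> complex) topology" where
  "Hneg_topology \<tau> = topology_on (Hneg \<tau>) (\<lambda>\<omega> \<eta>. dual_norm \<tau> (lin_comb 1 \<omega> (-1) \<eta>))"


section \<open>Symmetric tensor powers of \<open>\<H>\<^sub>\<tau>\<close>\<close>

text \<open>The Hilbert-space tensor power of \<open>\<H>\<^sub>\<tau>\<close> is realized as the space of Hilbert-Schmidt \<open>n\<close>-linear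
  forms on its dual \<open>\<H>\<^sub>-\<^sub>\<tau>\<close>, the elementary tensor of \<open>x\<^sub>1, \<dots>, x\<^sub>n\<close> being the form that sends
  \<open>\<omega>\<^sub>1, \<dots>, \<omega>\<^sub>n\<close> to the product of the \<open>pairing \<tau> \<omega>\<^sub>k x\<^sub>k\<close>. The squared norm of a form is the sum of
  the squares of its coefficients \<open>\<phi>((\<cdot>, e\<^sub>1), \<dots>, (\<cdot>, e\<^sub>n))\<close>, the \<open>e\<^sub>k\<close> running over an orthonormal
  basis of \<open>\<H>\<^sub>\<tau>\<close>. This sum does not depend on the basis, and it is the supremum of the same sums
  over finite orthonormal systems. Finiteness of the supremum implies that the form is bounded.
  Symmetric tensors carry the norm of the full tensor power.\<close>

definition riesz :: "'t \<Rightarrow> 'a \<times> 'a \<Rightarrow> ('a \<times> 'a \<Rightarrow> complex)" where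
  "riesz \<tau> e = (\<lambda>\<xi>\<in>Phi. cinner (ip \<tau>) \<xi> e)"

definition coeff_sum :: "'t \<Rightarrow> nat \<Rightarrow> ((nat \<Rightarrow> 'a \<times> 'a \<Rightarrow> complex) \<Rightarrow> complex) \<Rightarrow> ('a \<times> 'a) set \<Rightarrow> real" where
  "coeff_sum \<tau> n \<phi> F = (\<Sum>e\<in>{..<n} \<rightarrow>\<^sub>E F. (cmod (\<phi> (\<lambda>k\<in>{..<n}. riesz \<tau> (e k))))\<^sup>2)"

definition orthonormal_systems :: "'t \<Rightarrow> ('a \<times> 'a) set set" where
  "orthonormal_systems \<tau> = {F. finite F \<and> F \<subseteq> Hc \<tau> \<and> corthonormal (ip \<tau>) F}"

definition tensor_power :: "'t \<Rightarrow> nat \<Rightarrow> ((nat \<Rightarrow> 'a \<times> 'a \<Rightarrow> complex) \<Rightarrow> complex) set" where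
  "tensor_power \<tau> n = {\<phi> \<in> extensional ({..<n} \<rightarrow>\<^sub>E Hneg \<tau>).
     (\<forall>\<omega>\<in>{..<n} \<rightarrow>\<^sub>E Hneg \<tau>. \<forall>k<n. \<forall>\<eta>\<in>Hneg \<tau>. \<forall>\<zeta>\<in>Hneg \<tau>. \<forall>a b.
        \<phi> (fun_upd \<omega> k (lin_comb a \<eta> b \<zeta>)) =
          a * \<phi> (fun_upd \<omega> k \<eta>) + b * \<phi> (fun_upd \<omega> k \<zeta>)) \<and>
     bdd_above (coeff_sum \<tau> n \<phi> ` orthonormal_systems \<tau>)}"

definition sym_tensor_power :: "'t \<Rightarrow> nat \<Rightarrow> ((nat \<Rightarrow> 'a \<times> 'a \<Rightarrow> complex) \<Rightarrow> complex) set" where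
  "sym_tensor_power \<tau> n = {\<phi> \<in> tensor_power \<tau> n.
     \<forall>\<pi>. \<pi> permutes {..<n} \<longrightarrow> (\<forall>\<omega>\<in>{..<n} \<rightarrow>\<^sub>E Hneg \<tau>. \<phi> (\<omega> \<circ> \<pi>) = \<phi> \<omega>)}"

definition tensor_norm :: "'t \<Rightarrow> nat \<Rightarrow> ((nat \<Rightarrow> 'a \<times> 'a \<Rightarrow> complex) \<Rightarrow> complex) \<Rightarrow> real" where
  "tensor_norm \<tau> n \<phi> = sqrt (SUP F\<in>orthonormal_systems \<tau>. coeff_sum \<tau> n \<phi> F)"

text \<open>The pairing of the \<open>n\<close>-th tensor power of \<open>\<omega>\<close> with \<open>\<phi>\<close>; for \<open>n = 0\<close> it is the scalar \<open>\<phi>\<close>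
  itself, the form having no arguments.\<close>

definition power_pairing ::
    "nat \<Rightarrow> ('a \<times> 'a \<Rightarrow> complex) \<Rightarrow> ((nat \<Rightarrow> 'a \<times> 'a \<Rightarrow> complex) \<Rightarrow> complex) \<Rightarrow> complex" where
  "power_pairing n \<omega> \<phi> = \<phi> (\<lambda>k\<in>{..<n}. \<omega>)"


section \<open>Spaces of entire functions\<close>

definition entire_on :: "'t \<Rightarrow> (('a \<times> 'a \<Rightarrow> complex) \<Rightarrow> complex) set" where
  "entire_on \<tau> = {f \<in> extensional (Hneg \<tau>).
     continuous_map (Hneg_topology \<tau>) euclidean f \<and>
     (\<forall>\<omega>\<in>Hneg \<tau>. \<forall>\<eta>\<in>Hneg \<tau>. (\<lambda>z. f (lin_comb 1 \<omega> z \<eta>)) holomorphic_on UNIV)}"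

definition growth_norm :: "real \<Rightarrow> 't \<Rightarrow> nat \<Rightarrow> (('a \<times> 'a \<Rightarrow> complex) \<Rightarrow> complex) \<Rightarrow> real" where
  "growth_norm \<alpha> \<tau> l f =
     (SUP \<omega>\<in>Hneg \<tau>. cmod (f \<omega>) * exp (- (2 powr (- real l) * dual_norm \<tau> \<omega> powr \<alpha>)))"

definition growth_space :: "real \<Rightarrow> 't \<Rightarrow> nat \<Rightarrow> (('a \<times> 'a \<Rightarrow> complex) \<Rightarrow> complex) set" where
  "growth_space \<alpha> \<tau> l = {f \<in> entire_on \<tau>.
     bdd_above ((\<lambda>\<omega>. cmod (f \<omega>) * exp (- (2 powr (- real l) * dual_norm \<tau> \<omega> powr \<alpha>))) ` Hneg \<tau>)}"

definition has_kernels ::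
    "'t \<Rightarrow> (('a \<times> 'a \<Rightarrow> complex) \<Rightarrow> complex) \<Rightarrow>
     (nat \<Rightarrow> (nat \<Rightarrow> 'a \<times> 'a \<Rightarrow> complex) \<Rightarrow> complex) \<Rightarrow> bool" where
  "has_kernels \<tau> f \<phi> \<longleftrightarrow> (\<forall>n. \<phi> n \<in> sym_tensor_power \<tau> n) \<and>
     (\<forall>\<omega>\<in>Hneg \<tau>. (\<lambda>n. power_pairing n \<omega> (\<phi> n)) sums f \<omega>)"

text \<open>The kernels of \<open>f\<close> are unique, by uniqueness of power series coefficients and polarization.\<close>

definition kernels ::
    "'t \<Rightarrow> (('a \<times> 'a \<Rightarrow> complex) \<Rightarrow> complex) \<Rightarrow>
     (nat \<Rightarrow> (nat \<Rightarrow> 'a \<times> 'a \<Rightarrow> complex) \<Rightarrow> complex)" where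
  "kernels \<tau> f = (THE \<phi>. has_kernels \<tau> f \<phi>)"

definition kernel_norm :: "real \<Rightarrow> 't \<Rightarrow> nat \<Rightarrow> (('a \<times> 'a \<Rightarrow> complex) \<Rightarrow> complex) \<Rightarrow> real" where
  "kernel_norm \<alpha> \<tau> l f =
     (\<Sum>n. fact n powr (1 / \<alpha>) * 2 ^ (l * n) * tensor_norm \<tau> n (kernels \<tau> f n))"

definition kernel_space :: "real \<Rightarrow> 't \<Rightarrow> nat \<Rightarrow> (('a \<times> 'a \<Rightarrow> complex) \<Rightarrow> complex) set" where
  "kernel_space \<alpha> \<tau> l = {f \<in> entire_on \<tau>. \<exists>\<phi>. has_kernels \<tau> f \<phi> \<and>
     summable (\<lambda>n. fact n powr (1 / \<alpha>) * 2 ^ (l * n) * tensor_norm \<tau> n (\<phi> n))}"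


section \<open>Projective limits\<close>

text \<open>\<open>S \<tau> l\<close> is a space of functions on \<open>\<H>\<^sub>-\<^sub>\<tau>\<close> with norm \<open>N \<tau> l\<close>. Functions on \<open>\<Phi>'\<close> are
  extensional, so that they are equal iff they agree on \<open>\<Phi>'\<close>.\<close>

definition proj_lim ::
    "('t \<Rightarrow> nat \<Rightarrow> (('a \<times> 'a \<Rightarrow> complex) \<Rightarrow> complex) set) \<Rightarrow>
     (('a \<times> 'a \<Rightarrow> complex) \<Rightarrow> complex) set" where
  "proj_lim S = {f \<in> extensional Phi_dual. \<forall>\<tau>\<in>T. \<forall>l. restrict f (Hneg \<tau>) \<in> S \<tau> l}"

definition proj_lim_topology ::
    "('t \<Rightarrow> nat \<Rightarrow> (('a \<times> 'a \<Rightarrow> complex) \<Rightarrow> complex) set) \<Rightarrow>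
     ('t \<Rightarrow> nat \<Rightarrow> (('a \<times> 'a \<Rightarrow> complex) \<Rightarrow> complex) \<Rightarrow> real) \<Rightarrow>
     (('a \<times> 'a \<Rightarrow> complex) \<Rightarrow> complex) topology" where
  "proj_lim_topology S N = topology_generated_by
     {{g \<in> proj_lim S. N \<tau> l (\<lambda>\<omega>\<in>Hneg \<tau>. g \<omega> - f \<omega>) < \<epsilon>} | f \<tau> l \<epsilon>.
        f \<in> proj_lim S \<and> \<tau> \<in> T \<and> \<epsilon> > 0}"

definition E_min :: "real \<Rightarrow> (('a \<times> 'a \<Rightarrow> complex) \<Rightarrow> complex) set" where
  "E_min \<alpha> = proj_lim (growth_space \<alpha>)"

definition E_min_topology :: "real \<Rightarrow> (('a \<times> 'a \<Rightarrow> complex) \<Rightarrow> complex) topology" where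
  "E_min_topology \<alpha> = proj_lim_topology (growth_space \<alpha>) (growth_norm \<alpha>)"

definition E_kernel :: "real \<Rightarrow> (('a \<times> 'a \<Rightarrow> complex) \<Rightarrow> complex) set" where
  "E_kernel \<alpha> = proj_lim (kernel_space \<alpha>)"

definition E_kernel_topology :: "real \<Rightarrow> (('a \<times> 'a \<Rightarrow> complex) \<Rightarrow> complex) topology" where
  "E_kernel_topology \<alpha> = proj_lim_topology (kernel_space \<alpha>) (kernel_norm \<alpha>)"

end


section \<open>The standing assumptions\<close>

locale hilbert_rigging = hilbert_family T H ip
  for T :: "'t set"
    and H :: "'t \<Rightarrow> 'a::real_vector set"
    and ip :: "'t \<Rightarrow> 'a \<Rightarrow> 'a \<Rightarrow> real" +
  fixes \<tau>\<^sub>0 :: 't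
  assumes hilbert: "\<tau> \<in> T \<Longrightarrow> real_separable_hilbert (H \<tau>) (ip \<tau>)"
    and directed: "\<tau>1 \<in> T \<Longrightarrow> \<tau>2 \<in> T \<Longrightarrow>
      \<exists>\<tau>3\<in>T. continuously_embedded (H \<tau>3) (ip \<tau>3) (H \<tau>1) (ip \<tau>1) \<and>
             continuously_embedded (H \<tau>3) (ip \<tau>3) (H \<tau>2) (ip \<tau>2)"
    and nuclear: "\<tau>1 \<in> T \<Longrightarrow>
      \<exists>\<tau>2\<in>T. hilbert_schmidt_embedded (H \<tau>2) (ip \<tau>2) (H \<tau>1) (ip \<tau>1)"
    and dense: "\<tau> \<in> T \<Longrightarrow> hilbert_topology (H \<tau>) (ip \<tau>) closure_of (\<Inter>\<sigma>\<in>T. H \<sigma>) = H \<tau>"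
    and center: "\<tau>\<^sub>0 \<in> T"
    and center_embedding: "\<tau> \<in> T \<Longrightarrow> continuously_embedded (H \<tau>) (ip \<tau>) (H \<tau>\<^sub>0) (ip \<tau>\<^sub>0)"

section \<open>The center space inside \<open>\<H>\<^sub>-\<^sub>\<tau>\<close>\<close>

locale pre_hilbert =
  fixes S :: "'a::real_vector set" and ip :: "'a \<Rightarrow> 'a \<Rightarrow> real"
  assumes sub: "subspace S"
    and sym: "\<And>x y. x \<in> S \<Longrightarrow> y \<in> S \<Longrightarrow> ip x y = ip y x"
    and lin: "\<And>x y z a b. x \<in> S \<Longrightarrow> y \<in> S \<Longrightarrow> z \<in> S \<Longrightarrow>
      ip (a *\<^sub>R x + b *\<^sub>R y) z = a * ip x z + b * ip y z"
    and pos: "\<And>x. x \<in> S \<Longrightarrow> x \<noteq> 0 \<Longrightarrow> ip x x > 0"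
begin

lemma closed: "x \<in> S \<Longrightarrow> y \<in> S \<Longrightarrow> a *\<^sub>R x + b *\<^sub>R y \<in> S" "x \<in> S \<Longrightarrow> y \<in> S \<Longrightarrow> x - y \<in> S" "0 \<in> S"
  using sub by (auto simp: subspace_def subspace_diff)

lemma lin_right: "x \<in> S \<Longrightarrow> y \<in> S \<Longrightarrow> z \<in> S \<Longrightarrow> ip z (a *\<^sub>R x + b *\<^sub>R y) = a * ip z x + b * ip z y"
  using lin sym closed by metis

lemma zero: "z \<in> S \<Longrightarrow> ip 0 z = 0"
  using lin[of 0 0 z 0 0] closed by simp

lemma nonneg: "x \<in> S \<Longrightarrow> ip x x \<ge> 0"
  using pos[of x] zero[of 0] closed(3) by (cases "x = 0") auto

lemma cauchy_schwarz:
  assumes "x \<in> S" "y \<in> S"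
  shows "\<bar>ip x y\<bar> \<le> ip_norm ip x * ip_norm ip y"
proof (cases "y = 0")
  case True
  then show ?thesis
    using zero[OF assms(1)] zero[OF closed(3)] sym[OF assms(1) closed(3)] by (simp add: ip_norm_def)
next
  case False
  define t where "t = ip x y / ip y y"
  have p: "ip y y > 0" using pos assms False by auto
  have m: "1 *\<^sub>R x + (-t) *\<^sub>R y \<in> S" using closed assms by blast
  have "0 \<le> ip (1 *\<^sub>R x + (-t) *\<^sub>R y) (1 *\<^sub>R x + (-t) *\<^sub>R y)"
    using nonneg m by blast
  also have "\<dots> = 1 * ip x (1 *\<^sub>R x + (-t) *\<^sub>R y) + (-t) * ip y (1 *\<^sub>R x + (-t) *\<^sub>R y)"
    by (rule lin) (use assms m in auto)
  also have "\<dots> = ip x x - 2 * t * ip x y + t * t * ip y y"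
    unfolding lin_right[OF assms assms(1)] lin_right[OF assms assms(2)]
    using sym[OF assms] by (simp add: algebra_simps)
  also have "\<dots> = ip x x - (ip x y)\<^sup>2 / ip y y"
    using p by (simp add: t_def field_simps power2_eq_square)
  finally have "(ip x y)\<^sup>2 \<le> ip x x * ip y y" using p by (simp add: field_simps)
  then have "sqrt ((ip x y)\<^sup>2) \<le> sqrt (ip x x * ip y y)" by (rule real_sqrt_le_mono)
  then show ?thesis by (simp add: ip_norm_def real_sqrt_mult)
qed

lemma triangle:
  assumes "x \<in> S" "y \<in> S"
  shows "ip_norm ip (x + y) \<le> ip_norm ip x + ip_norm ip y"
proof (rule power2_le_imp_le)
  have m: "1 *\<^sub>R x + 1 *\<^sub>R y \<in> S" using closed assms by blast
  have e: "ip (1 *\<^sub>R x + 1 *\<^sub>R y) (1 *\<^sub>R x + 1 *\<^sub>R y) = ip x x + 2 * ip x y + ip y y"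
    unfolding lin[OF assms m] lin_right[OF assms assms(1)] lin_right[OF assms assms(2)]
    using sym[OF assms] by simp
  have "(ip_norm ip (x + y))\<^sup>2 = ip x x + 2 * ip x y + ip y y"
    using e nonneg[OF m] by (simp add: ip_norm_def)
  also have "\<dots> \<le> ip x x + 2 * (ip_norm ip x * ip_norm ip y) + ip y y"
    using cauchy_schwarz[OF assms] by simp
  also have "\<dots> = (ip_norm ip x + ip_norm ip y)\<^sup>2"
    using nonneg assms by (simp add: ip_norm_def power2_sum)
  finally show "(ip_norm ip (x + y))\<^sup>2 \<le> (ip_norm ip x + ip_norm ip y)\<^sup>2" .
  show "0 \<le> ip_norm ip x + ip_norm ip y" using nonneg assms by (simp add: ip_norm_def)
qed

lemma norm_commute: assumes "x \<in> S" "y \<in> S" shows "ip_norm ip (x - y) = ip_norm ip (y - x)"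
proof -
  have d: "x - y \<in> S" using closed assms by blast
  have "ip ((-1) *\<^sub>R (x - y) + 0 *\<^sub>R 0) ((-1) *\<^sub>R (x - y) + 0 *\<^sub>R 0) = ip (x - y) (x - y)"
    using lin[OF d closed(3), of "(-1) *\<^sub>R (x - y) + 0 *\<^sub>R 0" "-1" 0]
      lin_right[OF d closed(3) d, of "-1" 0] closed(1)[OF d closed(3), of "-1" 0]
    by simp
  then show ?thesis by (simp add: ip_norm_def)
qed

lemma metric: "Metric_space S (dist_on S (\<lambda>x y. ip_norm ip (x - y)))"
proof
  show "0 \<le> dist_on S (\<lambda>x y. ip_norm ip (x - y)) x y" for x y
    using nonneg closed by (auto simp: dist_on_def ip_norm_def)
  show "dist_on S (\<lambda>x y. ip_norm ip (x - y)) x y = dist_on S (\<lambda>x y. ip_norm ip (x - y)) y x" for x y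
    using norm_commute by (auto simp: dist_on_def)
  show "dist_on S (\<lambda>x y. ip_norm ip (x - y)) x y = 0 \<longleftrightarrow> x = y" if "x \<in> S" "y \<in> S" for x y
    using pos[of "x - y"] zero[of 0] closed that by (force simp: dist_on_def ip_norm_def)
  show "dist_on S (\<lambda>x y. ip_norm ip (x - y)) x z
      \<le> dist_on S (\<lambda>x y. ip_norm ip (x - y)) x y + dist_on S (\<lambda>x y. ip_norm ip (x - y)) y z"
    if "x \<in> S" "y \<in> S" "z \<in> S" for x y z
    using triangle[of "x - y" "y - z"] closed that by (auto simp: dist_on_def)
qed

lemma topspace: "topspace (hilbert_topology S ip) = S"
  unfolding hilbert_topology_def topology_on_def
  by (rule Metric_space.topspace_mtopology[OF metric])

lemma lipschitz_continuous_map: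
  assumes P: "Metric_space S' (dist_on S' d')"
    and f: "\<And>x. x \<in> S \<Longrightarrow> f x \<in> S'"
    and C: "\<And>x y. x \<in> S \<Longrightarrow> y \<in> S \<Longrightarrow> d' (f x) (f y) \<le> C * ip_norm ip (x - y)"
  shows "continuous_map (hilbert_topology S ip) (topology_on S' d') f"
proof -
  have "\<exists>\<delta>>0. \<forall>y. y \<in> S \<and> dist_on S (\<lambda>x y. ip_norm ip (x - y)) x y < \<delta> \<longrightarrow> dist_on S' d' (f x) (f y) < \<epsilon>"
    if "x \<in> S" "\<epsilon> > 0" for x \<epsilon>
  proof (intro exI[of _ "\<epsilon> / (\<bar>C\<bar> + 1)"] conjI allI impI)
    show "\<epsilon> / (\<bar>C\<bar> + 1) > 0" using that by simp
    fix y assume y: "y \<in> S \<and> dist_on S (\<lambda>x y. ip_norm ip (x - y)) x y < \<epsilon> / (\<bar>C\<bar> + 1)"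
    then have n: "ip_norm ip (x - y) < \<epsilon> / (\<bar>C\<bar> + 1)" using that by (auto simp: dist_on_def)
    have p: "ip_norm ip (x - y) \<ge> 0" using nonneg closed that y by (simp add: ip_norm_def)
    have "dist_on S' d' (f x) (f y) \<le> C * ip_norm ip (x - y)"
      using C f that y by (simp add: dist_on_def)
    also have "\<dots> \<le> (\<bar>C\<bar> + 1) * ip_norm ip (x - y)"
      using p by (intro mult_right_mono) auto
    also have "\<dots> < \<epsilon>" using n by (simp add: field_simps)
    finally show "dist_on S' d' (f x) (f y) < \<epsilon>" .
  qed
  then show ?thesis
    unfolding hilbert_topology_def topology_on_def
    using Metric_space.metric_continuous_map[OF metric P] f by (simp add: image_subset_iff)
qed

end

lemma real_separable_hilbert_imp_pre_hilbert:
  "real_separable_hilbert S ip \<Longrightarrow> pre_hilbert S ip"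
  unfolding real_separable_hilbert_def by unfold_locales auto

lemma pre_hilbert_complexification:
  assumes "pre_hilbert S ip"
  shows "pre_hilbert (S \<times> S) (\<lambda>x y. Re (cinner ip x y))"
proof -
  interpret pre_hilbert S ip by fact
  show ?thesis
  proof
    show "subspace (S \<times> S)" using sub by (simp add: subspace_Times)
  next
    show "Re (cinner ip x y) = Re (cinner ip y x)" if "x \<in> S \<times> S" "y \<in> S \<times> S" for x y
      using that sym by (auto simp: cinner_def)
  next
    show "Re (cinner ip (a *\<^sub>R x + b *\<^sub>R y) z) = a * Re (cinner ip x z) + b * Re (cinner ip y z)"
      if "x \<in> S \<times> S" "y \<in> S \<times> S" "z \<in> S \<times> S" for x y z a b
      using that lin by (auto simp: cinner_def algebra_simps)
  next
    show "Re (cinner ip x x) > 0" if xS: "x \<in> S \<times> S" "x \<noteq> 0" for x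
    proof -
      obtain u v where x: "x = (u, v)" "u \<in> S" "v \<in> S" using xS by auto
      then have "u \<noteq> 0 \<or> v \<noteq> 0" using xS by (auto simp: zero_prod_def)
      then show ?thesis
        using x pos[of u] pos[of v] nonneg[of u] nonneg[of v] by (auto simp: cinner_def)
    qed
  qed
qed

context hilbert_rigging
begin

lemma center_in_Hneg:
  assumes "\<tau> \<in> T" and h: "h \<in> Hc \<tau>\<^sub>0"
  shows "(\<lambda>\<xi>\<in>Phi. cinner (ip \<tau>\<^sub>0) h (cconj \<xi>)) \<in> Hneg \<tau>"
proof -
  interpret A: pre_hilbert "H \<tau>" "ip \<tau>"
    using assms hilbert real_separable_hilbert_imp_pre_hilbert by blast
  interpret B: pre_hilbert "H \<tau>\<^sub>0" "ip \<tau>\<^sub>0"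
    using center hilbert real_separable_hilbert_imp_pre_hilbert by blast
  interpret C: pre_hilbert "Hc \<tau>" "\<lambda>x y. Re (cinner (ip \<tau>) x y)"
    unfolding Hc_def using pre_hilbert_complexification A.pre_hilbert_axioms by blast
  have sub: "H \<tau> \<subseteq> H \<tau>\<^sub>0"
    and emb: "continuous_map (hilbert_topology (H \<tau>) (ip \<tau>)) (hilbert_topology (H \<tau>\<^sub>0) (ip \<tau>\<^sub>0)) (\<lambda>x. x)"
    using center_embedding[OF assms(1)] by (auto simp: continuously_embedded_def)
  have top: "topspace (Hc_topology \<tau>) = Hc \<tau>"
    using C.topspace by (simp add: Hc_topology_def)
  have proj: "continuous_map (Hc_topology \<tau>) (hilbert_topology (H \<tau>) (ip \<tau>)) f"
    if "f = fst \<or> f = snd" for f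
    unfolding Hc_topology_def hilbert_topology_def[of "H \<tau>"]
  proof (rule C.lipschitz_continuous_map[OF A.metric, where C = 1])
    show "f x \<in> H \<tau>" if "x \<in> Hc \<tau>" for x
      using that \<open>f = fst \<or> f = snd\<close> by (auto simp: Hc_def)
    show "ip_norm (ip \<tau>) (f x - f y) \<le> 1 * cnorm (ip \<tau>) (x - y)" if "x \<in> Hc \<tau>" "y \<in> Hc \<tau>" for x y
      using that \<open>f = fst \<or> f = snd\<close> A.nonneg A.closed(2)
      by (auto simp: Hc_def cinner_def ip_norm_def)
  qed
  have R: "Metric_space (UNIV :: real set) (dist_on UNIV dist)"
    unfolding dist_on_def by simp (rule Met_TC.Metric_space_axioms)
  have bdd: "continuous_map (hilbert_topology (H \<tau>\<^sub>0) (ip \<tau>\<^sub>0)) euclidean (\<lambda>x. ip \<tau>\<^sub>0 u x)"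
    if u: "u \<in> H \<tau>\<^sub>0" for u
  proof -
    have "continuous_map (hilbert_topology (H \<tau>\<^sub>0) (ip \<tau>\<^sub>0)) (topology_on UNIV dist) (\<lambda>x. ip \<tau>\<^sub>0 u x)"
    proof (rule B.lipschitz_continuous_map[OF R, where C = "ip_norm (ip \<tau>\<^sub>0) u"])
      fix x y assume xy: "x \<in> H \<tau>\<^sub>0" "y \<in> H \<tau>\<^sub>0"
      have "ip \<tau>\<^sub>0 u (x - y) = ip \<tau>\<^sub>0 u x - ip \<tau>\<^sub>0 u y"
        using B.lin_right[OF xy u, of 1 "-1"] by simp
      then show "dist (ip \<tau>\<^sub>0 u x) (ip \<tau>\<^sub>0 u y) \<le> ip_norm (ip \<tau>\<^sub>0) u * ip_norm (ip \<tau>\<^sub>0) (x - y)"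
        using B.cauchy_schwarz[OF u B.closed(2)[OF xy]] by (simp add: dist_real_def)
    qed simp
    moreover have "topology_on (UNIV :: real set) dist = euclidean"
      unfolding topology_on_def dist_on_def by simp
    ultimately show ?thesis by simp
  qed
  have cont: "continuous_map (Hc_topology \<tau>) euclidean (\<lambda>\<xi>. ip \<tau>\<^sub>0 u (f \<xi>))"
    if "u \<in> H \<tau>\<^sub>0" "f = fst \<or> f = snd" for u f
    using continuous_map_compose[OF continuous_map_compose[OF proj[OF that(2)] emb] bdd[OF that(1)]]
    by (simp add: o_def)
  obtain u v where uv: "h = (u, v)" "u \<in> H \<tau>\<^sub>0" "v \<in> H \<tau>\<^sub>0" using h by (auto simp: Hc_def)
  have neg: "ip \<tau>\<^sub>0 z (- x) = - ip \<tau>\<^sub>0 z x" if "z \<in> H \<tau>\<^sub>0" "x \<in> H \<tau>\<^sub>0" for z x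
    using B.lin_right[OF that(2) that(2) that(1), of "-1" 0] by simp
  have c: "cinner (ip \<tau>\<^sub>0) h (cconj \<xi>) =
      of_real (ip \<tau>\<^sub>0 u (fst \<xi>)) - of_real (ip \<tau>\<^sub>0 v (snd \<xi>)) +
      \<i> * (of_real (ip \<tau>\<^sub>0 v (fst \<xi>)) + of_real (ip \<tau>\<^sub>0 u (snd \<xi>)))" if "\<xi> \<in> Hc \<tau>" for \<xi>
    using that uv sub neg[OF _ subsetD[OF sub]]
    by (auto simp: cinner_def cconj_def Hc_def complex_eq_iff)
  define w where "w = (\<lambda>\<xi>\<in>Hc \<tau>. cinner (ip \<tau>\<^sub>0) h (cconj \<xi>))"
  have "continuous_map (Hc_topology \<tau>) euclidean
     (\<lambda>\<xi>. complex_of_real (ip \<tau>\<^sub>0 u (fst \<xi>)) - of_real (ip \<tau>\<^sub>0 v (snd \<xi>)) +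
      \<i> * (of_real (ip \<tau>\<^sub>0 v (fst \<xi>)) + of_real (ip \<tau>\<^sub>0 u (snd \<xi>))))"
  proof -
    have r: "continuous_map (Hc_topology \<tau>) euclidean (\<lambda>\<xi>. complex_of_real (g \<xi>))"
      if "continuous_map (Hc_topology \<tau>) euclidean g" for g
      using continuous_map_compose[OF that, of euclidean complex_of_real]
      by (simp add: o_def continuous_on_of_real continuous_on_id)
    have i: "continuous_map (Hc_topology \<tau>) euclidean (\<lambda>\<xi>. \<i> * g \<xi>)"
      if "continuous_map (Hc_topology \<tau>) euclidean g" for g
      using continuous_map_compose[OF that, of euclidean "\<lambda>z. \<i> * z"]
      by (simp add: o_def continuous_on_mult_left continuous_on_id)
    show ?thesis
      by (intro continuous_map_add continuous_map_diff r i cont uv) auto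
  qed
  then have "continuous_map (Hc_topology \<tau>) euclidean w"
    by (rule continuous_map_eq) (simp add: top w_def c)
  moreover have "w (cscale a x + cscale b y) = a * w x + b * w y"
    if xy: "x \<in> Hc \<tau>" "y \<in> Hc \<tau>" for x y a b
  proof -
    obtain x1 x2 y1 y2 where e: "x = (x1, x2)" "y = (y1, y2)"
      "x1 \<in> H \<tau>" "x2 \<in> H \<tau>" "y1 \<in> H \<tau>" "y2 \<in> H \<tau>" using xy by (auto simp: Hc_def)
    have s: "r *\<^sub>R p \<in> H \<tau>" "p + q \<in> H \<tau>" "p - q \<in> H \<tau>" if "p \<in> H \<tau>" "q \<in> H \<tau>" for p q r
      using A.sub that by (auto simp: subspace_def subspace_diff)
    have m: "cscale a x + cscale b y \<in> Hc \<tau>"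
      using e s by (simp add: cscale_def Hc_def)
    have l: "ip \<tau>\<^sub>0 z (p + q) = ip \<tau>\<^sub>0 z p + ip \<tau>\<^sub>0 z q" "ip \<tau>\<^sub>0 z (p - q) = ip \<tau>\<^sub>0 z p - ip \<tau>\<^sub>0 z q"
      "ip \<tau>\<^sub>0 z (r *\<^sub>R p) = r * ip \<tau>\<^sub>0 z p"
      if "z \<in> H \<tau>\<^sub>0" "p \<in> H \<tau>" "q \<in> H \<tau>" for z p q r
      using B.lin_right[of p q z 1 1] B.lin_right[of p q z 1 "-1"] B.lin_right[of p q z r 0]
        that sub by auto
    have w: "w \<xi> = of_real (ip \<tau>\<^sub>0 u (fst \<xi>)) - of_real (ip \<tau>\<^sub>0 v (snd \<xi>)) +
      \<i> * (of_real (ip \<tau>\<^sub>0 v (fst \<xi>)) + of_real (ip \<tau>\<^sub>0 u (snd \<xi>)))" if "\<xi> \<in> Hc \<tau>" for \<xi>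
      using c[OF that] that by (simp add: w_def)
    show ?thesis
      unfolding w[OF m] w[OF xy(1)] w[OF xy(2)]
      using e uv s by (simp add: cscale_def l complex_eq_iff) (simp add: algebra_simps)
  qed
  ultimately have "w \<in> dual \<tau>" by (auto simp: dual_def w_def)
  moreover have "restrict w Phi = (\<lambda>\<xi>\<in>Phi. cinner (ip \<tau>\<^sub>0) h (cconj \<xi>))"
    using assms(1) by (auto simp: w_def Phi_def restrict_def fun_eq_iff)
  ultimately show ?thesis unfolding Hneg_def by (metis image_eqI)
qed

end

end

theory Submission
  imports Defs "HOL-Complex_Analysis.Cauchy_Integral_Formula"
begin

text \<open>The two families of norms dominate each other, each at the price of a change of the indices.

  From kernels to growth: by the Riesz representation \<open>\<omega> \<in> \<H>\<^sub>-\<^sub>\<tau>\<close> is a multiple of the functional of a unit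
  vector, so the diagonal value of a kernel is at most \<open>\<parallel>\<omega>\<parallel>\<^sup>n\<close> times its Hilbert-Schmidt norm, and
  \<open>y\<^sup>n \<le> n! e\<^sup>y\<close> turns the weights \<open>(n!)\<^sup>1\<^sup>/\<^sup>\<alpha> 2\<^sup>l\<^sup>n\<close> into an exponential bound of order \<open>\<alpha>\<close>
  (\<open>kernel_space_growth\<close>). Here \<open>\<tau>\<close> stays the same.

  From growth to kernels: the kernels must be the Taylor coefficients of \<open>f\<close>. They are obtained as
  iterated directional derivatives at the origin. These are linear in their directions and commute,
  because \<open>f\<close> is holomorphic along complex lines and bounded on balls. Cauchy's estimate at the
  radius \<open>R\<close> with \<open>R\<^sup>\<alpha> = 2\<^sup>l\<^sup>' n\<close> bounds the \<open>n\<close>-th coefficient, as a multilinear form, by the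
  growth norm of \<open>f\<close> times \<open>C\<^sup>n 2\<^sup>-\<^sup>l\<^sup>'\<^sup>n\<^sup>/\<^sup>\<alpha> (n!)\<^sup>-\<^sup>1\<^sup>/\<^sup>\<alpha>\<close> for a constant \<open>C\<close>. A bounded form need not be Hilbert-Schmidt, and this is where
  nuclearity enters: if \<open>\<H>\<^sub>\<sigma> \<subseteq> \<H>\<^sub>\<tau>\<close> is Hilbert-Schmidt, then so is \<open>\<H>\<^sub>-\<^sub>\<tau> \<subseteq> \<H>\<^sub>-\<^sub>\<sigma>\<close>
  (\<open>hilbert_schmidt_dual\<close>), and a bounded form on \<open>\<H>\<^sub>-\<^sub>\<sigma>\<close> restricts to a Hilbert-Schmidt form on
  \<open>\<H>\<^sub>-\<^sub>\<tau>\<close>. With \<open>l'\<close> large the resulting series of weighted norms is geometric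
  (\<open>growth_space_kernel\<close>).

  The kernel norm refers to the kernels of a function, so their uniqueness is needed too. It
  follows from uniqueness of power series along lines and polarization (\<open>has_kernels_unique\<close>).
  Equality of the spaces is then immediate, and equality of the topologies follows since both norms
  satisfy the triangle inequality.\<close>

section \<open>Hilbert spaces on a carrier\<close>

context pre_hilbert
begin

lemma norm_nonneg: "x \<in> S \<Longrightarrow> 0 \<le> ip_norm ip x"
  using nonneg by (simp add: ip_norm_def)

lemma norm_sq: "x \<in> S \<Longrightarrow> (ip_norm ip x)\<^sup>2 = ip x x"
  using nonneg by (simp add: ip_norm_def)

lemma mem_add: "x \<in> S \<Longrightarrow> y \<in> S \<Longrightarrow> x + y \<in> S"
  and mem_scale: "x \<in> S \<Longrightarrow> r *\<^sub>R x \<in> S"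
  using sub by (auto simp: subspace_def)

lemma ip_add_left: "x \<in> S \<Longrightarrow> y \<in> S \<Longrightarrow> z \<in> S \<Longrightarrow> ip (x + y) z = ip x z + ip y z"
  using lin[of x y z 1 1] by simp

lemma ip_diff_left: "x \<in> S \<Longrightarrow> y \<in> S \<Longrightarrow> z \<in> S \<Longrightarrow> ip (x - y) z = ip x z - ip y z"
  using lin[of x y z 1 "-1"] by simp

lemma ip_scale_left: "x \<in> S \<Longrightarrow> z \<in> S \<Longrightarrow> ip (r *\<^sub>R x) z = r * ip x z"
  using lin[of x x z r 0] by simp

lemma ip_add_right: "x \<in> S \<Longrightarrow> y \<in> S \<Longrightarrow> z \<in> S \<Longrightarrow> ip z (x + y) = ip z x + ip z y"
  using lin_right[of x y z 1 1] by simp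

lemma ip_diff_right: "x \<in> S \<Longrightarrow> y \<in> S \<Longrightarrow> z \<in> S \<Longrightarrow> ip z (x - y) = ip z x - ip z y"
  using lin_right[of x y z 1 "-1"] by simp

lemma ip_scale_right: "x \<in> S \<Longrightarrow> z \<in> S \<Longrightarrow> ip z (r *\<^sub>R x) = r * ip z x"
  using lin_right[of x x z r 0] by simp

lemmas ip_simps = ip_add_left ip_diff_left ip_scale_left ip_add_right ip_diff_right ip_scale_right
  mem_add mem_scale closed(2,3)

lemma norm_scale: "x \<in> S \<Longrightarrow> ip_norm ip (r *\<^sub>R x) = \<bar>r\<bar> * ip_norm ip x"
  by (simp add: ip_norm_def ip_simps real_sqrt_mult flip: mult.assoc power2_eq_square)

lemma norm_zero: "ip_norm ip 0 = 0"
  using zero[OF closed(3)] by (simp add: ip_norm_def)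

lemma norm_eq_0: "x \<in> S \<Longrightarrow> ip_norm ip x = 0 \<Longrightarrow> x = 0"
  using pos[of x] by (force simp: ip_norm_def)

lemma closure_approx:
  assumes "x \<in> hilbert_topology S ip closure_of A" "\<epsilon> > 0"
  obtains y where "y \<in> A" "y \<in> S" "ip_norm ip (x - y) < \<epsilon>"
proof -
  interpret M: Metric_space S "dist_on S (\<lambda>x y. ip_norm ip (x - y))" by (rule metric)
  have "x \<in> M.mtopology closure_of A"
    using assms(1) by (simp add: hilbert_topology_def topology_on_def)
  then obtain y where "y \<in> A" "y \<in> M.mball x \<epsilon>"
    using assms(2) M.metric_closure_of[of A] by auto
  then show thesis using that[of y] by (auto simp: dist_on_def)
qed

text \<open>Continuity at the origin bounds a positively homogeneous function on a small ball, and
  scaling carries the bound to the whole space.\<close>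

lemma homogeneous_bounded:
  assumes hom: "\<And>x r. x \<in> S \<Longrightarrow> q (r *\<^sub>R x) = \<bar>r\<bar> * q x"
    and \<delta>: "\<delta> > 0" "\<And>x. x \<in> S \<Longrightarrow> ip_norm ip x < \<delta> \<Longrightarrow> q x < 1"
  obtains M :: real where "M \<ge> 0" "\<And>x. x \<in> S \<Longrightarrow> q x \<le> M * ip_norm ip x"
proof (rule that)
  show "2 / \<delta> \<ge> 0" using \<delta>(1) by simp
  fix x assume x: "x \<in> S"
  show "q x \<le> 2 / \<delta> * ip_norm ip x"
  proof (cases "x = 0")
    case True
    then show ?thesis using hom[OF closed(3), of 0] norm_zero by simp
  next
    case False
    define n where "n = ip_norm ip x"
    have n: "n > 0" using False norm_eq_0[OF x] norm_nonneg[OF x] by (force simp: n_def)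
    have "ip_norm ip ((\<delta> / (2 * n)) *\<^sub>R x) < \<delta>"
      using n \<delta>(1) norm_scale[OF x] by (simp flip: n_def)
    then have "q ((\<delta> / (2 * n)) *\<^sub>R x) < 1" using \<delta>(2) mem_scale[OF x] by blast
    then have "\<delta> / (2 * n) * q x < 1" using hom[OF x] n \<delta>(1) by simp
    then show ?thesis using n \<delta>(1) by (simp add: field_simps flip: n_def)
  qed
qed

lemma continuous_map_ball:
  assumes f: "continuous_map (hilbert_topology S ip) X f" and U: "openin X U" "f 0 \<in> U"
  obtains \<delta> where "\<delta> > 0" "\<And>x. x \<in> S \<Longrightarrow> ip_norm ip x < \<delta> \<Longrightarrow> f x \<in> U"
proof -
  interpret M: Metric_space S "dist_on S (\<lambda>x y. ip_norm ip (x - y))" by (rule metric)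
  have "openin M.mtopology {x \<in> topspace M.mtopology. f x \<in> U}"
    using f U unfolding hilbert_topology_def topology_on_def continuous_map_def by auto
  then obtain \<delta> where \<delta>: "\<delta> > 0" "M.mball 0 \<delta> \<subseteq> {x \<in> topspace M.mtopology. f x \<in> U}"
    unfolding M.openin_mtopology using U(2) closed(3) by auto
  show thesis
  proof (rule that[OF \<delta>(1)])
    fix x assume "x \<in> S" "ip_norm ip x < \<delta>"
    then have "x \<in> M.mball 0 \<delta>"
      using closed(3) norm_commute[of x 0] by (auto simp: dist_on_def)
    then show "f x \<in> U" using \<delta>(2) by auto
  qed
qed

text \<open>The Riesz representation: a minimizing sequence of \<open>\<langle>x, x\<rangle> - 2 g x\<close> is Cauchy by the
  parallelogram law, and stationarity at its limit is the representation.\<close>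

lemma riesz_representation:
  assumes complete: "Metric_space.mcomplete S (dist_on S (\<lambda>x y. ip_norm ip (x - y)))"
    and g: "\<And>x y a b. x \<in> S \<Longrightarrow> y \<in> S \<Longrightarrow> g (a *\<^sub>R x + b *\<^sub>R y) = a * g x + b * g y"
    and M: "\<And>x. x \<in> S \<Longrightarrow> \<bar>g x\<bar> \<le> M * ip_norm ip x"
  obtains h where "h \<in> S" "\<And>x. x \<in> S \<Longrightarrow> g x = ip x h"
proof -
  interpret M: Metric_space S "dist_on S (\<lambda>x y. ip_norm ip (x - y))" by (rule metric)
  define J where "J x = ip x x - 2 * g x" for x
  have g_simps: "g (x + y) = g x + g y" "g (r *\<^sub>R x) = r * g x" if "x \<in> S" "y \<in> S" for x y r
    using g[OF that, of 1 1] g[OF that, of r 0] by auto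
  have lower: "J x \<ge> - M\<^sup>2" if "x \<in> S" for x
  proof -
    have "0 \<le> (ip_norm ip x - M)\<^sup>2" by simp
    also have "\<dots> = ip x x - 2 * (M * ip_norm ip x) + M\<^sup>2"
      using norm_sq[OF that] by (simp add: power2_diff algebra_simps)
    also have "\<dots> \<le> J x + M\<^sup>2" using M[OF that] by (simp add: J_def)
    finally show ?thesis by simp
  qed
  define m where "m = Inf (J ` S)"
  have bdd: "bdd_below (J ` S)" using lower by (intro bdd_belowI[where m = "- M\<^sup>2"]) auto
  have m: "m \<le> J x" if "x \<in> S" for x unfolding m_def using bdd that by (intro cInf_lower) auto
  have "\<exists>x\<in>S. J x < m + inverse (real (Suc n))" for n
    using cInf_lessD[of "J ` S" "m + inverse (real (Suc n))"] closed(3) unfolding m_def by auto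
  then obtain x where x: "x n \<in> S" "J (x n) < m + inverse (real (Suc n))" for n
    by metis
  have par: "ip (u - v) (u - v) = 2 * J u + 2 * J v - 4 * J ((1/2) *\<^sub>R (u + v))" if "u \<in> S" "v \<in> S" for u v
    using that sym[OF that] by (simp add: J_def ip_simps g_simps algebra_simps)
  have cauchy: "(ip_norm ip (x n - x k))\<^sup>2 < 2 * inverse (real (Suc n)) + 2 * inverse (real (Suc k))" for n k
  proof -
    have "m \<le> J ((1/2) *\<^sub>R (x n + x k))" by (intro m mem_scale mem_add x)
    then show ?thesis
      using par[OF x(1) x(1), of n k] x(2)[of n] x(2)[of k] norm_sq[OF closed(2)[OF x(1) x(1)], of n k] by simp
  qed
  have "M.MCauchy x"
    unfolding M.MCauchy_def
  proof (intro conjI allI impI)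
    show "range x \<subseteq> S" using x by auto
    fix \<epsilon> :: real assume "\<epsilon> > 0"
    then obtain N where N: "inverse (real (Suc N)) < \<epsilon>\<^sup>2 / 4"
      using reals_Archimedean[of "\<epsilon>\<^sup>2 / 4"] by auto
    have "dist_on S (\<lambda>x y. ip_norm ip (x - y)) (x n) (x k) < \<epsilon>" if "N \<le> n" "N \<le> k" for n k
    proof -
      have "inverse (real (Suc n)) \<le> inverse (real (Suc N))" "inverse (real (Suc k)) \<le> inverse (real (Suc N))"
        using that by (auto simp: field_simps)
      then have "(ip_norm ip (x n - x k))\<^sup>2 < \<epsilon>\<^sup>2" using cauchy[of n k] N by linarith
      then show ?thesis
        using \<open>\<epsilon> > 0\<close> x power2_less_imp_less[of "ip_norm ip (x n - x k)" \<epsilon>] by (simp add: dist_on_def)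
    qed
    then show "\<exists>N. \<forall>n n'. N \<le> n \<longrightarrow> N \<le> n' \<longrightarrow> dist_on S (\<lambda>x y. ip_norm ip (x - y)) (x n) (x n') < \<epsilon>"
      by blast
  qed
  then obtain h where "limitin M.mtopology x h sequentially"
    using complete unfolding M.mcomplete_def by blast
  then have h: "h \<in> S" and "(\<lambda>n. dist_on S (\<lambda>x y. ip_norm ip (x - y)) (x n) h) \<longlonglongrightarrow> 0"
    by (auto simp: M.limitin_metric_dist_null)
  then have lim: "(\<lambda>n. ip_norm ip (x n - h)) \<longlonglongrightarrow> 0" using x by (simp add: dist_on_def)
  have stationary: "(ip y (x n) - g y)\<^sup>2 \<le> ip y y * inverse (real (Suc n))" if y: "y \<in> S" for y n
  proof (cases "y = 0")
    case True
    then show ?thesis using zero[OF x(1)] g_simps(2)[OF y y, of 0] zero[OF closed(3)] by simp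
  next
    case False
    define c where "c = ip y (x n) - g y"
    define t where "t = - c / ip y y"
    have p: "ip y y > 0" using pos y False by blast
    have "m \<le> J (x n + t *\<^sub>R y)" by (intro m mem_add mem_scale x y)
    also have "\<dots> = J (x n) + 2 * t * c + t\<^sup>2 * ip y y"
      using y x(1)[of n] sym[OF y x(1)[of n]]
      by (simp add: J_def ip_simps g_simps algebra_simps c_def power2_eq_square)
    also have "\<dots> = J (x n) - c\<^sup>2 / ip y y"
      using p by (simp add: t_def power2_eq_square field_simps)
    finally have "c\<^sup>2 / ip y y \<le> inverse (real (Suc n))" using x(2)[of n] by linarith
    then show ?thesis using p by (simp add: c_def pos_divide_le_eq mult.commute)
  qed
  show thesis
  proof (rule that[OF h])
    fix y assume y: "y \<in> S"
    have "(\<lambda>n. (ip y (x n) - g y)\<^sup>2) \<longlonglongrightarrow> 0"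
    proof (rule tendsto_sandwich[OF _ _ tendsto_const])
      show "(\<lambda>n. ip y y * inverse (real (Suc n))) \<longlonglongrightarrow> 0"
        by (rule tendsto_mult_right_zero) (rule LIMSEQ_inverse_real_of_nat)
    qed (use stationary[OF y] in auto)
    then have 1: "(\<lambda>n. ip y (x n) - g y) \<longlonglongrightarrow> 0"
      by (simp add: tendsto_power_zero tendsto_null_power)
    have "(\<lambda>n. ip y (x n - h)) \<longlonglongrightarrow> 0"
    proof (rule Lim_null_comparison)
      show "\<forall>\<^sub>F n in sequentially. norm (ip y (x n - h)) \<le> ip_norm ip y * ip_norm ip (x n - h)"
        using cauchy_schwarz[OF y] x h closed(2) by auto
      show "(\<lambda>n. ip_norm ip y * ip_norm ip (x n - h)) \<longlonglongrightarrow> 0"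
        by (rule tendsto_mult_right_zero[OF lim])
    qed
    from tendsto_diff[OF 1 this] have "(\<lambda>n. ip y h - g y) \<longlonglongrightarrow> 0"
      using y x h by (simp add: ip_simps)
    then show "g y = ip y h" by (simp add: LIMSEQ_const_iff)
  qed
qed

end


section \<open>Complexified Hilbert spaces\<close>

context pre_hilbert
begin

interpretation C: pre_hilbert "S \<times> S" "\<lambda>x y. Re (cinner ip x y)"
  by (rule pre_hilbert_complexification) (rule pre_hilbert_axioms)

lemma cscale_mem: "x \<in> S \<times> S \<Longrightarrow> cscale c x \<in> S \<times> S"
  by (auto simp: cscale_def ip_simps)

lemma cinner_cscale_left:
  "x \<in> S \<times> S \<Longrightarrow> y \<in> S \<times> S \<Longrightarrow> cinner ip (cscale c x) y = c * cinner ip x y"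
  by (auto simp: cscale_def cinner_def ip_simps complex_eq_iff algebra_simps)

lemma cinner_add_left:
  "x \<in> S \<times> S \<Longrightarrow> y \<in> S \<times> S \<Longrightarrow> z \<in> S \<times> S \<Longrightarrow> cinner ip (x + y) z = cinner ip x z + cinner ip y z"
  by (auto simp: cinner_def ip_simps complex_eq_iff algebra_simps)

lemma cinner_commute: "x \<in> S \<times> S \<Longrightarrow> y \<in> S \<times> S \<Longrightarrow> cinner ip y x = cnj (cinner ip x y)"
  using sym by (auto simp: cinner_def complex_eq_iff)

lemma cinner_self: "x \<in> S \<times> S \<Longrightarrow> cinner ip x x = of_real ((cnorm ip x)\<^sup>2)"
  using sym C.norm_sq[of x] by (auto simp: cinner_def complex_eq_iff)

lemma cnorm_cscale: "x \<in> S \<times> S \<Longrightarrow> cnorm ip (cscale c x) = cmod c * cnorm ip x"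
proof -
  assume x: "x \<in> S \<times> S"
  have "cinner ip x (cscale c x) = cnj (cinner ip (cscale c x) x)"
    using cinner_commute[OF cscale_mem[OF x] x] .
  then have "cinner ip (cscale c x) (cscale c x) = c * cnj c * cnj (cinner ip x x)"
    using cinner_cscale_left[OF x cscale_mem[OF x], of c] cinner_cscale_left[OF x x, of c] by simp
  also have "\<dots> = of_real ((cmod c)\<^sup>2 * Re (cinner ip x x))"
    using cinner_self[OF x] by (simp add: complex_norm_square[symmetric])
  finally show ?thesis by (simp add: ip_norm_def real_sqrt_mult)
qed

lemma cinner_cauchy_schwarz:
  assumes "x \<in> S \<times> S" "y \<in> S \<times> S"
  shows "cmod (cinner ip x y) \<le> cnorm ip x * cnorm ip y"
proof -
  \<comment> \<open>Rotating \<open>x\<close> by \<open>c\<close> makes the inner product real, which leaves the real inequality.\<close>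
  define c where "c = cnj (sgn (cinner ip x y))"
  have c: "cmod c \<le> 1" by (simp add: c_def norm_sgn)
  have "c * cinner ip x y = of_real (cmod (cinner ip x y))"
    by (cases "cinner ip x y = 0")
       (auto simp: c_def sgn_eq complex_norm_square[symmetric] field_simps power2_eq_square)
  then have "cmod (cinner ip x y) = Re (cinner ip (cscale c x) y)"
    using assms by (simp add: cinner_cscale_left)
  also have "\<dots> \<le> cnorm ip (cscale c x) * cnorm ip y"
    using C.cauchy_schwarz[OF cscale_mem[OF assms(1)] assms(2), of c] by linarith
  also have "\<dots> \<le> cnorm ip x * cnorm ip y"
    using c C.norm_nonneg assms by (simp add: cnorm_cscale mult_left_le_one_le mult_right_mono)
  finally show ?thesis .
qed

lemma cinner_sum_left:
  assumes "finite F" "\<And>e. e \<in> F \<Longrightarrow> u e \<in> S \<times> S" "y \<in> S \<times> S"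
  shows "(\<Sum>e\<in>F. u e) \<in> S \<times> S \<and> cinner ip (\<Sum>e\<in>F. u e) y = (\<Sum>e\<in>F. cinner ip (u e) y)"
  using assms(1,2)
proof (induction F rule: finite_induct)
  case empty
  then show ?case
    using C.closed(3) cinner_cscale_left[OF assms(3) assms(3), of 0] by (simp add: cscale_def zero_prod_def)
next
  case (insert e F)
  then show ?case using assms(3) by (simp only: sum.insert C.mem_add cinner_add_left insert_iff simp_thms)
qed

lemma bessel_inequality:
  assumes F: "finite F" "F \<subseteq> S \<times> S" "corthonormal ip F" and x: "x \<in> S \<times> S"
  shows "(\<Sum>e\<in>F. (cmod (cinner ip x e))\<^sup>2) \<le> (cnorm ip x)\<^sup>2"
proof -
  define s where "s = (\<Sum>e\<in>F. (cmod (cinner ip x e))\<^sup>2)"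
  define p where "p = (\<Sum>e\<in>F. cscale (cinner ip x e) e)"
  have m: "cscale (cinner ip x e) e \<in> S \<times> S" if "e \<in> F" for e by (rule cscale_mem[OF subsetD[OF F(2) that]])
  have p: "p \<in> S \<times> S"
    unfolding p_def by (rule conjunct1[OF cinner_sum_left[OF F(1) m x]])
  have left: "cinner ip p y = (\<Sum>e\<in>F. cinner ip x e * cinner ip e y)" if "y \<in> S \<times> S" for y
  proof -
    have "cinner ip p y = (\<Sum>e\<in>F. cinner ip (cscale (cinner ip x e) e) y)"
      unfolding p_def by (rule conjunct2[OF cinner_sum_left[OF F(1) m that]])
    then show ?thesis using cinner_cscale_left[OF subsetD[OF F(2)] that] by simp
  qed
  have px: "cinner ip p x = of_real s"
    unfolding left[OF x] s_def of_real_sum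
    by (intro sum.cong refl) (simp only: cinner_commute[OF x subsetD[OF F(2)]] complex_norm_square)
  have pe: "cinner ip p e = cinner ip x e" if e: "e \<in> F" for e
  proof -
    have "cinner ip p e = (\<Sum>e'\<in>F. if e' = e then cinner ip x e else 0)"
      unfolding left[OF subsetD[OF F(2) e]] using F(3) e
      by (intro sum.cong) (auto simp: corthonormal_def)
    then show ?thesis using F(1) e by simp
  qed
  have pp: "cinner ip p p = of_real s"
    unfolding left[OF p] s_def of_real_sum
    by (intro sum.cong refl) (simp only: cinner_commute[OF p subsetD[OF F(2)]] pe complex_norm_square)
  have "0 \<le> Re (cinner ip (x - p) (x - p))" by (rule C.nonneg[OF C.closed(2)[OF x p]])
  also have "\<dots> = Re (cinner ip x x) - 2 * Re (cinner ip p x) + Re (cinner ip p p)"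
    using C.sym[OF x p]
    by (simp only: C.ip_diff_left[OF x p C.closed(2)[OF x p]] C.ip_diff_right[OF x p x] C.ip_diff_right[OF x p p])
  also have "\<dots> = (cnorm ip x)\<^sup>2 - s" using C.norm_sq[OF x] px pp by simp
  finally show ?thesis by (simp add: s_def)
qed

lemma ip_sum_left:
  assumes "finite F" "\<And>e. e \<in> F \<Longrightarrow> u e \<in> S" "y \<in> S"
  shows "(\<Sum>e\<in>F. u e) \<in> S \<and> ip (\<Sum>e\<in>F. u e) y = (\<Sum>e\<in>F. ip (u e) y)"
  using assms by (induction F rule: finite_induct) (auto simp: zero closed(3) ip_simps)

lemma orthonormal_combination:
  assumes "finite F" "F \<subseteq> S" "\<And>x y. x \<in> F \<Longrightarrow> y \<in> F \<Longrightarrow> ip x y = (if x = y then 1 else 0)"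
  shows "ip (\<Sum>b\<in>F. u b *\<^sub>R b) (\<Sum>b\<in>F. u b *\<^sub>R b) = (\<Sum>b\<in>F. (u b)\<^sup>2)"
proof -
  define x where "x = (\<Sum>b\<in>F. u b *\<^sub>R b)"
  have m: "u b *\<^sub>R b \<in> S" if "b \<in> F" for b using that assms mem_scale by blast
  have x: "x \<in> S" unfolding x_def by (rule conjunct1[OF ip_sum_left[OF assms(1) m closed(3)]])
  have left: "ip x y = (\<Sum>b\<in>F. u b * ip b y)" if "y \<in> S" for y
    unfolding x_def using ip_sum_left[OF assms(1), of "\<lambda>b. u b *\<^sub>R b" y] m that assms(2)
    by (auto simp: ip_scale_left subset_iff intro!: sum.cong)
  have "ip x b = u b" if b: "b \<in> F" for b
  proof -
    have "ip x b = (\<Sum>b'\<in>F. if b' = b then u b else 0)"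
      unfolding left[OF subsetD[OF assms(2) b]] using assms(3)[OF _ b] by (intro sum.cong) auto
    then show ?thesis using assms(1) b by simp
  qed
  then have "ip x x = (\<Sum>b\<in>F. (u b)\<^sup>2)"
    unfolding left[OF x] using sym[OF subsetD[OF assms(2)] x] by (intro sum.cong) (auto simp: power2_eq_square)
  then show ?thesis by (simp add: x_def)
qed

text \<open>On the complex span of a real orthonormal basis this is the inequality of Cauchy and Schwarz
  for the coordinates; the span is dense and the functional is continuous.\<close>

lemma functional_bound_by_basis_values:
  assumes B: "orthonormal_basis S ip B"
    and w: "\<And>x y a b. x \<in> S \<times> S \<Longrightarrow> y \<in> S \<times> S \<Longrightarrow> w (cscale a x + cscale b y) = a * w x + b * w y"
    and M: "\<And>x. x \<in> S \<times> S \<Longrightarrow> cmod (w x) \<le> M * cnorm ip x"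
    and summ: "(\<lambda>b. (cmod (w (b, 0)))\<^sup>2) summable_on B"
    and \<xi>: "\<xi> \<in> S \<times> S"
  shows "cmod (w \<xi>) \<le> sqrt (\<Sum>\<^sub>\<infinity>b\<in>B. (cmod (w (b, 0)))\<^sup>2) * cnorm ip \<xi>"
proof -
  define K where "K = sqrt (\<Sum>\<^sub>\<infinity>b\<in>B. (cmod (w (b, 0)))\<^sup>2)"
  have K: "K \<ge> 0" unfolding K_def by (simp add: infsum_nonneg)
  have BS: "B \<subseteq> S" and ortho: "\<And>x y. x \<in> B \<Longrightarrow> y \<in> B \<Longrightarrow> ip x y = (if x = y then 1 else 0)"
    and dense: "hilbert_topology S ip closure_of (span B) = S"
    using B by (auto simp: orthonormal_basis_def)
  have w0: "w 0 = 0" using w[OF C.closed(3) C.closed(3), of 0 0] by (simp add: cscale_def zero_prod_def)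
  have w_add: "w (x + y) = w x + w y" if "x \<in> S \<times> S" "y \<in> S \<times> S" for x y
    using w[OF that, of 1 1] by (simp add: cscale_def)
  have w_scale: "w (cscale c x) = c * w x" if "x \<in> S \<times> S" for c x
    using w[OF that that, of c 0] by (simp add: cscale_def flip: zero_prod_def)
  have w_diff: "w (x - y) = w x - w y" if "x \<in> S \<times> S" "y \<in> S \<times> S" for x y
    using w[OF that, of 1 "-1"] by (simp add: cscale_def minus_prod_def plus_prod_def)
  have w_sum: "(\<Sum>b\<in>F. u b) \<in> S \<times> S \<and> w (\<Sum>b\<in>F. u b) = (\<Sum>b\<in>F. w (u b))"
    if "finite F" "\<And>b. b \<in> F \<Longrightarrow> u b \<in> S \<times> S" for F :: "'a set" and u
    using that
  proof (induction F rule: finite_induct)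
    case empty
    then show ?case using w0 C.closed(3) by simp
  next
    case (insert b F)
    then show ?case by (simp only: sum.insert C.mem_add w_add insert_iff simp_thms)
  qed
  have on_span: "cmod (w (x, y)) \<le> K * cnorm ip (x, y)" if xy: "x \<in> span B" "y \<in> span B" for x y
  proof -
    obtain t1 r1 t2 r2 where 1: "finite t1" "t1 \<subseteq> B" "x = (\<Sum>b\<in>t1. r1 b *\<^sub>R b)"
      and 2: "finite t2" "t2 \<subseteq> B" "y = (\<Sum>b\<in>t2. r2 b *\<^sub>R b)"
      using xy unfolding span_explicit by auto
    define F where "F = t1 \<union> t2"
    have F: "finite F" "F \<subseteq> B" using 1 2 by (auto simp: F_def)
    have "x \<in> span F" "y \<in> span F"
      unfolding 1(3) 2(3) by (intro span_sum span_scale span_base; simp add: F_def)+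
    then obtain u v where u: "x = (\<Sum>b\<in>F. u b *\<^sub>R b)" and v: "y = (\<Sum>b\<in>F. v b *\<^sub>R b)"
      unfolding span_finite[OF F(1)] by auto
    have b: "(b, 0) \<in> S \<times> S" if "b \<in> F" for b using that F BS closed(3) by auto
    have "(x, y) = (\<Sum>b\<in>F. cscale (Complex (u b) (v b)) (b, 0))"
      by (simp add: u v cscale_def prod_eq_iff fst_sum snd_sum)
    then have "w (x, y) = (\<Sum>b\<in>F. Complex (u b) (v b) * w (b, 0))"
      using w_sum[OF F(1), of "\<lambda>b. cscale (Complex (u b) (v b)) (b, 0)"] b cscale_mem w_scale
      by (auto intro!: sum.cong simp del: mem_Times_iff)
    then have "cmod (w (x, y)) \<le> (\<Sum>b\<in>F. \<bar>cmod (Complex (u b) (v b))\<bar> * \<bar>cmod (w (b, 0))\<bar>)"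
      by (simp add: sum_norm_le norm_mult)
    also have "\<dots> \<le> L2_set (\<lambda>b. cmod (Complex (u b) (v b))) F * L2_set (\<lambda>b. cmod (w (b, 0))) F"
      by (rule L2_set_mult_ineq)
    also have "\<dots> \<le> L2_set (\<lambda>b. cmod (Complex (u b) (v b))) F * K"
    proof (intro mult_left_mono L2_set_nonneg)
      show "L2_set (\<lambda>b. cmod (w (b, 0))) F \<le> K" unfolding L2_set_def K_def
      using F(1,2) summ by (intro real_sqrt_le_mono finite_sum_le_infsum) auto
    qed
    also have "L2_set (\<lambda>b. cmod (Complex (u b) (v b))) F = cnorm ip (x, y)"
    proof -
      have o: "ip p q = (if p = q then 1 else 0)" if "p \<in> F" "q \<in> F" for p q
        by (rule ortho) (use that F in auto)
      have FS: "F \<subseteq> S" using F BS by auto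
      have "ip x x = (\<Sum>b\<in>F. (u b)\<^sup>2)" "ip y y = (\<Sum>b\<in>F. (v b)\<^sup>2)"
        unfolding u v by (rule orthonormal_combination[OF F(1) FS o]; assumption)+
      then show ?thesis by (simp add: L2_set_def ip_norm_def cinner_def cmod_def sum.distrib)
    qed
    finally show ?thesis by (simp add: mult.commute)
  qed
  define N where "N = max M 0"
  have N: "N \<ge> 0" "cmod (w x) \<le> N * cnorm ip x" if "x \<in> S \<times> S" for x
    using M[OF that] C.norm_nonneg[OF that] mult_right_mono[of M N "cnorm ip x"] by (auto simp: N_def)
  have "cmod (w \<xi>) \<le> K * cnorm ip \<xi> + \<epsilon>" if \<epsilon>: "\<epsilon> > 0" for \<epsilon>
  proof -
    define \<delta> where "\<delta> = \<epsilon> / (2 * (K + N + 1))"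
    have \<delta>: "\<delta> > 0" "\<delta> * 2 * (K + N) \<le> \<epsilon>" using \<epsilon> K N(1)[OF C.closed(3)] by (auto simp: \<delta>_def field_simps)
    obtain x y where xy: "\<xi> = (x, y)" "x \<in> S" "y \<in> S" using \<xi> by auto
    obtain x' where x': "x' \<in> span B" "x' \<in> S" "ip_norm ip (x - x') < \<delta>"
      using closure_approx[of x "span B" \<delta>] dense xy \<delta> by auto
    obtain y' where y': "y' \<in> span B" "y' \<in> S" "ip_norm ip (y - y') < \<delta>"
      using closure_approx[of y "span B" \<delta>] dense xy \<delta> by auto
    have m: "(x', y') \<in> S \<times> S" "\<xi> - (x', y') \<in> S \<times> S" using xy x' y' closed(2) by auto
    have "cnorm ip (\<xi> - (x', y')) \<le> ip_norm ip (x - x') + ip_norm ip (y - y')"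
      using xy nonneg[OF closed(2)[OF xy(2) x'(2)]] nonneg[OF closed(2)[OF xy(3) y'(2)]]
      by (simp add: ip_norm_def cinner_def sqrt_add_le_add_sqrt)
    then have d: "cnorm ip (\<xi> - (x', y')) \<le> 2 * \<delta>" using x' y' by linarith
    have "cnorm ip (x', y') = cnorm ip (\<xi> + - 1 *\<^sub>R (\<xi> - (x', y')))" by simp
    also have "\<dots> \<le> cnorm ip \<xi> + cnorm ip (- 1 *\<^sub>R (\<xi> - (x', y')))"
      by (rule C.triangle[OF \<xi> C.mem_scale[OF m(2)]])
    also have "\<dots> \<le> cnorm ip \<xi> + 2 * \<delta>" using d C.norm_scale[OF m(2), of "-1"] by simp
    finally have n: "cnorm ip (x', y') \<le> cnorm ip \<xi> + 2 * \<delta>" .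
    have "cmod (w \<xi>) \<le> cmod (w (x', y')) + cmod (w (\<xi> - (x', y')))"
      using w_diff[OF \<xi> m(1)] norm_triangle_sub[of "w \<xi>" "w (x', y')"] by simp
    also have "\<dots> \<le> K * (cnorm ip \<xi> + 2 * \<delta>) + N * (2 * \<delta>)"
      using on_span[OF x'(1) y'(1)] N(2)[OF m(2)] mult_left_mono[OF n K] mult_left_mono[OF d N(1)[OF \<xi>]]
      by linarith
    also have "\<dots> \<le> K * cnorm ip \<xi> + \<epsilon>" using \<delta>(2) by (simp add: algebra_simps)
    finally show ?thesis .
  qed
  then show ?thesis unfolding K_def[symmetric] by (rule field_le_epsilon)
qed

end


section \<open>The spaces \<open>\<H>\<^sub>-\<^sub>\<tau>\<close>\<close>

lemma has_sum_sum:
  fixes s :: "'i \<Rightarrow> 'b \<Rightarrow> 'c::topological_ab_group_add"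
  assumes "finite F" "\<And>e. e \<in> F \<Longrightarrow> (s e has_sum t e) B"
  shows "((\<lambda>b. \<Sum>e\<in>F. s e b) has_sum (\<Sum>e\<in>F. t e)) B"
  using assms
proof (induction F rule: finite_induct)
  case empty
  then show ?case by (simp add: has_sum_0)
next
  case (insert e F)
  then show ?case by (simp add: has_sum_add)
qed

context hilbert_rigging
begin

lemma H_pre_hilbert: "\<tau> \<in> T \<Longrightarrow> pre_hilbert (H \<tau>) (ip \<tau>)"
  using hilbert real_separable_hilbert_imp_pre_hilbert by blast

lemma Hc_pre_hilbert: "\<tau> \<in> T \<Longrightarrow> pre_hilbert (Hc \<tau>) (\<lambda>x y. Re (cinner (ip \<tau>) x y))"
  unfolding Hc_def by (rule pre_hilbert_complexification) (rule H_pre_hilbert)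

lemma cnorm_nonneg: "\<tau> \<in> T \<Longrightarrow> \<xi> \<in> Hc \<tau> \<Longrightarrow> 0 \<le> cnorm (ip \<tau>) \<xi>"
  using pre_hilbert.norm_nonneg[OF Hc_pre_hilbert] .

lemma Phi_subset: "\<tau> \<in> T \<Longrightarrow> Phi \<subseteq> Hc \<tau>"
  by (auto simp: Phi_def)

text \<open>The real dense subspace approximates the real and the imaginary part separately.\<close>

lemma Phi_dense:
  assumes "\<tau> \<in> T" "x \<in> Hc \<tau>" "\<epsilon> > 0"
  obtains y where "y \<in> Phi" "cnorm (ip \<tau>) (x - y) < \<epsilon>"
proof -
  interpret P: pre_hilbert "H \<tau>" "ip \<tau>" by (rule H_pre_hilbert) fact
  obtain u v where uv: "x = (u, v)" "u \<in> H \<tau>" "v \<in> H \<tau>" using assms by (auto simp: Hc_def)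
  have cl: "hilbert_topology (H \<tau>) (ip \<tau>) closure_of (\<Inter>\<sigma>\<in>T. H \<sigma>) = H \<tau>" using dense assms by blast
  obtain u' where u': "u' \<in> (\<Inter>\<sigma>\<in>T. H \<sigma>)" "u' \<in> H \<tau>" "ip_norm (ip \<tau>) (u - u') < \<epsilon> / 2"
    using P.closure_approx[of u "\<Inter>\<sigma>\<in>T. H \<sigma>" "\<epsilon> / 2"] cl uv assms(3) by auto
  obtain v' where v': "v' \<in> (\<Inter>\<sigma>\<in>T. H \<sigma>)" "v' \<in> H \<tau>" "ip_norm (ip \<tau>) (v - v') < \<epsilon> / 2"
    using P.closure_approx[of v "\<Inter>\<sigma>\<in>T. H \<sigma>" "\<epsilon> / 2"] cl uv assms(3) by auto
  show thesis
  proof (rule that)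
    show "(u', v') \<in> Phi" using u'(1) v'(1) by (auto simp: Phi_def Hc_def)
    have "cnorm (ip \<tau>) (x - (u', v')) \<le> ip_norm (ip \<tau>) (u - u') + ip_norm (ip \<tau>) (v - v')"
      using uv P.nonneg[OF P.closed(2)[OF uv(2) u'(2)]] P.nonneg[OF P.closed(2)[OF uv(3) v'(2)]]
      by (simp add: ip_norm_def cinner_def sqrt_add_le_add_sqrt)
    then show "cnorm (ip \<tau>) (x - (u', v')) < \<epsilon>" using u'(3) v'(3) by simp
  qed
qed

lemma dual_linear:
  "w \<in> dual \<tau> \<Longrightarrow> x \<in> Hc \<tau> \<Longrightarrow> y \<in> Hc \<tau> \<Longrightarrow> w (cscale a x + cscale b y) = a * w x + b * w y"
  by (auto simp: dual_def)

lemma cscale_of_real: "cscale (of_real r) x = r *\<^sub>R x"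
  by (simp add: cscale_def prod_eq_iff)

lemma dual_diff: "w \<in> dual \<tau> \<Longrightarrow> x \<in> Hc \<tau> \<Longrightarrow> y \<in> Hc \<tau> \<Longrightarrow> w (x - y) = w x - w y"
  using dual_linear[of w \<tau> x y 1 "-1"] cscale_of_real[of 1 x] cscale_of_real[of "-1" y] by simp

lemma dual_scaleR: "w \<in> dual \<tau> \<Longrightarrow> x \<in> Hc \<tau> \<Longrightarrow> w (r *\<^sub>R x) = of_real r * w x"
  using dual_linear[of w \<tau> x x "of_real r" 0] cscale_of_real[of r x] cscale_of_real[of 0 x] by simp

lemma dual_bounded:
  assumes "\<tau> \<in> T" "w \<in> dual \<tau>"
  obtains M where "M \<ge> 0" "\<And>x. x \<in> Hc \<tau> \<Longrightarrow> cmod (w x) \<le> M * cnorm (ip \<tau>) x"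
proof -
  interpret C: pre_hilbert "Hc \<tau>" "\<lambda>x y. Re (cinner (ip \<tau>) x y)" by (rule Hc_pre_hilbert) fact
  have 0: "w 0 = 0" using dual_scaleR[OF assms(2) C.closed(3), of 0] by simp
  have "continuous_map (hilbert_topology (Hc \<tau>) (\<lambda>x y. Re (cinner (ip \<tau>) x y))) euclidean w"
    using assms(2) by (simp add: dual_def Hc_topology_def)
  then obtain \<delta> where "\<delta> > 0" "\<And>x. x \<in> Hc \<tau> \<Longrightarrow> cnorm (ip \<tau>) x < \<delta> \<Longrightarrow> w x \<in> ball 0 1"
    using C.continuous_map_ball[of euclidean w "ball 0 1"] 0 by auto
  then show thesis
    using C.homogeneous_bounded[of "\<lambda>x. cmod (w x)" \<delta>] dual_scaleR[OF assms(2)] that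
    by (auto simp: norm_mult)
qed

lemma bounded_in_dual:
  assumes "\<tau> \<in> T" "w \<in> extensional (Hc \<tau>)"
    and lin: "\<And>x y a b. x \<in> Hc \<tau> \<Longrightarrow> y \<in> Hc \<tau> \<Longrightarrow> w (cscale a x + cscale b y) = a * w x + b * w y"
    and M: "\<And>x. x \<in> Hc \<tau> \<Longrightarrow> cmod (w x) \<le> M * cnorm (ip \<tau>) x"
  shows "w \<in> dual \<tau>"
proof -
  interpret C: pre_hilbert "Hc \<tau>" "\<lambda>x y. Re (cinner (ip \<tau>) x y)" by (rule Hc_pre_hilbert) fact
  have R: "Metric_space (UNIV :: complex set) (dist_on UNIV dist)"
    unfolding dist_on_def by simp (rule Met_TC.Metric_space_axioms)
  have "continuous_map (Hc_topology \<tau>) (topology_on UNIV dist) w"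
    unfolding Hc_topology_def
  proof (rule C.lipschitz_continuous_map[OF R, where C = M])
    fix x y assume xy: "x \<in> Hc \<tau>" "y \<in> Hc \<tau>"
    have "w (x - y) = w x - w y"
      using lin[OF xy, of 1 "-1"] cscale_of_real[of 1 x] cscale_of_real[of "-1" y] by simp
    then show "dist (w x) (w y) \<le> M * cnorm (ip \<tau>) (x - y)"
      using M[OF C.closed(2)[OF xy]] by (simp add: dist_norm)
  qed simp
  moreover have "topology_on (UNIV :: complex set) dist = euclidean"
    unfolding topology_on_def dist_on_def by simp
  ultimately have "continuous_map (Hc_topology \<tau>) euclidean w" by simp
  then show ?thesis unfolding dual_def mem_Collect_eq by (intro conjI ballI allI assms(2) lin)
qed

text \<open>A bounded functional is determined by its values on the dense subspace \<open>\<Phi>\<close>. This makes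
  \<^const>\<open>pairing\<close> the inverse of restriction to \<open>\<Phi>\<close>.\<close>

lemma dual_eqI:
  assumes \<tau>: "\<tau> \<in> T" and w: "w \<in> dual \<tau>" and v: "v \<in> dual \<tau>"
    and eq: "restrict w Phi = restrict v Phi"
  shows "w = v"
proof
  fix x show "w x = v x"
  proof (cases "x \<in> Hc \<tau>")
    case False
    have "w \<in> extensional (Hc \<tau>)" "v \<in> extensional (Hc \<tau>)"
      using w v unfolding dual_def mem_Collect_eq by (iprover elim: conjE)+
    then show ?thesis using False extensional_arb[of w] extensional_arb[of v] by metis
  next
    case x: True
    interpret C: pre_hilbert "Hc \<tau>" "\<lambda>x y. Re (cinner (ip \<tau>) x y)" by (rule Hc_pre_hilbert) fact
    obtain M where M: "M \<ge> 0" "\<And>x. x \<in> Hc \<tau> \<Longrightarrow> cmod (w x) \<le> M * cnorm (ip \<tau>) x"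
      using dual_bounded[OF \<tau> w] by blast
    obtain N where N: "N \<ge> 0" "\<And>x. x \<in> Hc \<tau> \<Longrightarrow> cmod (v x) \<le> N * cnorm (ip \<tau>) x"
      using dual_bounded[OF \<tau> v] by blast
    have "cmod (w x - v x) \<le> 0 + \<epsilon>" if "\<epsilon> > 0" for \<epsilon>
    proof -
      define \<delta> where "\<delta> = \<epsilon> / (M + N + 1)"
      have "M + N + 1 > 0" using M(1) N(1) by linarith
      then have \<delta>: "\<delta> > 0" "(M + N) * \<delta> \<le> \<epsilon>"
        using that by (simp_all add: \<delta>_def pos_divide_le_eq algebra_simps)
      obtain y where y: "y \<in> Phi" "cnorm (ip \<tau>) (x - y) < \<delta>" using Phi_dense[OF \<tau> x \<delta>(1)] .
      have yH: "y \<in> Hc \<tau>" using y Phi_subset[OF \<tau>] by auto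
      have "w y = v y" using fun_cong[OF eq, of y] y by simp
      then have "w x - v x = w (x - y) - v (x - y)"
        using dual_diff[OF w x yH] dual_diff[OF v x yH] by simp
      then have "cmod (w x - v x) \<le> cmod (w (x - y)) + cmod (v (x - y))"
        by (simp add: norm_triangle_ineq4)
      also have "\<dots> \<le> (M + N) * cnorm (ip \<tau>) (x - y)"
        using M(2)[OF C.closed(2)[OF x yH]] N(2)[OF C.closed(2)[OF x yH]] unfolding distrib_right
        by (rule add_mono)
      also have "\<dots> \<le> (M + N) * \<delta>" using M N y by (intro mult_left_mono) auto
      finally show ?thesis using \<delta>(2) by simp
    qed
    then have "cmod (w x - v x) \<le> 0" by (rule field_le_epsilon)
    then show ?thesis by simp
  qed
qed

lemma pairing_restrict: "\<tau> \<in> T \<Longrightarrow> w \<in> dual \<tau> \<Longrightarrow> pairing \<tau> (restrict w Phi) = w"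
  unfolding pairing_def by (rule the_equality) (auto intro: dual_eqI)

lemma restrict_in_Hneg: "w \<in> dual \<tau> \<Longrightarrow> restrict w Phi \<in> Hneg \<tau>"
  by (simp add: Hneg_def)

lemma Hneg_pairing:
  assumes "\<tau> \<in> T" "\<omega> \<in> Hneg \<tau>"
  shows "pairing \<tau> \<omega> \<in> dual \<tau>" "restrict (pairing \<tau> \<omega>) Phi = \<omega>"
  using assms pairing_restrict by (auto simp: Hneg_def)

lemma Hneg_extensional: "\<omega> \<in> Hneg \<tau> \<Longrightarrow> \<omega> \<in> extensional Phi"
  by (auto simp: Hneg_def)

lemma lin_comb_dual:
  assumes \<tau>: "\<tau> \<in> T" and w: "w \<in> dual \<tau>" and v: "v \<in> dual \<tau>"
  shows "(\<lambda>\<xi>\<in>Hc \<tau>. a * w \<xi> + b * v \<xi>) \<in> dual \<tau>"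
proof -
  interpret C: pre_hilbert "Hc \<tau>" "\<lambda>x y. Re (cinner (ip \<tau>) x y)" by (rule Hc_pre_hilbert) fact
  interpret P: pre_hilbert "H \<tau>" "ip \<tau>" by (rule H_pre_hilbert) fact
  obtain M where M: "M \<ge> 0" "\<And>x. x \<in> Hc \<tau> \<Longrightarrow> cmod (w x) \<le> M * cnorm (ip \<tau>) x"
    using dual_bounded[OF \<tau> w] by blast
  obtain N where N: "N \<ge> 0" "\<And>x. x \<in> Hc \<tau> \<Longrightarrow> cmod (v x) \<le> N * cnorm (ip \<tau>) x"
    using dual_bounded[OF \<tau> v] by blast
  show ?thesis
  proof (rule bounded_in_dual[OF \<tau>, where M = "cmod a * M + cmod b * N"])
    fix x y c d assume xy: "x \<in> Hc \<tau>" "y \<in> Hc \<tau>"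
    have "cscale c x + cscale d y \<in> Hc \<tau>"
      using C.mem_add P.cscale_mem xy unfolding Hc_def by blast
    then show "(\<lambda>\<xi>\<in>Hc \<tau>. a * w \<xi> + b * v \<xi>) (cscale c x + cscale d y) =
        c * (\<lambda>\<xi>\<in>Hc \<tau>. a * w \<xi> + b * v \<xi>) x + d * (\<lambda>\<xi>\<in>Hc \<tau>. a * w \<xi> + b * v \<xi>) y"
      using xy dual_linear[OF w xy] dual_linear[OF v xy] by (simp add: algebra_simps)
  next
    fix x assume x: "x \<in> Hc \<tau>"
    have "cmod (a * w x + b * v x) \<le> cmod a * cmod (w x) + cmod b * cmod (v x)"
      by (metis norm_mult norm_triangle_ineq)
    also have "\<dots> \<le> cmod a * (M * cnorm (ip \<tau>) x) + cmod b * (N * cnorm (ip \<tau>) x)"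
      using M(2)[OF x] N(2)[OF x] by (intro add_mono mult_left_mono) auto
    finally show "cmod ((\<lambda>\<xi>\<in>Hc \<tau>. a * w \<xi> + b * v \<xi>) x) \<le> (cmod a * M + cmod b * N) * cnorm (ip \<tau>) x"
      using x by (simp add: algebra_simps)
  qed simp
qed

lemma
  assumes \<tau>: "\<tau> \<in> T" and \<omega>: "\<omega> \<in> Hneg \<tau>" and \<eta>: "\<eta> \<in> Hneg \<tau>"
  shows lin_comb_in_Hneg: "lin_comb a \<omega> b \<eta> \<in> Hneg \<tau>"
    and pairing_lin_comb:
      "\<xi> \<in> Hc \<tau> \<Longrightarrow> pairing \<tau> (lin_comb a \<omega> b \<eta>) \<xi> = a * pairing \<tau> \<omega> \<xi> + b * pairing \<tau> \<eta> \<xi>"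
proof -
  define u where "u = (\<lambda>\<xi>\<in>Hc \<tau>. a * pairing \<tau> \<omega> \<xi> + b * pairing \<tau> \<eta> \<xi>)"
  have u: "u \<in> dual \<tau>" unfolding u_def
    using lin_comb_dual[OF \<tau>] Hneg_pairing(1)[OF \<tau>] \<omega> \<eta> by blast
  have "lin_comb a (restrict (pairing \<tau> \<omega>) Phi) b (restrict (pairing \<tau> \<eta>) Phi) = restrict u Phi"
    using Phi_subset[OF \<tau>] by (auto simp: lin_comb_def u_def restrict_def fun_eq_iff)
  then have eq: "lin_comb a \<omega> b \<eta> = restrict u Phi"
    using Hneg_pairing(2)[OF \<tau>] \<omega> \<eta> by simp
  then show "lin_comb a \<omega> b \<eta> \<in> Hneg \<tau>" using restrict_in_Hneg[OF u] by simp
  show "pairing \<tau> (lin_comb a \<omega> b \<eta>) \<xi> = a * pairing \<tau> \<omega> \<xi> + b * pairing \<tau> \<eta> \<xi>" if "\<xi> \<in> Hc \<tau>"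
    unfolding eq pairing_restrict[OF \<tau> u] using that by (simp add: u_def)
qed

lemma
  assumes \<tau>: "\<tau> \<in> T" and \<omega>: "\<omega> \<in> Hneg \<tau>"
  shows pairing_le: "\<xi> \<in> Hc \<tau> \<Longrightarrow> cmod (pairing \<tau> \<omega> \<xi>) \<le> dual_norm \<tau> \<omega> * cnorm (ip \<tau>) \<xi>"
    and dual_norm_nonneg: "0 \<le> dual_norm \<tau> \<omega>"
proof -
  interpret C: pre_hilbert "Hc \<tau>" "\<lambda>x y. Re (cinner (ip \<tau>) x y)" by (rule Hc_pre_hilbert) fact
  define w where "w = pairing \<tau> \<omega>"
  have w: "w \<in> dual \<tau>" unfolding w_def by (rule Hneg_pairing(1)[OF \<tau> \<omega>])
  obtain M where M: "M \<ge> 0" "\<And>x. x \<in> Hc \<tau> \<Longrightarrow> cmod (w x) \<le> M * cnorm (ip \<tau>) x"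
    using dual_bounded[OF \<tau> w] by blast
  have bdd: "bdd_above ((\<lambda>\<xi>. cmod (w \<xi>)) ` {\<xi> \<in> Hc \<tau>. cnorm (ip \<tau>) \<xi> \<le> 1})"
  proof (rule bdd_aboveI2[where M = M])
    fix x assume "x \<in> {\<xi> \<in> Hc \<tau>. cnorm (ip \<tau>) \<xi> \<le> 1}"
    then show "cmod (w x) \<le> M"
      using M(2)[of x] mult_left_mono[of "cnorm (ip \<tau>) x" 1 M] M(1) by auto
  qed
  have le: "cmod (w x) \<le> dual_norm \<tau> \<omega>" if "x \<in> Hc \<tau>" "cnorm (ip \<tau>) x \<le> 1" for x
    unfolding dual_norm_def w_def[symmetric] using bdd that by (intro cSUP_upper) auto
  show "0 \<le> dual_norm \<tau> \<omega>"
    using le[OF C.closed(3)] C.norm_zero norm_ge_zero[of "w 0"] by linarith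
  show "cmod (pairing \<tau> \<omega> \<xi>) \<le> dual_norm \<tau> \<omega> * cnorm (ip \<tau>) \<xi>" if \<xi>: "\<xi> \<in> Hc \<tau>"
  proof (cases "cnorm (ip \<tau>) \<xi> = 0")
    case True
    then show ?thesis using M(2)[OF \<xi>] by (simp add: w_def)
  next
    case False
    then have p: "cnorm (ip \<tau>) \<xi> > 0" using C.norm_nonneg[OF \<xi>] by simp
    have "cmod (w ((1 / cnorm (ip \<tau>) \<xi>) *\<^sub>R \<xi>)) \<le> dual_norm \<tau> \<omega>"
      using p by (intro le C.mem_scale[OF \<xi>]) (simp add: C.norm_scale[OF \<xi>])
    then have "cmod (w \<xi>) / cnorm (ip \<tau>) \<xi> \<le> dual_norm \<tau> \<omega>"
      using p unfolding dual_scaleR[OF w \<xi>] norm_mult norm_of_real by simp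
    then show ?thesis using p by (simp add: pos_divide_le_eq w_def)
  qed
qed

lemma dual_norm_le:
  assumes "\<tau> \<in> T" "M \<ge> 0" "\<And>\<xi>. \<xi> \<in> Hc \<tau> \<Longrightarrow> cmod (pairing \<tau> \<omega> \<xi>) \<le> M * cnorm (ip \<tau>) \<xi>"
  shows "dual_norm \<tau> \<omega> \<le> M"
  unfolding dual_norm_def
proof (rule cSUP_least)
  interpret C: pre_hilbert "Hc \<tau>" "\<lambda>x y. Re (cinner (ip \<tau>) x y)" by (rule Hc_pre_hilbert) fact
  have "0 \<in> {\<xi> \<in> Hc \<tau>. cnorm (ip \<tau>) \<xi> \<le> 1}" unfolding mem_Collect_eq C.norm_zero using C.closed(3) by simp
  then show "{\<xi> \<in> Hc \<tau>. cnorm (ip \<tau>) \<xi> \<le> 1} \<noteq> {}" by blast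
  fix \<xi> assume "\<xi> \<in> {\<xi> \<in> Hc \<tau>. cnorm (ip \<tau>) \<xi> \<le> 1}"
  then show "cmod (pairing \<tau> \<omega> \<xi>) \<le> M"
    using assms(3)[of \<xi>] mult_left_mono[of "cnorm (ip \<tau>) \<xi>" 1 M] assms(2) by auto
qed

lemma dual_norm_lin_comb:
  assumes \<tau>: "\<tau> \<in> T" and \<omega>: "\<omega> \<in> Hneg \<tau>" and \<eta>: "\<eta> \<in> Hneg \<tau>"
  shows "dual_norm \<tau> (lin_comb a \<omega> b \<eta>) \<le> cmod a * dual_norm \<tau> \<omega> + cmod b * dual_norm \<tau> \<eta>"
proof (rule dual_norm_le[OF \<tau>])
  show "0 \<le> cmod a * dual_norm \<tau> \<omega> + cmod b * dual_norm \<tau> \<eta>"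
    using dual_norm_nonneg[OF \<tau>] \<omega> \<eta> by simp
  fix \<xi> assume \<xi>: "\<xi> \<in> Hc \<tau>"
  have "cmod (pairing \<tau> (lin_comb a \<omega> b \<eta>) \<xi>) \<le> cmod a * cmod (pairing \<tau> \<omega> \<xi>) + cmod b * cmod (pairing \<tau> \<eta> \<xi>)"
    unfolding pairing_lin_comb[OF assms \<xi>] by (metis norm_mult norm_triangle_ineq)
  also have "\<dots> \<le> cmod a * (dual_norm \<tau> \<omega> * cnorm (ip \<tau>) \<xi>) + cmod b * (dual_norm \<tau> \<eta> * cnorm (ip \<tau>) \<xi>)"
    using pairing_le[OF \<tau>] \<omega> \<eta> \<xi> by (intro add_mono mult_left_mono) auto
  finally show "cmod (pairing \<tau> (lin_comb a \<omega> b \<eta>) \<xi>)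
      \<le> (cmod a * dual_norm \<tau> \<omega> + cmod b * dual_norm \<tau> \<eta>) * cnorm (ip \<tau>) \<xi>"
    by (simp add: algebra_simps)
qed

lemma dual_norm_eq_0:
  assumes \<tau>: "\<tau> \<in> T" and \<omega>: "\<omega> \<in> Hneg \<tau>" and 0: "dual_norm \<tau> \<omega> = 0"
  shows "\<omega> = (\<lambda>\<xi>\<in>Phi. 0)"
proof -
  have "pairing \<tau> \<omega> \<xi> = 0" if "\<xi> \<in> Phi" for \<xi>
    using pairing_le[OF \<tau> \<omega>, of \<xi>] that Phi_subset[OF \<tau>] 0 by auto
  then have "restrict (pairing \<tau> \<omega>) Phi = (\<lambda>\<xi>\<in>Phi. 0)" by (auto simp: restrict_def fun_eq_iff)
  then show ?thesis using Hneg_pairing(2)[OF \<tau> \<omega>] by simp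
qed

lemma zero_in_Hneg: "\<tau> \<in> T \<Longrightarrow> (\<lambda>\<xi>\<in>Phi. 0) \<in> Hneg \<tau>"
proof -
  assume \<tau>: "\<tau> \<in> T"
  have "(\<lambda>\<xi>\<in>Hc \<tau>. 0 :: complex) \<in> dual \<tau>"
  proof (rule bounded_in_dual[OF \<tau>, where M = 0])
    interpret P: pre_hilbert "H \<tau>" "ip \<tau>" by (rule H_pre_hilbert) fact
    interpret C: pre_hilbert "Hc \<tau>" "\<lambda>x y. Re (cinner (ip \<tau>) x y)" by (rule Hc_pre_hilbert) fact
    fix x y a b assume xy: "x \<in> Hc \<tau>" "y \<in> Hc \<tau>"
    have "cscale a x + cscale b y \<in> Hc \<tau>"
      using C.mem_add P.cscale_mem xy unfolding Hc_def by blast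
    then show "(\<lambda>\<xi>\<in>Hc \<tau>. 0 :: complex) (cscale a x + cscale b y) =
        a * (\<lambda>\<xi>\<in>Hc \<tau>. 0) x + b * (\<lambda>\<xi>\<in>Hc \<tau>. 0) y" using xy by simp
  qed auto
  from restrict_in_Hneg[OF this] show ?thesis
    using Phi_subset[OF \<tau>] by (simp add: Int_absorb1)
qed

lemma dual_norm_zero: "\<tau> \<in> T \<Longrightarrow> dual_norm \<tau> (\<lambda>\<xi>\<in>Phi. 0) = 0"
proof -
  assume \<tau>: "\<tau> \<in> T"
  have "lin_comb 0 (\<lambda>\<xi>\<in>Phi. 0) 0 (\<lambda>\<xi>\<in>Phi. 0) = (\<lambda>\<xi>\<in>Phi. 0)" by (simp add: lin_comb_def)
  then show ?thesis
    using dual_norm_lin_comb[OF \<tau> zero_in_Hneg[OF \<tau>] zero_in_Hneg[OF \<tau>], of 0 0]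
      dual_norm_nonneg[OF \<tau> zero_in_Hneg[OF \<tau>]] by simp
qed

lemma
  assumes \<tau>: "\<tau> \<in> T" and e: "e \<in> Hc \<tau>"
  shows riesz_in_Hneg: "riesz \<tau> e \<in> Hneg \<tau>"
    and pairing_riesz: "\<xi> \<in> Hc \<tau> \<Longrightarrow> pairing \<tau> (riesz \<tau> e) \<xi> = cinner (ip \<tau>) \<xi> e"
proof -
  interpret P: pre_hilbert "H \<tau>" "ip \<tau>" by (rule H_pre_hilbert) fact
  interpret C: pre_hilbert "Hc \<tau>" "\<lambda>x y. Re (cinner (ip \<tau>) x y)" by (rule Hc_pre_hilbert) fact
  define w where "w = (\<lambda>\<xi>\<in>Hc \<tau>. cinner (ip \<tau>) \<xi> e)"
  have w: "w \<in> dual \<tau>"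
  proof (rule bounded_in_dual[OF \<tau>, where M = "cnorm (ip \<tau>) e"])
    fix x y a b assume xy: "x \<in> Hc \<tau>" "y \<in> Hc \<tau>"
    have m: "cscale a x \<in> Hc \<tau>" "cscale b y \<in> Hc \<tau>" using xy P.cscale_mem unfolding Hc_def by blast+
    show "w (cscale a x + cscale b y) = a * w x + b * w y"
      using xy m C.mem_add[OF m] e P.cinner_add_left P.cinner_cscale_left
      unfolding w_def Hc_def by (simp del: mem_Times_iff)
  next
    fix x assume "x \<in> Hc \<tau>"
    then show "cmod (w x) \<le> cnorm (ip \<tau>) e * cnorm (ip \<tau>) x"
      using P.cinner_cauchy_schwarz[of x e] e unfolding Hc_def w_def by (simp add: mult.commute del: mem_Times_iff)
  qed (simp add: w_def)
  have r: "riesz \<tau> e = restrict w Phi"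
    using Phi_subset[OF \<tau>] by (auto simp: riesz_def w_def restrict_def fun_eq_iff)
  show "riesz \<tau> e \<in> Hneg \<tau>" unfolding r by (rule restrict_in_Hneg[OF w])
  show "pairing \<tau> (riesz \<tau> e) \<xi> = cinner (ip \<tau>) \<xi> e" if "\<xi> \<in> Hc \<tau>"
    unfolding r pairing_restrict[OF \<tau> w] using that by (simp add: w_def)
qed

text \<open>A complex linear functional is determined by its real part, and the real part is represented
  separately on the two real summands of \<open>\<H>\<^sub>\<tau>\<close>.\<close>

lemma Hneg_riesz:
  assumes \<tau>: "\<tau> \<in> T" and \<omega>: "\<omega> \<in> Hneg \<tau>"
  obtains h where "h \<in> Hc \<tau>" "\<omega> = riesz \<tau> h" "cnorm (ip \<tau>) h \<le> dual_norm \<tau> \<omega>"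
proof -
  interpret P: pre_hilbert "H \<tau>" "ip \<tau>" by (rule H_pre_hilbert) fact
  interpret C: pre_hilbert "Hc \<tau>" "\<lambda>x y. Re (cinner (ip \<tau>) x y)" by (rule Hc_pre_hilbert) fact
  define w where "w = pairing \<tau> \<omega>"
  have w: "w \<in> dual \<tau>" unfolding w_def by (rule Hneg_pairing(1)[OF \<tau> \<omega>])
  have complete: "Metric_space.mcomplete (H \<tau>) (dist_on (H \<tau>) (\<lambda>x y. ip_norm (ip \<tau>) (x - y)))"
    using hilbert[OF \<tau>] by (simp add: real_separable_hilbert_def)
  have lin: "w (a *\<^sub>R x + b *\<^sub>R y) = of_real a * w x + of_real b * w y" if "x \<in> Hc \<tau>" "y \<in> Hc \<tau>" for a b x y
    using dual_linear[OF w that, of "of_real a" "of_real b"] by (simp add: cscale_of_real)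
  have bnd: "\<bar>Re (w x)\<bar> \<le> dual_norm \<tau> \<omega> * cnorm (ip \<tau>) x" if "x \<in> Hc \<tau>" for x
    using pairing_le[OF \<tau> \<omega> that] abs_Re_le_cmod[of "w x"] by (simp add: w_def)
  have fst: "(x, 0) \<in> Hc \<tau>" "cnorm (ip \<tau>) (x, 0) = ip_norm (ip \<tau>) x"
    and snd: "(0, x) \<in> Hc \<tau>" "cnorm (ip \<tau>) (0, x) = ip_norm (ip \<tau>) x" if "x \<in> H \<tau>" for x
    using that P.closed(3) P.zero[OF P.closed(3)] by (auto simp: Hc_def ip_norm_def cinner_def)
  obtain h1 where h1: "h1 \<in> H \<tau>" "\<And>x. x \<in> H \<tau> \<Longrightarrow> Re (w (x, 0)) = ip \<tau> x h1"
  proof (rule P.riesz_representation[OF complete, where g = "\<lambda>x. Re (w (x, 0))" and M = "dual_norm \<tau> \<omega>"])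
    show "Re (w (a *\<^sub>R x + b *\<^sub>R y, 0)) = a * Re (w (x, 0)) + b * Re (w (y, 0))"
      if "x \<in> H \<tau>" "y \<in> H \<tau>" for x y a b
      using lin[OF fst(1)[OF that(1)] fst(1)[OF that(2)], of a b] by simp
    show "\<bar>Re (w (x, 0))\<bar> \<le> dual_norm \<tau> \<omega> * ip_norm (ip \<tau>) x" if "x \<in> H \<tau>" for x
      using bnd[OF fst(1)[OF that]] fst(2)[OF that] by simp
  qed (rule that)
  obtain h2 where h2: "h2 \<in> H \<tau>" "\<And>x. x \<in> H \<tau> \<Longrightarrow> Re (w (0, x)) = ip \<tau> x h2"
  proof (rule P.riesz_representation[OF complete, where g = "\<lambda>x. Re (w (0, x))" and M = "dual_norm \<tau> \<omega>"])
    show "Re (w (0, a *\<^sub>R x + b *\<^sub>R y)) = a * Re (w (0, x)) + b * Re (w (0, y))"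
      if "x \<in> H \<tau>" "y \<in> H \<tau>" for x y a b
      using lin[OF snd(1)[OF that(1)] snd(1)[OF that(2)], of a b] by simp
    show "\<bar>Re (w (0, x))\<bar> \<le> dual_norm \<tau> \<omega> * ip_norm (ip \<tau>) x" if "x \<in> H \<tau>" for x
      using bnd[OF snd(1)[OF that]] snd(2)[OF that] by simp
  qed (rule that)
  define h where "h = (h1, h2)"
  have h: "h \<in> Hc \<tau>" using h1 h2 by (simp add: h_def Hc_def)
  have re: "Re (w \<xi>) = Re (cinner (ip \<tau>) \<xi> h)" if \<xi>: "\<xi> \<in> Hc \<tau>" for \<xi>
  proof -
    obtain x y where xy: "\<xi> = (x, y)" "x \<in> H \<tau>" "y \<in> H \<tau>" using \<xi> by (auto simp: Hc_def)
    have "w \<xi> = w (x, 0) + w (0, y)"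
      using lin[OF fst(1)[OF xy(2)] snd(1)[OF xy(3)], of 1 1] xy by simp
    then show ?thesis using h1(2) h2(2) xy by (simp add: cinner_def h_def)
  qed
  have w_eq: "w \<xi> = cinner (ip \<tau>) \<xi> h" if \<xi>: "\<xi> \<in> Hc \<tau>" for \<xi>
  proof (rule complex_eqI)
    show "Re (w \<xi>) = Re (cinner (ip \<tau>) \<xi> h)" by (rule re[OF \<xi>])
    have m: "cscale (-\<i>) \<xi> \<in> Hc \<tau>" using P.cscale_mem \<xi> unfolding Hc_def by blast
    have "w (cscale (-\<i>) \<xi>) = - \<i> * w \<xi>"
      using dual_linear[OF w \<xi> \<xi>, of "-\<i>" 0] cscale_of_real[of 0 \<xi>] by simp
    moreover have "cinner (ip \<tau>) (cscale (-\<i>) \<xi>) h = - \<i> * cinner (ip \<tau>) \<xi> h"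
      using P.cinner_cscale_left[of \<xi> h "-\<i>"] \<xi> h unfolding Hc_def by blast
    ultimately show "Im (w \<xi>) = Im (cinner (ip \<tau>) \<xi> h)"
      using re[OF m] by simp
  qed
  show thesis
  proof (rule that[OF h])
    have "\<omega> = restrict w Phi" unfolding w_def by (rule Hneg_pairing(2)[OF \<tau> \<omega>, symmetric])
    then show "\<omega> = riesz \<tau> h"
      using w_eq Phi_subset[OF \<tau>] by (auto simp: riesz_def restrict_def fun_eq_iff)
    have "w h = of_real ((cnorm (ip \<tau>) h)\<^sup>2)"
      using w_eq[OF h] P.cinner_self[of h] h unfolding Hc_def by simp
    then have "(cnorm (ip \<tau>) h)\<^sup>2 \<le> dual_norm \<tau> \<omega> * cnorm (ip \<tau>) h"
      using pairing_le[OF \<tau> \<omega> h] by (simp add: w_def norm_power)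
    then show "cnorm (ip \<tau>) h \<le> dual_norm \<tau> \<omega>"
      using dual_norm_nonneg[OF \<tau> \<omega>] cnorm_nonneg[OF \<tau> h]
      by (cases "cnorm (ip \<tau>) h = 0") (auto simp: power2_eq_square)
  qed
qed

lemma embedding_bounded:
  assumes \<sigma>: "\<sigma> \<in> T" and \<tau>: "\<tau> \<in> T" and emb: "continuously_embedded (H \<sigma>) (ip \<sigma>) (H \<tau>) (ip \<tau>)"
  obtains c where "c \<ge> 0" "\<And>\<xi>. \<xi> \<in> Hc \<sigma> \<Longrightarrow> cnorm (ip \<tau>) \<xi> \<le> c * cnorm (ip \<sigma>) \<xi>"
proof -
  interpret P: pre_hilbert "H \<sigma>" "ip \<sigma>" by (rule H_pre_hilbert) fact
  interpret Q: pre_hilbert "H \<tau>" "ip \<tau>" by (rule H_pre_hilbert) fact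
  interpret M: Metric_space "H \<tau>" "dist_on (H \<tau>) (\<lambda>x y. ip_norm (ip \<tau>) (x - y))" by (rule Q.metric)
  have sub: "H \<sigma> \<subseteq> H \<tau>"
    and cont: "continuous_map (hilbert_topology (H \<sigma>) (ip \<sigma>)) (hilbert_topology (H \<tau>) (ip \<tau>)) (\<lambda>x. x)"
    using emb by (auto simp: continuously_embedded_def)
  have "openin (hilbert_topology (H \<tau>) (ip \<tau>)) (M.mball 0 1)"
    unfolding hilbert_topology_def topology_on_def by (rule M.openin_mball)
  moreover have "0 \<in> M.mball 0 1" using Q.closed(3) by simp
  ultimately obtain \<delta> where \<delta>: "\<delta> > 0" "\<And>x. x \<in> H \<sigma> \<Longrightarrow> ip_norm (ip \<sigma>) x < \<delta> \<Longrightarrow> x \<in> M.mball 0 1"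
    using P.continuous_map_ball[OF cont] by blast
  have "ip_norm (ip \<tau>) x < 1" if "x \<in> H \<sigma>" "ip_norm (ip \<sigma>) x < \<delta>" for x
    using \<delta>(2)[OF that] Q.norm_commute[of 0 x] Q.closed(3) that(1) sub by (auto simp: dist_on_def)
  then obtain c where c: "c \<ge> 0" "\<And>x. x \<in> H \<sigma> \<Longrightarrow> ip_norm (ip \<tau>) x \<le> c * ip_norm (ip \<sigma>) x"
    using P.homogeneous_bounded[of "ip_norm (ip \<tau>)" \<delta>] \<delta>(1) Q.norm_scale sub by blast
  show thesis
  proof (rule that[OF c(1)])
    fix \<xi> assume "\<xi> \<in> Hc \<sigma>"
    then obtain x y where xy: "\<xi> = (x, y)" "x \<in> H \<sigma>" "y \<in> H \<sigma>" by (auto simp: Hc_def)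
    have sq: "ip \<tau> x x \<le> c\<^sup>2 * ip \<sigma> x x" if "x \<in> H \<sigma>" for x
      using power_mono[OF c(2)[OF that] Q.norm_nonneg, of 2] P.norm_sq[OF that] Q.norm_sq[of x] that sub
      by (auto simp: power_mult_distrib)
    have "sqrt (ip \<tau> x x + ip \<tau> y y) \<le> sqrt (c\<^sup>2 * (ip \<sigma> x x + ip \<sigma> y y))"
      using sq[OF xy(2)] sq[OF xy(3)] by (simp add: algebra_simps)
    then show "cnorm (ip \<tau>) \<xi> \<le> c * cnorm (ip \<sigma>) \<xi>"
      using c(1) by (simp add: xy(1) ip_norm_def cinner_def real_sqrt_mult)
  qed
qed

text \<open>Dualizing reverses the inclusion: a functional that is bounded on the larger \<open>\<H>\<^sub>\<tau>\<close> is bounded on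
  \<open>\<H>\<^sub>\<sigma>\<close>, and both are represented by the same functional on \<open>\<Phi>\<close>.\<close>

lemma
  assumes \<sigma>: "\<sigma> \<in> T" and \<tau>: "\<tau> \<in> T" and emb: "continuously_embedded (H \<sigma>) (ip \<sigma>) (H \<tau>) (ip \<tau>)"
    and \<omega>: "\<omega> \<in> Hneg \<tau>"
  shows Hneg_mono: "\<omega> \<in> Hneg \<sigma>"
    and pairing_mono: "\<xi> \<in> Hc \<sigma> \<Longrightarrow> pairing \<sigma> \<omega> \<xi> = pairing \<tau> \<omega> \<xi>"
proof -
  interpret P: pre_hilbert "H \<sigma>" "ip \<sigma>" by (rule H_pre_hilbert) fact
  interpret C: pre_hilbert "Hc \<sigma>" "\<lambda>x y. Re (cinner (ip \<sigma>) x y)" by (rule Hc_pre_hilbert) fact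
  have sub: "Hc \<sigma> \<subseteq> Hc \<tau>" using emb by (auto simp: continuously_embedded_def Hc_def)
  obtain c where c: "c \<ge> 0" "\<And>\<xi>. \<xi> \<in> Hc \<sigma> \<Longrightarrow> cnorm (ip \<tau>) \<xi> \<le> c * cnorm (ip \<sigma>) \<xi>"
    using embedding_bounded[OF \<sigma> \<tau> emb] by blast
  define w where "w = restrict (pairing \<tau> \<omega>) (Hc \<sigma>)"
  have w: "w \<in> dual \<sigma>"
  proof (rule bounded_in_dual[OF \<sigma>, where M = "dual_norm \<tau> \<omega> * c"])
    fix x y a b assume xy: "x \<in> Hc \<sigma>" "y \<in> Hc \<sigma>"
    have "cscale a x + cscale b y \<in> Hc \<sigma>"
      using C.mem_add P.cscale_mem xy unfolding Hc_def by blast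
    then show "w (cscale a x + cscale b y) = a * w x + b * w y"
      using xy sub dual_linear[OF Hneg_pairing(1)[OF \<tau> \<omega>], of x y a b] by (auto simp: w_def)
  next
    fix x assume x: "x \<in> Hc \<sigma>"
    have "cmod (w x) \<le> dual_norm \<tau> \<omega> * cnorm (ip \<tau>) x"
      using pairing_le[OF \<tau> \<omega>, of x] x sub by (auto simp: w_def)
    also have "\<dots> \<le> dual_norm \<tau> \<omega> * (c * cnorm (ip \<sigma>) x)"
      using c(2)[OF x] dual_norm_nonneg[OF \<tau> \<omega>] by (rule mult_left_mono)
    finally show "cmod (w x) \<le> dual_norm \<tau> \<omega> * c * cnorm (ip \<sigma>) x" by (simp add: mult.assoc)
  qed (simp add: w_def)
  have "restrict (pairing \<tau> \<omega>) Phi = restrict w Phi"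
    using Phi_subset[OF \<sigma>] by (auto simp: w_def restrict_def fun_eq_iff)
  then have r: "\<omega> = restrict w Phi" using Hneg_pairing(2)[OF \<tau> \<omega>] by simp
  show "\<omega> \<in> Hneg \<sigma>" unfolding r by (rule restrict_in_Hneg[OF w])
  show "pairing \<sigma> \<omega> \<xi> = pairing \<tau> \<omega> \<xi>" if "\<xi> \<in> Hc \<sigma>"
    using pairing_restrict[OF \<sigma> w] that unfolding r[symmetric] by (simp add: w_def)
qed

text \<open>The adjoint of a Hilbert-Schmidt embedding is Hilbert-Schmidt. Expanding
  \<open>\<parallel>riesz \<tau> e\<parallel>\<^sub>-\<^sub>\<sigma>\<^sup>2\<close> over the basis of \<open>\<H>\<^sub>\<sigma>\<close> and summing over \<open>e\<close> first, Bessel's inequality in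
  \<open>\<H>\<^sub>\<tau>\<close> leaves the Hilbert-Schmidt sum of the embedding.\<close>

lemma hilbert_schmidt_dual:
  assumes \<sigma>: "\<sigma> \<in> T" and \<tau>: "\<tau> \<in> T" and HS: "hilbert_schmidt_embedded (H \<sigma>) (ip \<sigma>) (H \<tau>) (ip \<tau>)"
  obtains K where "K \<ge> 0"
    "\<And>F. F \<in> orthonormal_systems \<tau> \<Longrightarrow> (\<Sum>e\<in>F. (dual_norm \<sigma> (riesz \<tau> e))\<^sup>2) \<le> K"
proof -
  interpret P: pre_hilbert "H \<sigma>" "ip \<sigma>" by (rule H_pre_hilbert) fact
  interpret Q: pre_hilbert "H \<tau>" "ip \<tau>" by (rule H_pre_hilbert) fact
  interpret D: pre_hilbert "Hc \<tau>" "\<lambda>x y. Re (cinner (ip \<tau>) x y)" by (rule Hc_pre_hilbert) fact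
  obtain B where B: "orthonormal_basis (H \<sigma>) (ip \<sigma>) B" and summ: "(\<lambda>b. (ip_norm (ip \<tau>) b)\<^sup>2) summable_on B"
    and emb: "continuously_embedded (H \<sigma>) (ip \<sigma>) (H \<tau>) (ip \<tau>)"
    using HS by (auto simp: hilbert_schmidt_embedded_def)
  have BS: "(b, 0) \<in> Hc \<sigma>" "(b, 0) \<in> Hc \<tau>" if "b \<in> B" for b
    using B emb P.closed(3) Q.closed(3) that
    by (auto simp: orthonormal_basis_def continuously_embedded_def Hc_def)
  have nb: "cnorm (ip \<tau>) (b, 0) = ip_norm (ip \<tau>) b" for b
    using Q.zero[OF Q.closed(3)] by (simp add: ip_norm_def cinner_def)
  define s where "s e b = (cmod (cinner (ip \<tau>) (b, 0) e))\<^sup>2" for e b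
  have summ_s: "s e summable_on B" if e: "e \<in> Hc \<tau>" for e
  proof (rule summable_on_comparison_test[where f = "\<lambda>b. (ip_norm (ip \<tau>) b)\<^sup>2 * (cnorm (ip \<tau>) e)\<^sup>2"])
    show "(\<lambda>b. (ip_norm (ip \<tau>) b)\<^sup>2 * (cnorm (ip \<tau>) e)\<^sup>2) summable_on B"
      by (rule summable_on_cmult_left[OF summ])
    fix b assume "b \<in> B"
    then have "cmod (cinner (ip \<tau>) (b, 0) e) \<le> ip_norm (ip \<tau>) b * cnorm (ip \<tau>) e"
      using Q.cinner_cauchy_schwarz[of "(b, 0)" e] BS(2) e nb unfolding Hc_def by metis
    then show "s e b \<le> (ip_norm (ip \<tau>) b)\<^sup>2 * (cnorm (ip \<tau>) e)\<^sup>2"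
      unfolding s_def power_mult_distrib[symmetric] by (rule power_mono) simp
  qed (simp add: s_def)
  have le: "(dual_norm \<sigma> (riesz \<tau> e))\<^sup>2 \<le> infsum (s e) B" if e: "e \<in> Hc \<tau>" for e
  proof -
    define \<omega> where "\<omega> = riesz \<tau> e"
    have \<omega>: "\<omega> \<in> Hneg \<tau>" unfolding \<omega>_def by (rule riesz_in_Hneg[OF \<tau> e])
    have \<omega>': "\<omega> \<in> Hneg \<sigma>" by (rule Hneg_mono[OF \<sigma> \<tau> emb \<omega>])
    have val: "(cmod (pairing \<sigma> \<omega> (b, 0)))\<^sup>2 = s e b" if "b \<in> B" for b
      using pairing_mono[OF \<sigma> \<tau> emb \<omega> BS(1)[OF that]] pairing_riesz[OF \<tau> e BS(2)[OF that]]
      by (simp add: \<omega>_def s_def)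
    have "dual_norm \<sigma> \<omega> \<le> sqrt (infsum (s e) B)"
    proof (rule dual_norm_le[OF \<sigma>])
      show "0 \<le> sqrt (infsum (s e) B)" by (simp add: infsum_nonneg s_def)
      fix \<xi> assume \<xi>: "\<xi> \<in> Hc \<sigma>"
      have "cmod (pairing \<sigma> \<omega> \<xi>) \<le> sqrt (\<Sum>\<^sub>\<infinity>b\<in>B. (cmod (pairing \<sigma> \<omega> (b, 0)))\<^sup>2) * cnorm (ip \<sigma>) \<xi>"
      proof (rule P.functional_bound_by_basis_values[OF B, where M = "dual_norm \<sigma> \<omega>"])
        show "(\<lambda>b. (cmod (pairing \<sigma> \<omega> (b, 0)))\<^sup>2) summable_on B"
          using summ_s[OF e] val summable_on_cong[of B "\<lambda>b. (cmod (pairing \<sigma> \<omega> (b, 0)))\<^sup>2" "s e"] by blast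
      qed (use \<xi> dual_linear[OF Hneg_pairing(1)[OF \<sigma> \<omega>']] pairing_le[OF \<sigma> \<omega>'] in \<open>auto simp: Hc_def\<close>)
      also have "(\<Sum>\<^sub>\<infinity>b\<in>B. (cmod (pairing \<sigma> \<omega> (b, 0)))\<^sup>2) = infsum (s e) B"
        using val by (rule infsum_cong)
      finally show "cmod (pairing \<sigma> \<omega> \<xi>) \<le> sqrt (infsum (s e) B) * cnorm (ip \<sigma>) \<xi>" .
    qed
    then have "(dual_norm \<sigma> \<omega>)\<^sup>2 \<le> (sqrt (infsum (s e) B))\<^sup>2"
      using dual_norm_nonneg[OF \<sigma> \<omega>'] by (rule power_mono)
    then show ?thesis by (simp add: \<omega>_def infsum_nonneg s_def)
  qed
  show thesis
  proof (rule that)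
    show "(\<Sum>\<^sub>\<infinity>b\<in>B. (ip_norm (ip \<tau>) b)\<^sup>2) \<ge> 0" by (simp add: infsum_nonneg)
    fix F assume "F \<in> orthonormal_systems \<tau>"
    then have F: "finite F" "F \<subseteq> Hc \<tau>" "corthonormal (ip \<tau>) F" by (auto simp: orthonormal_systems_def)
    have sums: "((\<lambda>b. \<Sum>e\<in>F. s e b) has_sum (\<Sum>e\<in>F. infsum (s e) B)) B"
      by (rule has_sum_sum[OF F(1)]) (use F(2) summ_s in \<open>auto intro: has_sum_infsum\<close>)
    have "(\<Sum>e\<in>F. (dual_norm \<sigma> (riesz \<tau> e))\<^sup>2) \<le> (\<Sum>e\<in>F. infsum (s e) B)"
      using le F(2) by (intro sum_mono) auto
    also have "\<dots> = (\<Sum>\<^sub>\<infinity>b\<in>B. \<Sum>e\<in>F. s e b)"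
      by (rule infsumI[OF sums, symmetric])
    also have "\<dots> \<le> (\<Sum>\<^sub>\<infinity>b\<in>B. (ip_norm (ip \<tau>) b)\<^sup>2)"
    proof (rule infsum_mono[OF _ summ])
      show "(\<lambda>b. \<Sum>e\<in>F. s e b) summable_on B"
        using sums by (rule has_sum_imp_summable)
      fix b assume "b \<in> B"
      then show "(\<Sum>e\<in>F. s e b) \<le> (ip_norm (ip \<tau>) b)\<^sup>2"
        using Q.bessel_inequality[OF F(1) _ F(3), of "(b, 0)"] F(2) BS(2) nb[of b]
        unfolding Hc_def s_def by simp
    qed
    finally show "(\<Sum>e\<in>F. (dual_norm \<sigma> (riesz \<tau> e))\<^sup>2) \<le> (\<Sum>\<^sub>\<infinity>b\<in>B. (ip_norm (ip \<tau>) b)\<^sup>2)" .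
  qed
qed

end


section \<open>Symmetric multilinear forms and uniqueness of the kernels\<close>

context hilbert_family
begin

lemma lin_comb_one_zero: "\<omega> \<in> extensional Phi \<Longrightarrow> lin_comb 1 \<omega> 0 \<eta> = \<omega>"
  by (auto simp: lin_comb_def restrict_def fun_eq_iff extensional_def)

lemma lin_comb_zero_one: "\<omega> \<in> extensional Phi \<Longrightarrow> lin_comb 1 (\<lambda>\<xi>\<in>Phi. 0) 1 \<omega> = \<omega>"
  by (auto simp: lin_comb_def restrict_def fun_eq_iff extensional_def)

lemma tensor_power_multilinear:
  assumes "\<phi> \<in> tensor_power \<tau> n" "\<omega> \<in> {..<n} \<rightarrow>\<^sub>E Hneg \<tau>" "k < n" "\<eta> \<in> Hneg \<tau>" "\<zeta> \<in> Hneg \<tau>"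
  shows "\<phi> (fun_upd \<omega> k (lin_comb a \<eta> b \<zeta>)) = a * \<phi> (fun_upd \<omega> k \<eta>) + b * \<phi> (fun_upd \<omega> k \<zeta>)"
  using assms unfolding tensor_power_def by blast

lemma tensor_power_extensional: "\<phi> \<in> tensor_power \<tau> n \<Longrightarrow> \<phi> \<in> extensional ({..<n} \<rightarrow>\<^sub>E Hneg \<tau>)"
  unfolding tensor_power_def by (erule CollectE) (elim conjE)

lemma has_kernelsD:
  assumes "has_kernels \<tau> f \<phi>"
  shows "\<phi> n \<in> sym_tensor_power \<tau> n" "\<omega> \<in> Hneg \<tau> \<Longrightarrow> (\<lambda>n. power_pairing n \<omega> (\<phi> n)) sums f \<omega>"
  using assms by (auto simp: has_kernels_def)

lemma sym_tensor_powerD: "\<phi> \<in> sym_tensor_power \<tau> n \<Longrightarrow> \<phi> \<in> tensor_power \<tau> n"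
  by (simp add: sym_tensor_power_def)

lemma PiE_upd: "\<omega> \<in> {..<n} \<rightarrow>\<^sub>E S \<Longrightarrow> k < n \<Longrightarrow> \<eta> \<in> S \<Longrightarrow> (fun_upd \<omega> k \<eta>) \<in> {..<n} \<rightarrow>\<^sub>E S"
  by (auto simp: PiE_iff extensional_def)

lemma power_pairing_scale:
  assumes \<phi>: "\<phi> \<in> tensor_power \<tau> n" and \<omega>: "\<omega> \<in> Hneg \<tau>" and z\<omega>: "lin_comb z \<omega> 0 \<omega> \<in> Hneg \<tau>"
  shows "power_pairing n (lin_comb z \<omega> 0 \<omega>) \<phi> = z ^ n * power_pairing n \<omega> \<phi>"
proof -
  define X where "X m = (\<lambda>i\<in>{..<n}. if i < m then lin_comb z \<omega> 0 \<omega> else \<omega>)" for m :: nat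
  have X: "X m \<in> {..<n} \<rightarrow>\<^sub>E Hneg \<tau>" for m using \<omega> z\<omega> by (auto simp: X_def)
  have "\<phi> (X m) = z ^ m * \<phi> (X 0)" if "m \<le> n" for m
    using that
  proof (induction m)
    case (Suc m)
    have "X (Suc m) = (fun_upd (X m) m (lin_comb z \<omega> 0 \<omega>))" "X m = (fun_upd (X m) m \<omega>)"
      using Suc.prems by (auto simp: X_def fun_eq_iff)
    then have "\<phi> (X (Suc m)) = z * \<phi> (X m)"
      using tensor_power_multilinear[OF \<phi> X, of m \<omega> \<omega> m z 0] \<omega> Suc.prems by simp
    then show ?case using Suc by simp
  qed simp
  from this[OF order_refl] have "\<phi> (X n) = z ^ n * \<phi> (X 0)" .
  moreover have "X n = (\<lambda>i\<in>{..<n}. lin_comb z \<omega> 0 \<omega>)" "X 0 = (\<lambda>i\<in>{..<n}. \<omega>)"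
    by (auto simp: X_def)
  ultimately show ?thesis by (simp add: power_pairing_def)
qed

end

context hilbert_rigging
begin

text \<open>The product rule. In the inductive step, linearity in the slot \<open>m\<close> turns the form into
  \<open>F(z) + z G(z)\<close>, where \<open>F\<close> and \<open>G\<close> are of the same shape with one slot less.\<close>

lemma multilinear_derivative:
  assumes \<tau>: "\<tau> \<in> T" and \<phi>: "\<phi> \<in> tensor_power \<tau> n" and "m \<le> n"
    and x: "x \<in> {..<n} \<rightarrow>\<^sub>E Hneg \<tau>" and y: "\<And>i. i < n \<Longrightarrow> y i \<in> Hneg \<tau>"
  shows "((\<lambda>z. \<phi> (\<lambda>i\<in>{..<n}. if i < m then lin_comb 1 (x i) z (y i) else x i))
    has_field_derivative (\<Sum>i<m. \<phi> (fun_upd x i (y i)))) (at 0)"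
  using \<open>m \<le> n\<close> x
proof (induction m arbitrary: x)
  case 0
  then show ?case by simp
next
  case (Suc m)
  define A where "A z x = (\<lambda>i\<in>{..<n}. if i < m then lin_comb 1 (x i) z (y i) else x i)" for z x
  have x: "x \<in> {..<n} \<rightarrow>\<^sub>E Hneg \<tau>" and m: "m < n" using Suc.prems by auto
  have A: "A z x \<in> {..<n} \<rightarrow>\<^sub>E Hneg \<tau>" if "x \<in> {..<n} \<rightarrow>\<^sub>E Hneg \<tau>" for x z
    using that y by (auto simp: A_def intro!: lin_comb_in_Hneg[OF \<tau>])
  define x' where "x' = fun_upd x m (y m)"
  have x': "x' \<in> {..<n} \<rightarrow>\<^sub>E Hneg \<tau>" unfolding x'_def by (rule PiE_upd[OF x m y[OF m]])
  have F: "((\<lambda>z. \<phi> (A z x)) has_field_derivative (\<Sum>i<m. \<phi> (fun_upd x i (y i)))) (at 0)"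
    unfolding A_def by (rule Suc.IH) (use m x in auto)
  have G: "((\<lambda>z. \<phi> (A z x')) has_field_derivative (\<Sum>i<m. \<phi> (fun_upd x' i (y i)))) (at 0)"
    unfolding A_def by (rule Suc.IH) (use m x' in auto)
  have split: "\<phi> (\<lambda>i\<in>{..<n}. if i < Suc m then lin_comb 1 (x i) z (y i) else x i)
      = \<phi> (A z x) + z * \<phi> (A z x')" for z
  proof -
    have "(\<lambda>i\<in>{..<n}. if i < Suc m then lin_comb 1 (x i) z (y i) else x i)
        = (fun_upd (A z x) m (lin_comb 1 (x m) z (y m)))"
      "(fun_upd (A z x) m (x m)) = A z x" "(fun_upd (A z x) m (y m)) = A z x'"
      using m by (auto simp: A_def x'_def fun_eq_iff)
    then show ?thesis
      using tensor_power_multilinear[OF \<phi> A[OF x] m, of "x m" "y m" z 1 z] m x y by (simp add: PiE_iff)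
  qed
  have ext: "x' i \<in> extensional Phi" if "i < n" for i
    using x' that Hneg_extensional by (auto simp: PiE_iff)
  have "A 0 x' = (\<lambda>i\<in>{..<n}. x' i)"
    unfolding A_def by (rule restrict_ext) (simp add: lin_comb_one_zero ext)
  also have "\<dots> = x'" using x' by (simp add: PiE_iff extensional_restrict)
  finally have A0: "A 0 x' = x'" .
  have "((\<lambda>z. \<phi> (A z x) + z * \<phi> (A z x')) has_field_derivative
      (\<Sum>i<m. \<phi> (fun_upd x i (y i))) + (1 * \<phi> (A 0 x') + (\<Sum>i<m. \<phi> (fun_upd x' i (y i))) * 0)) (at 0)"
    by (intro DERIV_add DERIV_mult F G DERIV_ident)
  then show ?case unfolding split sum.lessThan_Suc x'_def[symmetric] A0 by simp
qed

text \<open>Polarization. If the form vanishes whenever the first \<open>j + 1\<close> arguments agree, it vanishes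
  along \<open>(\<omega> + z \<eta>, \<dots>, \<omega> + z \<eta>)\<close>; by symmetry the derivative at \<open>z = 0\<close> is \<open>j + 1\<close> times its value
  with \<open>j\<close> arguments \<open>\<omega>\<close> followed by \<open>\<eta>\<close>.\<close>

lemma symmetric_form_zero_if_diagonal_zero:
  assumes \<tau>: "\<tau> \<in> T" and \<phi>: "\<phi> \<in> sym_tensor_power \<tau> n"
    and diag: "\<And>\<omega>. \<omega> \<in> Hneg \<tau> \<Longrightarrow> power_pairing n \<omega> \<phi> = 0"
    and x: "x \<in> {..<n} \<rightarrow>\<^sub>E Hneg \<tau>"
  shows "\<phi> x = 0"
proof -
  have \<phi>t: "\<phi> \<in> tensor_power \<tau> n"
    and sym: "\<And>\<pi> \<omega>. \<pi> permutes {..<n} \<Longrightarrow> \<omega> \<in> {..<n} \<rightarrow>\<^sub>E Hneg \<tau> \<Longrightarrow> \<phi> (\<omega> \<circ> \<pi>) = \<phi> \<omega>"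
    using \<phi> unfolding sym_tensor_power_def by blast+
  have "\<forall>\<omega>\<in>Hneg \<tau>. \<forall>x\<in>{..<n} \<rightarrow>\<^sub>E Hneg \<tau>. \<phi> (\<lambda>i\<in>{..<n}. if i < j then \<omega> else x i) = 0"
    if "j \<le> n" for j
    using that
  proof (induction rule: inc_induct)
    case base
    have "(\<lambda>i\<in>{..<n}. if i < n then \<omega> else x i) = (\<lambda>i\<in>{..<n}. \<omega>)" for \<omega> x by auto
    then show ?case using diag unfolding power_pairing_def by metis
  next
    case (step j)
    show ?case
    proof (intro ballI)
      fix \<omega> x assume \<omega>: "\<omega> \<in> Hneg \<tau>" and x: "x \<in> {..<n} \<rightarrow>\<^sub>E Hneg \<tau>"
      define \<eta> where "\<eta> = x j"
      have \<eta>: "\<eta> \<in> Hneg \<tau>" unfolding \<eta>_def using PiE_mem[OF x, of j] step.hyps by simp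
      define X where "X = (\<lambda>i\<in>{..<n}. if i < Suc j then \<omega> else x i)"
      have X: "X \<in> {..<n} \<rightarrow>\<^sub>E Hneg \<tau>" unfolding X_def using \<omega> PiE_mem[OF x] by (simp add: restrict_PiE_iff)
      have "\<phi> (\<lambda>i\<in>{..<n}. if i < Suc j then lin_comb 1 (X i) z \<eta> else X i) = 0" for z
      proof -
        have eq: "(\<lambda>i\<in>{..<n}. if i < Suc j then lin_comb 1 (X i) z \<eta> else X i)
            = (\<lambda>i\<in>{..<n}. if i < Suc j then lin_comb 1 \<omega> z \<eta> else x i)"
          by (auto simp: X_def)
        show ?thesis
          unfolding eq by (rule step.IH[rule_format, OF lin_comb_in_Hneg[OF \<tau> \<omega> \<eta>] x])
      qed
      moreover have "((\<lambda>z. \<phi> (\<lambda>i\<in>{..<n}. if i < Suc j then lin_comb 1 (X i) z \<eta> else X i))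
          has_field_derivative (\<Sum>i<Suc j. \<phi> (fun_upd X i \<eta>))) (at 0)"
        using step.hyps \<eta> X by (intro multilinear_derivative[OF \<tau> \<phi>t]) auto
      ultimately have "((\<lambda>z. 0) has_field_derivative (\<Sum>i<Suc j. \<phi> (fun_upd X i \<eta>))) (at (0::complex))"
        by (simp only:)
      then have sum0: "(\<Sum>i<Suc j. \<phi> (fun_upd X i \<eta>)) = 0" using DERIV_const by (rule DERIV_unique)
      have swap: "\<phi> (fun_upd X i \<eta>) = \<phi> (fun_upd X j \<eta>)" if "i < Suc j" for i
      proof -
        have "fun_upd X i \<eta> = (fun_upd X j \<eta>) \<circ> Transposition.transpose i j"
          using that step.hyps by (auto simp: fun_eq_iff X_def Transposition.transpose_def)
        moreover have "Transposition.transpose i j permutes {..<n}"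
          using that step.hyps by (intro permutes_swap_id) auto
        moreover have "fun_upd X j \<eta> \<in> {..<n} \<rightarrow>\<^sub>E Hneg \<tau>"
          using PiE_upd[OF X _ \<eta>] step.hyps by blast
        ultimately show ?thesis using sym by metis
      qed
      have "(\<Sum>i<Suc j. \<phi> (fun_upd X i \<eta>)) = (\<Sum>i<Suc j. \<phi> (fun_upd X j \<eta>))"
        by (rule sum.cong[OF refl], rule swap, erule lessThan_iff[THEN iffD1])
      from trans[OF this[symmetric] sum0]
      have "of_nat (Suc j) * \<phi> (fun_upd X j \<eta>) = 0" by (simp only: sum_constant card_lessThan)
      then have "\<phi> (fun_upd X j \<eta>) = 0" by (simp del: of_nat_Suc)
      moreover have "fun_upd X j \<eta> = (\<lambda>i\<in>{..<n}. if i < j then \<omega> else x i)"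
        using step.hyps by (auto simp: X_def \<eta>_def fun_eq_iff)
      ultimately show "\<phi> (\<lambda>i\<in>{..<n}. if i < j then \<omega> else x i) = 0" by simp
    qed
  qed
  from this[of 0] have "\<forall>\<omega>\<in>Hneg \<tau>. \<forall>x\<in>{..<n} \<rightarrow>\<^sub>E Hneg \<tau>. \<phi> (\<lambda>i\<in>{..<n}. x i) = 0" by simp
  then have "\<phi> (\<lambda>i\<in>{..<n}. x i) = 0" using x zero_in_Hneg[OF \<tau>] by blast
  moreover have "(\<lambda>i\<in>{..<n}. x i) = x" using x by (simp add: PiE_iff extensional_restrict)
  ultimately show ?thesis by simp
qed

text \<open>Sums and differences are both of the form \<open>\<phi> + c \<psi>\<close>.\<close>

definition tensor_add_scaled :: "'t \<Rightarrow> nat \<Rightarrow> ((nat \<Rightarrow> 'a \<times> 'a \<Rightarrow> complex) \<Rightarrow> complex) \<Rightarrow> complex \<Rightarrow>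
    ((nat \<Rightarrow> 'a \<times> 'a \<Rightarrow> complex) \<Rightarrow> complex) \<Rightarrow> ((nat \<Rightarrow> 'a \<times> 'a \<Rightarrow> complex) \<Rightarrow> complex)" where
  "tensor_add_scaled \<tau> n \<phi> c \<psi> = (\<lambda>\<omega>\<in>{..<n} \<rightarrow>\<^sub>E Hneg \<tau>. \<phi> \<omega> + c * \<psi> \<omega>)"

lemma riesz_tuple:
  assumes "\<tau> \<in> T" "F \<subseteq> Hc \<tau>" "e \<in> {..<n} \<rightarrow>\<^sub>E F"
  shows "(\<lambda>k\<in>{..<n}. riesz \<tau> (e k)) \<in> {..<n} \<rightarrow>\<^sub>E Hneg \<tau>"
  using assms by (auto simp: PiE_iff intro!: riesz_in_Hneg)

lemma coeff_sum_nonneg: "0 \<le> coeff_sum \<tau> n \<phi> F"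
  by (simp add: coeff_sum_def sum_nonneg)

lemma coeff_sum_add_scaled:
  assumes "\<tau> \<in> T" "F \<in> orthonormal_systems \<tau>"
  shows "sqrt (coeff_sum \<tau> n (tensor_add_scaled \<tau> n \<phi> c \<psi>) F)
    \<le> sqrt (coeff_sum \<tau> n \<phi> F) + cmod c * sqrt (coeff_sum \<tau> n \<psi> F)"
proof -
  define E where "E = {..<n} \<rightarrow>\<^sub>E F"
  define p where "p = (\<lambda>e. cmod (\<phi> (\<lambda>k\<in>{..<n}. riesz \<tau> (e k))))"
  define q where "q = (\<lambda>e. cmod (\<psi> (\<lambda>k\<in>{..<n}. riesz \<tau> (e k))))"
  have F: "F \<subseteq> Hc \<tau>" using assms(2) by (auto simp: orthonormal_systems_def)
  have "sqrt (coeff_sum \<tau> n (tensor_add_scaled \<tau> n \<phi> c \<psi>) F)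
      = L2_set (\<lambda>e. cmod (tensor_add_scaled \<tau> n \<phi> c \<psi> (\<lambda>k\<in>{..<n}. riesz \<tau> (e k)))) E"
    by (simp add: coeff_sum_def L2_set_def E_def)
  also have "\<dots> \<le> L2_set (\<lambda>e. p e + cmod c * q e) E"
  proof (rule L2_set_mono)
    fix e assume "e \<in> E"
    then show "cmod (tensor_add_scaled \<tau> n \<phi> c \<psi> (\<lambda>k\<in>{..<n}. riesz \<tau> (e k))) \<le> p e + cmod c * q e"
      using riesz_tuple[OF assms(1) F, of e n] norm_triangle_ineq[of _ "c * _"]
      by (simp add: tensor_add_scaled_def E_def p_def q_def norm_mult[symmetric])
  qed simp
  also have "\<dots> \<le> L2_set p E + L2_set (\<lambda>e. cmod c * q e) E" by (rule L2_set_triangle_ineq)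
  also have "L2_set (\<lambda>e. cmod c * q e) E = cmod c * L2_set q E"
    by (simp add: L2_set_right_distrib)
  finally show ?thesis by (simp add: coeff_sum_def L2_set_def E_def p_def q_def)
qed

lemma coeff_sum_le_tensor_norm:
  assumes "\<phi> \<in> tensor_power \<tau> n" "F \<in> orthonormal_systems \<tau>"
  shows "sqrt (coeff_sum \<tau> n \<phi> F) \<le> tensor_norm \<tau> n \<phi>"
proof -
  have "bdd_above (coeff_sum \<tau> n \<phi> ` orthonormal_systems \<tau>)"
    using assms(1) unfolding tensor_power_def mem_Collect_eq by (elim conjE)
  then show ?thesis
    unfolding tensor_norm_def using assms(2) by (intro real_sqrt_le_mono cSUP_upper)
qed

lemma empty_orthonormal_system: "{} \<in> orthonormal_systems \<tau>"
  by (simp add: orthonormal_systems_def corthonormal_def)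

lemma tensor_norm_nonneg: "\<phi> \<in> tensor_power \<tau> n \<Longrightarrow> 0 \<le> tensor_norm \<tau> n \<phi>"
  using coeff_sum_le_tensor_norm[OF _ empty_orthonormal_system] coeff_sum_nonneg[of \<tau> n \<phi> "{}"]
  by (meson order_trans real_sqrt_ge_zero)

lemma tensor_norm_le:
  assumes "\<And>F. F \<in> orthonormal_systems \<tau> \<Longrightarrow> coeff_sum \<tau> n \<phi> F \<le> M\<^sup>2" "M \<ge> 0"
  shows "tensor_norm \<tau> n \<phi> \<le> M"
proof -
  have "(SUP F\<in>orthonormal_systems \<tau>. coeff_sum \<tau> n \<phi> F) \<le> M\<^sup>2"
    using assms(1) empty_orthonormal_system by (intro cSUP_least) auto
  then show ?thesis unfolding tensor_norm_def using assms(2) real_le_lsqrt by blast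
qed

lemma
  assumes \<tau>: "\<tau> \<in> T" and \<phi>: "\<phi> \<in> tensor_power \<tau> n" and \<psi>: "\<psi> \<in> tensor_power \<tau> n"
  shows tensor_power_add_scaled: "tensor_add_scaled \<tau> n \<phi> c \<psi> \<in> tensor_power \<tau> n"
    and tensor_norm_add_scaled: "tensor_norm \<tau> n (tensor_add_scaled \<tau> n \<phi> c \<psi>)
      \<le> tensor_norm \<tau> n \<phi> + cmod c * tensor_norm \<tau> n \<psi>"
proof -
  define M where "M = tensor_norm \<tau> n \<phi> + cmod c * tensor_norm \<tau> n \<psi>"
  have M: "0 \<le> M" unfolding M_def using tensor_norm_nonneg[OF \<phi>] tensor_norm_nonneg[OF \<psi>] by simp
  have le: "coeff_sum \<tau> n (tensor_add_scaled \<tau> n \<phi> c \<psi>) F \<le> M\<^sup>2" if F: "F \<in> orthonormal_systems \<tau>" for F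
  proof -
    have "sqrt (coeff_sum \<tau> n (tensor_add_scaled \<tau> n \<phi> c \<psi>) F) \<le> M"
      using coeff_sum_add_scaled[OF \<tau> F, of n \<phi> c \<psi>] coeff_sum_le_tensor_norm[OF \<phi> F]
        mult_left_mono[OF coeff_sum_le_tensor_norm[OF \<psi> F] norm_ge_zero[of c]]
      unfolding M_def by linarith
    then show ?thesis using sqrt_le_D by blast
  qed
  show "tensor_norm \<tau> n (tensor_add_scaled \<tau> n \<phi> c \<psi>) \<le> tensor_norm \<tau> n \<phi> + cmod c * tensor_norm \<tau> n \<psi>"
    using tensor_norm_le[OF le M] by (simp add: M_def)
  have "tensor_add_scaled \<tau> n \<phi> c \<psi> (fun_upd \<omega> k (lin_comb a \<eta> b \<zeta>)) =
      a * tensor_add_scaled \<tau> n \<phi> c \<psi> (fun_upd \<omega> k \<eta>) + b * tensor_add_scaled \<tau> n \<phi> c \<psi> (fun_upd \<omega> k \<zeta>)"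
    if h: "\<omega> \<in> {..<n} \<rightarrow>\<^sub>E Hneg \<tau>" "k < n" "\<eta> \<in> Hneg \<tau>" "\<zeta> \<in> Hneg \<tau>" for \<omega> k \<eta> \<zeta> a b
    using tensor_power_multilinear[OF \<phi> h, of a b] tensor_power_multilinear[OF \<psi> h, of a b]
      PiE_upd[OF h(1,2) h(3)] PiE_upd[OF h(1,2) h(4)] PiE_upd[OF h(1,2) lin_comb_in_Hneg[OF \<tau> h(3,4)], of a b]
    by (simp add: tensor_add_scaled_def algebra_simps)
  moreover have "bdd_above (coeff_sum \<tau> n (tensor_add_scaled \<tau> n \<phi> c \<psi>) ` orthonormal_systems \<tau>)"
    using le by (intro bdd_aboveI2)
  ultimately show "tensor_add_scaled \<tau> n \<phi> c \<psi> \<in> tensor_power \<tau> n"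
    unfolding tensor_power_def mem_Collect_eq
    by (intro conjI ballI allI impI) (simp_all add: tensor_add_scaled_def)
qed

lemma sym_tensor_power_add_scaled:
  assumes \<tau>: "\<tau> \<in> T" and \<phi>: "\<phi> \<in> sym_tensor_power \<tau> n" and \<psi>: "\<psi> \<in> sym_tensor_power \<tau> n"
  shows "tensor_add_scaled \<tau> n \<phi> c \<psi> \<in> sym_tensor_power \<tau> n"
proof -
  have "\<omega> \<circ> \<pi> \<in> {..<n} \<rightarrow>\<^sub>E Hneg \<tau>" if "\<omega> \<in> {..<n} \<rightarrow>\<^sub>E Hneg \<tau>" "\<pi> permutes {..<n}" for \<omega> \<pi>
    using that permutes_in_image[OF that(2)] by (auto simp: PiE_iff extensional_def)
  moreover have "\<phi> (\<omega> \<circ> \<pi>) = \<phi> \<omega>" "\<psi> (\<omega> \<circ> \<pi>) = \<psi> \<omega>"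
    if "\<omega> \<in> {..<n} \<rightarrow>\<^sub>E Hneg \<tau>" "\<pi> permutes {..<n}" for \<omega> \<pi>
    using assms that unfolding sym_tensor_power_def by blast+
  ultimately show ?thesis
    using tensor_power_add_scaled[OF \<tau> sym_tensor_powerD[OF \<phi>] sym_tensor_powerD[OF \<psi>], of c]
    unfolding sym_tensor_power_def mem_Collect_eq
    by (intro conjI allI impI ballI) (simp_all add: tensor_add_scaled_def)
qed

lemma power_pairing_add_scaled:
  "\<omega> \<in> Hneg \<tau> \<Longrightarrow> power_pairing n \<omega> (tensor_add_scaled \<tau> n \<phi> c \<psi>)
    = power_pairing n \<omega> \<phi> + c * power_pairing n \<omega> \<psi>"
  by (simp add: power_pairing_def tensor_add_scaled_def)

lemma has_kernels_add_scaled: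
  assumes \<tau>: "\<tau> \<in> T" and f: "has_kernels \<tau> f \<phi>" and g: "has_kernels \<tau> g \<psi>"
  shows "has_kernels \<tau> (\<lambda>\<omega>\<in>Hneg \<tau>. f \<omega> + c * g \<omega>) (\<lambda>n. tensor_add_scaled \<tau> n (\<phi> n) c (\<psi> n))"
  using f g sym_tensor_power_add_scaled[OF \<tau>]
  by (auto simp: has_kernels_def power_pairing_add_scaled intro!: sums_add sums_mult)

lemma power_series_zero:
  fixes d :: "nat \<Rightarrow> complex"
  assumes "\<And>z. (\<lambda>n. d n * z ^ n) sums 0"
  shows "d n = 0"
proof (rule ccontr)
  assume n: "d n \<noteq> 0"
  have "d 0 = 0" using sums_unique2[OF assms[of 0] powser_sums_zero[of d]] by simp
  then have "n > 0" using n by (cases n) auto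
  then obtain s where "0 < s" "\<And>z::complex. z \<in> cball 0 s - {0} \<Longrightarrow> (0::complex) \<noteq> 0"
    using powser_0_nonzero[of 1 0 d "\<lambda>_. 0" n] assms n by auto
  from this(2)[of "of_real s"] this(1) show False by simp
qed

text \<open>Along each line through the origin the kernels are the coefficients of a power series.\<close>

lemma has_kernels_unique:
  assumes \<tau>: "\<tau> \<in> T" and \<phi>: "has_kernels \<tau> f \<phi>" and \<psi>: "has_kernels \<tau> f \<psi>"
  shows "\<phi> = \<psi>"
proof
  fix n
  define \<delta> where "\<delta> = (\<lambda>n. tensor_add_scaled \<tau> n (\<phi> n) (-1) (\<psi> n))"
  have \<delta>: "has_kernels \<tau> (\<lambda>\<omega>\<in>Hneg \<tau>. f \<omega> + (-1) * f \<omega>) \<delta>"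
    unfolding \<delta>_def by (rule has_kernels_add_scaled[OF assms])
  then have \<delta>s: "\<delta> n \<in> sym_tensor_power \<tau> n" for n by (simp add: has_kernels_def)
  have "power_pairing n \<omega> (\<delta> n) = 0" if \<omega>: "\<omega> \<in> Hneg \<tau>" for \<omega>
  proof (rule power_series_zero)
    fix z
    have z: "lin_comb z \<omega> 0 \<omega> \<in> Hneg \<tau>" by (rule lin_comb_in_Hneg[OF \<tau> \<omega> \<omega>])
    have "(\<lambda>n. power_pairing n (lin_comb z \<omega> 0 \<omega>) (\<delta> n)) sums 0"
      using \<delta> z by (simp add: has_kernels_def)
    then show "(\<lambda>n. power_pairing n \<omega> (\<delta> n) * z ^ n) sums 0"
      using power_pairing_scale[OF sym_tensor_powerD[OF \<delta>s] \<omega> z] by (simp add: mult.commute)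
  qed
  then have 0: "\<delta> n x = 0" if "x \<in> {..<n} \<rightarrow>\<^sub>E Hneg \<tau>" for x
    by (rule symmetric_form_zero_if_diagonal_zero[OF \<tau> \<delta>s _ that])
  have ext: "\<phi> n \<in> extensional ({..<n} \<rightarrow>\<^sub>E Hneg \<tau>)" "\<psi> n \<in> extensional ({..<n} \<rightarrow>\<^sub>E Hneg \<tau>)"
    using has_kernelsD(1)[OF \<phi>] has_kernelsD(1)[OF \<psi>] tensor_power_extensional sym_tensor_powerD by blast+
  show "\<phi> n = \<psi> n"
  proof (rule extensionalityI[OF ext])
    fix x assume x: "x \<in> {..<n} \<rightarrow>\<^sub>E Hneg \<tau>"
    show "\<phi> n x = \<psi> n x" using 0[OF x] x by (simp add: \<delta>_def tensor_add_scaled_def)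
  qed
qed

lemma kernels_eq: "\<tau> \<in> T \<Longrightarrow> has_kernels \<tau> f \<phi> \<Longrightarrow> kernels \<tau> f = \<phi>"
  unfolding kernels_def by (rule the_equality) (auto intro: has_kernels_unique)

text \<open>Every \<open>\<omega>\<close> is a multiple of \<open>riesz \<tau> e\<close> for a unit vector \<open>e\<close>, and \<open>\<phi>\<close> at the diagonal of
  \<open>riesz \<tau> e\<close> is one of the coefficients that enter the norm of \<open>\<phi>\<close>.\<close>

lemma power_pairing_le:
  assumes \<tau>: "\<tau> \<in> T" and \<phi>: "\<phi> \<in> tensor_power \<tau> n" and \<omega>: "\<omega> \<in> Hneg \<tau>"
  shows "cmod (power_pairing n \<omega> \<phi>) \<le> dual_norm \<tau> \<omega> ^ n * tensor_norm \<tau> n \<phi>"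
proof -
  interpret P: pre_hilbert "H \<tau>" "ip \<tau>" by (rule H_pre_hilbert) fact
  interpret C: pre_hilbert "Hc \<tau>" "\<lambda>x y. Re (cinner (ip \<tau>) x y)" by (rule Hc_pre_hilbert) fact
  obtain h where h: "h \<in> Hc \<tau>" "\<omega> = riesz \<tau> h" "cnorm (ip \<tau>) h \<le> dual_norm \<tau> \<omega>"
    using Hneg_riesz[OF \<tau> \<omega>] .
  define r where "r = cnorm (ip \<tau>) h"
  have r: "0 \<le> r" "r \<le> dual_norm \<tau> \<omega>" using C.norm_nonneg[OF h(1)] h(3) by (simp_all add: r_def)
  define e where "e = (1 / r) *\<^sub>R h"
  \<comment> \<open>If \<open>\<omega> = 0\<close> there is no unit vector, but then only the form without arguments matters, and
    its coefficient sum over the empty system is its absolute square.\<close>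
  define F where "F = (if r = 0 then {} else {e})"
  have e: "e \<in> Hc \<tau>" unfolding e_def by (rule C.mem_scale[OF h(1)])
  have re: "r *\<^sub>R e = h" using C.norm_eq_0[OF h(1)] by (cases "r = 0") (auto simp: e_def r_def)
  have "cnorm (ip \<tau>) e = 1" if "r \<noteq> 0"
    using C.norm_scale[OF h(1), of "1 / r"] that r(1) by (simp add: e_def flip: r_def)
  then have "corthonormal (ip \<tau>) F"
    using P.cinner_self[of e] e unfolding Hc_def by (auto simp: F_def corthonormal_def)
  then have F: "F \<in> orthonormal_systems \<tau>" using e by (simp add: orthonormal_systems_def F_def)
  have e\<omega>: "riesz \<tau> e \<in> Hneg \<tau>" by (rule riesz_in_Hneg[OF \<tau> e])
  have "cinner (ip \<tau>) \<xi> (r *\<^sub>R e) = r * cinner (ip \<tau>) \<xi> e" if "\<xi> \<in> Phi" for \<xi>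
  proof -
    have "\<xi> \<in> Hc \<tau>" using that Phi_subset[OF \<tau>] by auto
    then show ?thesis using e by (auto simp: Hc_def cinner_def P.ip_simps complex_eq_iff algebra_simps)
  qed
  then have \<omega>e: "\<omega> = lin_comb (of_real r) (riesz \<tau> e) 0 (riesz \<tau> e)"
    unfolding h(2) re[symmetric] by (auto simp: riesz_def lin_comb_def restrict_def fun_eq_iff)
  have diag: "power_pairing n \<omega> \<phi> = of_real r ^ n * power_pairing n (riesz \<tau> e) \<phi>"
    using power_pairing_scale[OF \<phi> e\<omega>, of "of_real r"] \<omega> unfolding \<omega>e by blast
  show ?thesis
  proof (cases "r = 0 \<and> n > 0")
    case True
    then show ?thesis
      using diag tensor_norm_nonneg[OF \<phi>] dual_norm_nonneg[OF \<tau> \<omega>] by (simp add: power_0_left)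
  next
    case False
    have "(cmod (power_pairing n (riesz \<tau> e) \<phi>))\<^sup>2 = coeff_sum \<tau> n \<phi> F"
    proof (cases "n = 0")
      case True
      then show ?thesis by (simp add: coeff_sum_def power_pairing_def restrict_def)
    next
      case False
      then have "F = {e}" using \<open>\<not> (r = 0 \<and> n > 0)\<close> by (simp add: F_def)
      moreover have "{..<n} \<rightarrow>\<^sub>E {e} = {\<lambda>k\<in>{..<n}. e}" 
        by (auto simp: PiE_iff extensional_def fun_eq_iff)
      moreover have "(\<lambda>k\<in>{..<n}. riesz \<tau> ((\<lambda>k\<in>{..<n}. e) k)) = (\<lambda>k\<in>{..<n}. riesz \<tau> e)" by auto
      ultimately show ?thesis by (simp add: coeff_sum_def power_pairing_def)
    qed
    then have "cmod (power_pairing n (riesz \<tau> e) \<phi>) \<le> tensor_norm \<tau> n \<phi>"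
      using coeff_sum_le_tensor_norm[OF \<phi> F] by (metis norm_ge_zero real_sqrt_unique)
    then have "cmod (power_pairing n \<omega> \<phi>) \<le> r ^ n * tensor_norm \<tau> n \<phi>"
      unfolding diag norm_mult norm_power norm_of_real using r(1) by (intro mult_mono) auto
    also have "\<dots> \<le> dual_norm \<tau> \<omega> ^ n * tensor_norm \<tau> n \<phi>"
      using r tensor_norm_nonneg[OF \<phi>] by (intro mult_right_mono power_mono)
    finally show ?thesis .
  qed
qed

end


section \<open>Separately entire functions of two variables\<close>

text \<open>Second-order Taylor estimate, from Cauchy's bound for the second derivative.\<close>

lemma entire_linear_approximation:
  fixes u :: "complex \<Rightarrow> complex"
  assumes hol: "u holomorphic_on UNIV" and M: "\<And>s. cmod s \<le> 2 \<Longrightarrow> cmod (u s) \<le> M" and h: "cmod h \<le> 1"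
  shows "cmod (u h - u 0 - h * deriv u 0) \<le> 2 * M * (cmod h)\<^sup>2"
proof -
  have d2: "cmod ((deriv ^^ 2) u s) \<le> 2 * M" if "cmod s \<le> 1" for s
  proof -
    have "cmod ((deriv ^^ 2) u s) \<le> fact 2 * M / 1 ^ 2"
    proof (rule Cauchy_inequality)
      show "u holomorphic_on ball s 1" using hol by (rule holomorphic_on_subset) simp
      show "continuous_on (cball s 1) u"
        using holomorphic_on_imp_continuous_on[OF hol] by (rule continuous_on_subset) simp
      fix x assume "cmod (s - x) = 1"
      then have "cmod x \<le> 2" using that norm_triangle_sub[of x s] by (simp add: norm_minus_commute)
      then show "cmod (u x) \<le> M" by (rule M)
    qed simp
    then show ?thesis by simp
  qed
  have "cmod ((deriv ^^ 0) u h - (\<Sum>i\<le>1. (deriv ^^ i) u 0 * (h - 0) ^ i / fact i))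
      \<le> 2 * M * cmod (h - 0) ^ Suc 1 / fact 1"
  proof (rule complex_Taylor[of "cball 0 1"])
    fix i and x :: complex
    have "(deriv ^^ i) u holomorphic_on UNIV" by (rule holomorphic_higher_deriv[OF hol open_UNIV])
    then have "((deriv ^^ i) u has_field_derivative (deriv ^^ Suc i) u x) (at x)"
      using holomorphic_derivI[of "(deriv ^^ i) u" UNIV x] by simp
    then show "((deriv ^^ i) u has_field_derivative (deriv ^^ Suc i) u x) (at x within cball 0 1)"
      by (rule has_field_derivative_at_within)
  next
    fix x :: complex assume "x \<in> cball 0 1"
    then show "cmod ((deriv ^^ Suc 1) u x) \<le> 2 * M" using d2[of x] by (simp add: numeral_2_eq_2)
  qed (use h in auto)
  then show ?thesis by (simp add: power2_eq_square algebra_simps)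
qed

text \<open>Holomorphy in each variable and boundedness on bounded sets are immediate for restrictions of
  functions to complex planes, and they suffice to differentiate in one variable under the sign of
  the other.\<close>

definition separately_entire :: "(complex \<Rightarrow> complex \<Rightarrow> complex) \<Rightarrow> bool" where
  "separately_entire g \<longleftrightarrow> (\<forall>t. (\<lambda>s. g s t) holomorphic_on UNIV) \<and> (\<forall>s. g s holomorphic_on UNIV) \<and>
     (\<forall>R. \<exists>M. \<forall>s t. cmod s \<le> R \<longrightarrow> cmod t \<le> R \<longrightarrow> cmod (g s t) \<le> M)"

text \<open>The Taylor estimate in the first variable has a constant that does not depend on the second.\<close>

lemma difference_quotient_uniform:
  assumes g: "separately_entire g"
  shows "uniform_limit (cball 0 R) (\<lambda>h t. (g h t - g 0 t) / h) (\<lambda>t. deriv (\<lambda>s. g s t) 0) (at 0)"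
proof -
  obtain M where M: "\<And>s t. cmod s \<le> max R 2 \<Longrightarrow> cmod t \<le> max R 2 \<Longrightarrow> cmod (g s t) \<le> M"
    using g unfolding separately_entire_def by meson
  have "cmod (g 0 0) \<le> M" by (rule M) auto
  then have M0: "M \<ge> 0" using norm_ge_zero order_trans by blast
  have est: "cmod ((g h t - g 0 t) / h - deriv (\<lambda>s. g s t) 0) \<le> 2 * M * cmod h"
    if "cmod t \<le> R" "cmod h \<le> 1" "h \<noteq> 0" for t h
  proof -
    have "(g h t - g 0 t) / h - deriv (\<lambda>s. g s t) 0 = (g h t - g 0 t - h * deriv (\<lambda>s. g s t) 0) / h"
      using that by (simp add: field_simps)
    also have "cmod \<dots> \<le> 2 * M * (cmod h)\<^sup>2 / cmod h"
      unfolding norm_divide using g that M unfolding separately_entire_def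
      by (intro divide_right_mono entire_linear_approximation) auto
    finally show ?thesis using that by (simp add: power2_eq_square)
  qed
  show ?thesis
  proof (rule uniform_limitI)
    fix \<epsilon> :: real assume "\<epsilon> > 0"
    define d where "d = min 1 (\<epsilon> / (2 * M + 1))"
    have d: "d > 0" "d \<le> 1" "2 * M * d < \<epsilon>"
    proof -
      show "d > 0" "d \<le> 1" using \<open>\<epsilon> > 0\<close> M0 by (auto simp: d_def)
      have "2 * M * d \<le> 2 * M * (\<epsilon> / (2 * M + 1))" using M0 by (intro mult_left_mono) (auto simp: d_def)
      also have "\<dots> < \<epsilon>" using M0 \<open>\<epsilon> > 0\<close> by (simp add: pos_divide_less_eq algebra_simps)
      finally show "2 * M * d < \<epsilon>" .
    qed
    have "dist ((g h t - g 0 t) / h) (deriv (\<lambda>s. g s t) 0) < \<epsilon>"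
      if "h \<noteq> 0" "dist h 0 < d" "t \<in> cball 0 R" for h t
    proof -
      have "cmod ((g h t - g 0 t) / h - deriv (\<lambda>s. g s t) 0) \<le> 2 * M * cmod h"
        using that d by (intro est) auto
      also have "\<dots> \<le> 2 * M * d" using that M0 by (intro mult_left_mono) auto
      also have "\<dots> < \<epsilon>" by (rule d)
      finally show ?thesis by (simp add: dist_norm)
    qed
    then show "\<forall>\<^sub>F h in at 0. \<forall>t\<in>cball 0 R. dist ((g h t - g 0 t) / h) (deriv (\<lambda>s. g s t) 0) < \<epsilon>"
      unfolding eventually_at using d(1) by blast
  qed
qed

text \<open>Locally uniform limits of holomorphic functions are holomorphic, with convergence of the
  derivatives; here the limit is that of difference quotients in the other variable.\<close>

lemma
  assumes g: "separately_entire g"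
  shows separately_entire_partial_holomorphic: "(\<lambda>t. deriv (\<lambda>s. g s t) 0) holomorphic_on UNIV"
    and mixed_derivatives_commute:
      "deriv (\<lambda>t. deriv (\<lambda>s. g s t) 0) 0 = deriv (\<lambda>s. deriv (\<lambda>t. g s t) 0) 0"
proof -
  define p where "p t = deriv (\<lambda>s. g s t) 0" for t
  define q where "q s = deriv (g s) 0" for s
  have hol1: "(\<lambda>s. g s t) holomorphic_on UNIV" and hol2: "g s holomorphic_on UNIV" for s t
    using g by (auto simp: separately_entire_def)
  have key: "\<exists>p'. \<forall>t\<in>ball 0 R. (p has_field_derivative p' t) (at t) \<and>
      ((\<lambda>h. (deriv (g h) t - deriv (g 0) t) / h) \<longlongrightarrow> p' t) (at 0)" if "R > 0" for R
  proof -
    have "\<forall>\<^sub>F h in at 0. continuous_on (cball 0 R) (\<lambda>t. (g h t - g 0 t) / h) \<and>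
        (\<forall>w\<in>ball 0 R. ((\<lambda>t. (g h t - g 0 t) / h) has_field_derivative (deriv (g h) w - deriv (g 0) w) / h) (at w))"
      unfolding eventually_at_filter
    proof (intro always_eventually allI impI conjI ballI)
      fix h :: complex assume h: "h \<noteq> 0"
      have "continuous_on UNIV (g h)" "continuous_on UNIV (g 0)"
        using hol2 holomorphic_on_imp_continuous_on by blast+
      then show "continuous_on (cball 0 R) (\<lambda>t. (g h t - g 0 t) / h)"
        using h by (intro continuous_intros) (auto intro: continuous_on_subset)
      fix w :: complex
      have "(g h has_field_derivative deriv (g h) w) (at w)" "(g 0 has_field_derivative deriv (g 0) w) (at w)"
        using holomorphic_derivI[OF hol2 open_UNIV UNIV_I] by blast+
      then show "((\<lambda>t. (g h t - g 0 t) / h) has_field_derivative (deriv (g h) w - deriv (g 0) w) / h) (at w)"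
        by (intro DERIV_cdivide DERIV_diff)
    qed
    from has_complex_derivative_uniform_limit[OF this difference_quotient_uniform[OF g] _ that]
    obtain p' where "\<And>w. w \<in> ball 0 R \<Longrightarrow> ((\<lambda>t. deriv (\<lambda>s. g s t) 0) has_field_derivative p' w) (at w) \<and>
        ((\<lambda>h. (deriv (g h) w - deriv (g 0) w) / h) \<longlongrightarrow> p' w) (at 0)"
      by auto
    then show ?thesis unfolding p_def by blast
  qed
  have "p holomorphic_on UNIV"
    unfolding holomorphic_on_open[OF open_UNIV]
  proof (intro ballI)
    fix t :: complex
    have "t \<in> ball 0 (cmod t + 1)" by simp
    then show "\<exists>p'. (p has_field_derivative p') (at t)"
      using key[of "cmod t + 1"] norm_ge_zero[of t] by (smt (verit) norm_ge_zero)
  qed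
  then show "(\<lambda>t. deriv (\<lambda>s. g s t) 0) holomorphic_on UNIV" unfolding p_def .
  obtain d where d: "(p has_field_derivative d) (at 0)" "((\<lambda>h. (q h - q 0) / h) \<longlongrightarrow> d) (at 0)"
  proof -
    obtain p' where "\<forall>t\<in>ball 0 1. (p has_field_derivative p' t) (at t) \<and>
        ((\<lambda>h. (deriv (g h) t - deriv (g 0) t) / h) \<longlongrightarrow> p' t) (at 0)"
      using key[OF zero_less_one] by (elim exE)
    from bspec[OF this, of 0] show thesis using that[of "p' 0"] unfolding q_def by simp
  qed
  have "(q has_field_derivative d) (at 0)"
    using d(2) unfolding has_field_derivative_iff by simp
  then show "deriv (\<lambda>t. deriv (\<lambda>s. g s t) 0) 0 = deriv (\<lambda>s. deriv (\<lambda>t. g s t) 0) 0"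
    using DERIV_imp_deriv[OF d(1)] DERIV_imp_deriv[of q d 0] unfolding p_def q_def by simp
qed

text \<open>Split \<open>g(h, h) - g(0, 0)\<close> at \<open>g(0, h)\<close>; the first difference quotient is uniformly close to
  a partial derivative, which is continuous in the other variable.\<close>

lemma deriv_diagonal:
  assumes g: "separately_entire g"
  shows "deriv (\<lambda>z. g z z) 0 = deriv (\<lambda>s. g s 0) 0 + deriv (g 0) 0"
proof -
  define p where "p t = deriv (\<lambda>s. g s t) 0" for t
  have p: "p holomorphic_on UNIV"
    unfolding p_def by (rule separately_entire_partial_holomorphic[OF g])
  then have "isCont p 0"
    using holomorphic_on_imp_continuous_on continuous_on_eq_continuous_at[OF open_UNIV] by blast
  then have p0: "(p \<longlongrightarrow> p 0) (at 0)" by (simp add: isCont_def)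
  have "((\<lambda>h. (g h h - g 0 h) / h - p h) \<longlongrightarrow> 0) (at 0)"
    unfolding tendsto_iff
  proof (intro allI impI)
    fix \<epsilon> :: real assume "\<epsilon> > 0"
    with difference_quotient_uniform[OF g, of 1]
    have "\<forall>\<^sub>F h in at 0. \<forall>t\<in>cball 0 1. dist ((g h t - g 0 t) / h) (p t) < \<epsilon>"
      unfolding p_def uniform_limit_iff by blast
    moreover have "\<forall>\<^sub>F h in at (0::complex). h \<in> cball 0 1"
      unfolding eventually_at by (intro exI[of _ 1]) auto
    ultimately show "\<forall>\<^sub>F h in at 0. dist ((g h h - g 0 h) / h - p h) 0 < \<epsilon>"
      by eventually_elim (auto simp: dist_norm)
  qed
  from tendsto_add[OF this p0] have 1: "((\<lambda>h. (g h h - g 0 h) / h) \<longlongrightarrow> p 0) (at 0)" by simp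
  have "g 0 holomorphic_on UNIV" using g by (auto simp: separately_entire_def)
  then have "(g 0 has_field_derivative deriv (g 0) 0) (at 0)"
    using holomorphic_derivI[OF _ open_UNIV UNIV_I] by blast
  then have 2: "((\<lambda>h. (g 0 h - g 0 0) / h) \<longlongrightarrow> deriv (g 0) 0) (at 0)"
    unfolding has_field_derivative_iff by simp
  have "((\<lambda>h. (g h h - g 0 0) / h) \<longlongrightarrow> p 0 + deriv (g 0) 0) (at 0)"
    using tendsto_add[OF 1 2] by (simp add: diff_divide_distrib)
  then have "((\<lambda>z. g z z) has_field_derivative p 0 + deriv (g 0) 0) (at 0)"
    unfolding has_field_derivative_iff by simp
  then show ?thesis unfolding p_def by (rule DERIV_imp_deriv)
qed


section \<open>Taylor coefficients of entire functions on \<open>\<H>\<^sub>-\<^sub>\<sigma>\<close>\<close>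

context hilbert_rigging
begin

text \<open>Boundedness on balls takes the place of continuity. The growth condition provides it, and by
  Cauchy's estimate it passes to directional derivatives, so that these can be iterated.\<close>

definition entire_locally_bounded :: "'t \<Rightarrow> (('a \<times> 'a \<Rightarrow> complex) \<Rightarrow> complex) set" where
  "entire_locally_bounded \<sigma> = {f \<in> extensional (Hneg \<sigma>).
     (\<forall>\<omega>\<in>Hneg \<sigma>. \<forall>\<eta>\<in>Hneg \<sigma>. (\<lambda>z. f (lin_comb 1 \<omega> z \<eta>)) holomorphic_on UNIV) \<and>
     (\<forall>R. \<exists>M. \<forall>\<omega>\<in>Hneg \<sigma>. dual_norm \<sigma> \<omega> \<le> R \<longrightarrow> cmod (f \<omega>) \<le> M)}"

definition dir_deriv ::
    "'t \<Rightarrow> ('a \<times> 'a \<Rightarrow> complex) \<Rightarrow> (('a \<times> 'a \<Rightarrow> complex) \<Rightarrow> complex) \<Rightarrow> ('a \<times> 'a \<Rightarrow> complex) \<Rightarrow> complex" where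
  "dir_deriv \<sigma> \<eta> f = (\<lambda>\<omega>\<in>Hneg \<sigma>. deriv (\<lambda>z. f (lin_comb 1 \<omega> z \<eta>)) 0)"

lemma entire_locally_boundedD:
  assumes "f \<in> entire_locally_bounded \<sigma>"
  shows "f \<in> extensional (Hneg \<sigma>)"
    and "\<omega> \<in> Hneg \<sigma> \<Longrightarrow> \<eta> \<in> Hneg \<sigma> \<Longrightarrow> (\<lambda>z. f (lin_comb 1 \<omega> z \<eta>)) holomorphic_on UNIV"
    and "\<exists>M. \<forall>\<omega>\<in>Hneg \<sigma>. dual_norm \<sigma> \<omega> \<le> R \<longrightarrow> cmod (f \<omega>) \<le> M"
  using assms unfolding entire_locally_bounded_def by blast+

lemma lin_comb_swap: "lin_comb 1 (lin_comb 1 \<omega> s \<eta>) t \<zeta> = lin_comb 1 (lin_comb 1 \<omega> t \<zeta>) s \<eta>"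
  by (auto simp: lin_comb_def restrict_def fun_eq_iff)

lemma lin_comb_same_direction: "lin_comb 1 (lin_comb 1 \<omega> s \<eta>) t \<eta> = lin_comb 1 \<omega> (s + t) \<eta>"
  by (auto simp: lin_comb_def restrict_def fun_eq_iff algebra_simps)

lemma lin_comb_two_directions: "lin_comb 1 (lin_comb 1 \<omega> z \<eta>) z \<zeta> = lin_comb 1 \<omega> z (lin_comb 1 \<eta> 1 \<zeta>)"
  by (auto simp: lin_comb_def restrict_def fun_eq_iff algebra_simps)

lemma lin_comb_scaled_direction: "lin_comb 1 \<omega> z (lin_comb a \<eta> 0 \<eta>) = lin_comb 1 \<omega> (a * z) \<eta>"
  by (auto simp: lin_comb_def restrict_def fun_eq_iff algebra_simps)

lemma lin_comb_split: "lin_comb a \<eta> b \<zeta> = lin_comb 1 (lin_comb a \<eta> 0 \<eta>) 1 (lin_comb b \<zeta> 0 \<zeta>)"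
  by (auto simp: lin_comb_def restrict_def fun_eq_iff algebra_simps)

lemma dual_norm_step:
  "\<sigma> \<in> T \<Longrightarrow> \<omega> \<in> Hneg \<sigma> \<Longrightarrow> \<eta> \<in> Hneg \<sigma> \<Longrightarrow>
    dual_norm \<sigma> (lin_comb 1 \<omega> z \<eta>) \<le> dual_norm \<sigma> \<omega> + cmod z * dual_norm \<sigma> \<eta>"
  using dual_norm_lin_comb[of \<sigma> \<omega> \<eta> 1 z] by simp

lemma separately_entire_on_plane:
  assumes \<sigma>: "\<sigma> \<in> T" and f: "f \<in> entire_locally_bounded \<sigma>"
    and \<omega>: "\<omega> \<in> Hneg \<sigma>" and \<eta>: "\<eta> \<in> Hneg \<sigma>" and \<zeta>: "\<zeta> \<in> Hneg \<sigma>"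
  shows "separately_entire (\<lambda>s t. f (lin_comb 1 (lin_comb 1 \<omega> s \<eta>) t \<zeta>))"
  unfolding separately_entire_def
proof (intro conjI allI)
  show "(\<lambda>t. f (lin_comb 1 (lin_comb 1 \<omega> s \<eta>) t \<zeta>)) holomorphic_on UNIV" for s
    by (rule entire_locally_boundedD(2)[OF f lin_comb_in_Hneg[OF \<sigma> \<omega> \<eta>] \<zeta>])
  show "(\<lambda>s. f (lin_comb 1 (lin_comb 1 \<omega> s \<eta>) t \<zeta>)) holomorphic_on UNIV" for t
    unfolding lin_comb_swap[of \<omega> _ \<eta> t \<zeta>]
    by (rule entire_locally_boundedD(2)[OF f lin_comb_in_Hneg[OF \<sigma> \<omega> \<zeta>] \<eta>])
  fix R
  obtain M where M: "\<And>\<xi>. \<xi> \<in> Hneg \<sigma> \<Longrightarrow>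
      dual_norm \<sigma> \<xi> \<le> dual_norm \<sigma> \<omega> + R * dual_norm \<sigma> \<eta> + R * dual_norm \<sigma> \<zeta> \<Longrightarrow> cmod (f \<xi>) \<le> M"
    using entire_locally_boundedD(3)[OF f] by blast
  have "cmod (f (lin_comb 1 (lin_comb 1 \<omega> s \<eta>) t \<zeta>)) \<le> M" if "cmod s \<le> R" "cmod t \<le> R" for s t
  proof (rule M)
    have m: "lin_comb 1 \<omega> s \<eta> \<in> Hneg \<sigma>" by (rule lin_comb_in_Hneg[OF \<sigma> \<omega> \<eta>])
    then show "lin_comb 1 (lin_comb 1 \<omega> s \<eta>) t \<zeta> \<in> Hneg \<sigma>" by (rule lin_comb_in_Hneg[OF \<sigma> _ \<zeta>])
    show "dual_norm \<sigma> (lin_comb 1 (lin_comb 1 \<omega> s \<eta>) t \<zeta>)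
        \<le> dual_norm \<sigma> \<omega> + R * dual_norm \<sigma> \<eta> + R * dual_norm \<sigma> \<zeta>"
      using dual_norm_step[OF \<sigma> m \<zeta>, of t] dual_norm_step[OF \<sigma> \<omega> \<eta>, of s]
        mult_right_mono[OF that(1) dual_norm_nonneg[OF \<sigma> \<eta>]]
        mult_right_mono[OF that(2) dual_norm_nonneg[OF \<sigma> \<zeta>]] by linarith
  qed
  then show "\<exists>M. \<forall>s t. cmod s \<le> R \<longrightarrow> cmod t \<le> R \<longrightarrow> cmod (f (lin_comb 1 (lin_comb 1 \<omega> s \<eta>) t \<zeta>)) \<le> M"
    by blast
qed

text \<open>Cauchy's estimate on the circle of radius \<open>r / \<parallel>\<eta>\<parallel>\<close>, on which \<open>\<omega> + z \<eta>\<close> stays within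
  distance \<open>r\<close> of \<open>\<omega>\<close>.\<close>

lemma dir_deriv_bound:
  assumes \<sigma>: "\<sigma> \<in> T" and f: "f \<in> entire_locally_bounded \<sigma>"
    and \<omega>: "\<omega> \<in> Hneg \<sigma>" and \<eta>: "\<eta> \<in> Hneg \<sigma>" and r: "r > 0"
    and M: "\<And>\<zeta>. \<zeta> \<in> Hneg \<sigma> \<Longrightarrow> dual_norm \<sigma> \<zeta> \<le> dual_norm \<sigma> \<omega> + r \<Longrightarrow> cmod (f \<zeta>) \<le> M"
  shows "cmod (dir_deriv \<sigma> \<eta> f \<omega>) \<le> dual_norm \<sigma> \<eta> / r * M"
proof (cases "dual_norm \<sigma> \<eta> = 0")
  case True
  have "lin_comb 1 \<omega> z \<eta> = \<omega>" for z
    using Hneg_extensional[OF \<omega>] dual_norm_eq_0[OF \<sigma> \<eta> True]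
    by (auto simp: lin_comb_def restrict_def fun_eq_iff extensional_def)
  then show ?thesis using True \<omega> by (simp add: dir_deriv_def)
next
  case False
  then have p: "dual_norm \<sigma> \<eta> > 0" using dual_norm_nonneg[OF \<sigma> \<eta>] by simp
  define \<rho> where "\<rho> = r / dual_norm \<sigma> \<eta>"
  have \<rho>: "\<rho> > 0" using p r by (simp add: \<rho>_def)
  define u where "u = (\<lambda>z. f (lin_comb 1 \<omega> z \<eta>))"
  have u: "u holomorphic_on UNIV" unfolding u_def by (rule entire_locally_boundedD(2)[OF f \<omega> \<eta>])
  have "cmod ((deriv ^^ 1) u 0) \<le> fact 1 * M / \<rho> ^ 1"
  proof (rule Cauchy_inequality[OF _ _ \<rho>])
    show "u holomorphic_on ball 0 \<rho>" using u by (rule holomorphic_on_subset) simp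
    show "continuous_on (cball 0 \<rho>) u"
      using holomorphic_on_imp_continuous_on[OF u] by (rule continuous_on_subset) simp
    fix z :: complex assume "cmod (0 - z) = \<rho>"
    then have "cmod z * dual_norm \<sigma> \<eta> = r" using p by (simp add: \<rho>_def)
    then show "cmod (u z) \<le> M"
      unfolding u_def using dual_norm_step[OF \<sigma> \<omega> \<eta>, of z] by (intro M lin_comb_in_Hneg \<sigma> \<omega> \<eta>) simp
  qed
  then show ?thesis using \<omega> by (simp add: dir_deriv_def u_def \<rho>_def mult.commute)
qed

lemma dir_deriv_entire:
  assumes \<sigma>: "\<sigma> \<in> T" and f: "f \<in> entire_locally_bounded \<sigma>" and \<eta>: "\<eta> \<in> Hneg \<sigma>"
  shows "dir_deriv \<sigma> \<eta> f \<in> entire_locally_bounded \<sigma>"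
  unfolding entire_locally_bounded_def mem_Collect_eq
proof (intro conjI ballI allI)
  show "dir_deriv \<sigma> \<eta> f \<in> extensional (Hneg \<sigma>)" by (simp add: dir_deriv_def)
next
  fix \<omega> \<zeta> assume \<omega>: "\<omega> \<in> Hneg \<sigma>" and \<zeta>: "\<zeta> \<in> Hneg \<sigma>"
  have "dir_deriv \<sigma> \<eta> f (lin_comb 1 \<omega> z \<zeta>) = deriv (\<lambda>s. f (lin_comb 1 (lin_comb 1 \<omega> s \<eta>) z \<zeta>)) 0" for z
    unfolding dir_deriv_def lin_comb_swap[of \<omega> _ \<eta> z \<zeta>] using lin_comb_in_Hneg[OF \<sigma> \<omega> \<zeta>] by simp
  then show "(\<lambda>z. dir_deriv \<sigma> \<eta> f (lin_comb 1 \<omega> z \<zeta>)) holomorphic_on UNIV"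
    using separately_entire_partial_holomorphic[OF separately_entire_on_plane[OF \<sigma> f \<omega> \<eta> \<zeta>]]
    by (simp only:)
next
  fix R
  obtain M where M: "\<And>\<xi>. \<xi> \<in> Hneg \<sigma> \<Longrightarrow> dual_norm \<sigma> \<xi> \<le> R + 1 \<Longrightarrow> cmod (f \<xi>) \<le> M"
    using entire_locally_boundedD(3)[OF f] by blast
  have "cmod (dir_deriv \<sigma> \<eta> f \<omega>) \<le> dual_norm \<sigma> \<eta> / 1 * M" if "\<omega> \<in> Hneg \<sigma>" "dual_norm \<sigma> \<omega> \<le> R" for \<omega>
    by (rule dir_deriv_bound[OF \<sigma> f that(1) \<eta> zero_less_one]) (use M that(2) in auto)
  then show "\<exists>M. \<forall>\<omega>\<in>Hneg \<sigma>. dual_norm \<sigma> \<omega> \<le> R \<longrightarrow> cmod (dir_deriv \<sigma> \<eta> f \<omega>) \<le> M" by blast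
qed

text \<open>Additivity is the chain rule along the diagonal of the plane spanned by the two directions.\<close>

lemma dir_deriv_linear:
  assumes \<sigma>: "\<sigma> \<in> T" and f: "f \<in> entire_locally_bounded \<sigma>"
    and \<omega>: "\<omega> \<in> Hneg \<sigma>" and \<eta>: "\<eta> \<in> Hneg \<sigma>" and \<zeta>: "\<zeta> \<in> Hneg \<sigma>"
  shows "dir_deriv \<sigma> (lin_comb a \<eta> b \<zeta>) f \<omega> = a * dir_deriv \<sigma> \<eta> f \<omega> + b * dir_deriv \<sigma> \<zeta> f \<omega>"
proof -
  have scale: "dir_deriv \<sigma> (lin_comb c \<theta> 0 \<theta>) f \<omega> = c * dir_deriv \<sigma> \<theta> f \<omega>" if \<theta>: "\<theta> \<in> Hneg \<sigma>" for c \<theta>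
  proof -
    have "((\<lambda>z. f (lin_comb 1 \<omega> z \<theta>)) has_field_derivative deriv (\<lambda>z. f (lin_comb 1 \<omega> z \<theta>)) 0) (at (c * 0))"
      using holomorphic_derivI[OF entire_locally_boundedD(2)[OF f \<omega> \<theta>] open_UNIV UNIV_I, of 0] by simp
    moreover have "((\<lambda>z. c * z) has_field_derivative c) (at 0)"
      using DERIV_cmult_Id by blast
    ultimately have "((\<lambda>z. f (lin_comb 1 \<omega> (c * z) \<theta>)) has_field_derivative
        deriv (\<lambda>z. f (lin_comb 1 \<omega> z \<theta>)) 0 * c) (at 0)"
      by (rule DERIV_chain2)
    then show ?thesis
      using \<omega> DERIV_imp_deriv by (simp add: dir_deriv_def lin_comb_scaled_direction mult.commute)
  qed
  have add: "dir_deriv \<sigma> (lin_comb 1 \<theta> 1 \<kappa>) f \<omega> = dir_deriv \<sigma> \<theta> f \<omega> + dir_deriv \<sigma> \<kappa> f \<omega>"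
    if \<theta>: "\<theta> \<in> Hneg \<sigma>" and \<kappa>: "\<kappa> \<in> Hneg \<sigma>" for \<theta> \<kappa>
  proof -
    have "lin_comb 1 (lin_comb 1 \<omega> s \<theta>) 0 \<kappa> = lin_comb 1 \<omega> s \<theta>" for s
      by (rule lin_comb_one_zero) (rule Hneg_extensional[OF lin_comb_in_Hneg[OF \<sigma> \<omega> \<theta>]])
    moreover have "lin_comb 1 \<omega> 0 \<theta> = \<omega>" by (rule lin_comb_one_zero[OF Hneg_extensional[OF \<omega>]])
    ultimately show ?thesis
      using deriv_diagonal[OF separately_entire_on_plane[OF \<sigma> f \<omega> \<theta> \<kappa>]] \<omega>
      by (simp add: dir_deriv_def lin_comb_two_directions)
  qed
  show ?thesis
    unfolding lin_comb_split[of a \<eta> b \<zeta>]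
    using add[OF lin_comb_in_Hneg[OF \<sigma> \<eta> \<eta>] lin_comb_in_Hneg[OF \<sigma> \<zeta> \<zeta>]] scale[OF \<eta>] scale[OF \<zeta>] by metis
qed

lemma dir_deriv_commute:
  assumes \<sigma>: "\<sigma> \<in> T" and f: "f \<in> entire_locally_bounded \<sigma>" and \<eta>: "\<eta> \<in> Hneg \<sigma>" and \<zeta>: "\<zeta> \<in> Hneg \<sigma>"
  shows "dir_deriv \<sigma> \<eta> (dir_deriv \<sigma> \<zeta> f) = dir_deriv \<sigma> \<zeta> (dir_deriv \<sigma> \<eta> f)"
proof (rule extensionalityI[where A = "Hneg \<sigma>"])
  fix \<omega> assume \<omega>: "\<omega> \<in> Hneg \<sigma>"
  define g where "g s t = f (lin_comb 1 (lin_comb 1 \<omega> s \<eta>) t \<zeta>)" for s t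
  have "dir_deriv \<sigma> \<eta> (dir_deriv \<sigma> \<zeta> f) \<omega> = deriv (\<lambda>s. deriv (\<lambda>t. g s t) 0) 0"
    using \<omega> lin_comb_in_Hneg[OF \<sigma> \<omega> \<eta>] by (simp add: dir_deriv_def g_def)
  also have "\<dots> = deriv (\<lambda>t. deriv (\<lambda>s. g s t) 0) 0"
    using mixed_derivatives_commute[OF separately_entire_on_plane[OF \<sigma> f \<omega> \<eta> \<zeta>]] by (simp add: g_def)
  also have "\<dots> = dir_deriv \<sigma> \<zeta> (dir_deriv \<sigma> \<eta> f) \<omega>"
    using \<omega> lin_comb_in_Hneg[OF \<sigma> \<omega> \<zeta>] by (simp add: dir_deriv_def g_def lin_comb_swap[of \<omega> _ \<eta> _ \<zeta>])
  finally show "dir_deriv \<sigma> \<eta> (dir_deriv \<sigma> \<zeta> f) \<omega> = dir_deriv \<sigma> \<zeta> (dir_deriv \<sigma> \<eta> f) \<omega>" .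
qed (simp_all add: dir_deriv_def)

lemma iterated_dir_deriv_entire:
  assumes \<sigma>: "\<sigma> \<in> T" and f: "f \<in> entire_locally_bounded \<sigma>" and xs: "set xs \<subseteq> Hneg \<sigma>"
  shows "foldr (dir_deriv \<sigma>) xs f \<in> entire_locally_bounded \<sigma>"
  using xs by (induction xs) (use f dir_deriv_entire[OF \<sigma>] in auto)

lemma iterated_dir_deriv_move:
  assumes \<sigma>: "\<sigma> \<in> T" and f: "f \<in> entire_locally_bounded \<sigma>" and "set (ys @ x # zs) \<subseteq> Hneg \<sigma>"
  shows "foldr (dir_deriv \<sigma>) (ys @ x # zs) f = dir_deriv \<sigma> x (foldr (dir_deriv \<sigma>) (ys @ zs) f)"
  using assms(3)
proof (induction ys)
  case (Cons y ys)
  have "foldr (dir_deriv \<sigma>) (ys @ zs) f \<in> entire_locally_bounded \<sigma>"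
    by (rule iterated_dir_deriv_entire[OF \<sigma> f]) (use Cons.prems in auto)
  then have "dir_deriv \<sigma> y (dir_deriv \<sigma> x (foldr (dir_deriv \<sigma>) (ys @ zs) f))
      = dir_deriv \<sigma> x (dir_deriv \<sigma> y (foldr (dir_deriv \<sigma>) (ys @ zs) f))"
    by (rule dir_deriv_commute[OF \<sigma>]) (use Cons.prems in auto)
  then show ?case using Cons by simp
qed simp

lemma iterated_dir_deriv_permute:
  assumes \<sigma>: "\<sigma> \<in> T" and f: "f \<in> entire_locally_bounded \<sigma>" and "set xs \<subseteq> Hneg \<sigma>" "mset xs = mset ys"
  shows "foldr (dir_deriv \<sigma>) xs f = foldr (dir_deriv \<sigma>) ys f"
  using assms(3,4)
proof (induction xs arbitrary: ys)
  case (Cons x xs)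
  have "x \<in> set ys" using Cons.prems(2) by (metis list.set_intros(1) set_mset_mset)
  then obtain us vs where ys: "ys = us @ x # vs" by (auto simp: in_set_conv_decomp)
  have m: "mset xs = mset (us @ vs)" using Cons.prems(2) ys by simp
  have s: "set (us @ x # vs) \<subseteq> Hneg \<sigma>" using Cons.prems ys by (metis set_mset_mset)
  have "foldr (dir_deriv \<sigma>) xs f = foldr (dir_deriv \<sigma>) (us @ vs) f"
    by (rule Cons.IH[OF _ m]) (use Cons.prems in auto)
  then show ?case using iterated_dir_deriv_move[OF \<sigma> f s] by (simp only: ys foldr.simps o_apply)
qed simp

text \<open>Each derivative costs a step of length \<open>r\<close>, so \<open>n\<close> derivatives at the origin are controlled by
  \<open>f\<close> on the ball of radius \<open>n r\<close>. For \<open>n r = R\<close> the bound is \<open>(n / R)\<^sup>n sup \<bar>f\<bar>\<close>, which is what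
  Cauchy's estimate on the diagonal followed by polarization would give.\<close>

lemma iterated_dir_deriv_bound:
  fixes r :: real
  assumes \<sigma>: "\<sigma> \<in> T" and f: "f \<in> entire_locally_bounded \<sigma>" and r: "r > 0"
    and "set xs \<subseteq> Hneg \<sigma>" "\<omega> \<in> Hneg \<sigma>"
    and "\<And>\<zeta>. \<zeta> \<in> Hneg \<sigma> \<Longrightarrow> dual_norm \<sigma> \<zeta> \<le> dual_norm \<sigma> \<omega> + length xs * r \<Longrightarrow> cmod (f \<zeta>) \<le> M"
  shows "cmod (foldr (dir_deriv \<sigma>) xs f \<omega>) \<le> M / r ^ length xs * (\<Prod>x\<leftarrow>xs. dual_norm \<sigma> x)"
  using assms(4-6)
proof (induction xs arbitrary: \<omega>)
  case (Cons x xs)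
  have x: "x \<in> Hneg \<sigma>" and xs: "set xs \<subseteq> Hneg \<sigma>" using Cons.prems(1) by auto
  have "cmod (dir_deriv \<sigma> x (foldr (dir_deriv \<sigma>) xs f) \<omega>)
      \<le> dual_norm \<sigma> x / r * (M / r ^ length xs * (\<Prod>x\<leftarrow>xs. dual_norm \<sigma> x))"
  proof (rule dir_deriv_bound[OF \<sigma> iterated_dir_deriv_entire[OF \<sigma> f xs] Cons.prems(2) x r])
    fix \<zeta> assume \<zeta>: "\<zeta> \<in> Hneg \<sigma>" "dual_norm \<sigma> \<zeta> \<le> dual_norm \<sigma> \<omega> + r"
    show "cmod (foldr (dir_deriv \<sigma>) xs f \<zeta>) \<le> M / r ^ length xs * (\<Prod>x\<leftarrow>xs. dual_norm \<sigma> x)"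
    proof (rule Cons.IH[OF xs \<zeta>(1)])
      fix \<theta> assume "\<theta> \<in> Hneg \<sigma>" "dual_norm \<sigma> \<theta> \<le> dual_norm \<sigma> \<zeta> + length xs * r"
      then show "cmod (f \<theta>) \<le> M" using \<zeta>(2) by (intro Cons.prems(3)) (auto simp: algebra_simps)
    qed
  qed
  then show ?case by (simp add: field_simps)
qed simp

text \<open>The \<open>n\<close>-th derivative at the origin divided by \<open>n!\<close>. The derivatives are those of \<open>f\<close> on
  \<open>\<H>\<^sub>-\<^sub>\<sigma>\<close>, the form is considered on the smaller space \<open>\<H>\<^sub>-\<^sub>\<tau>\<close>.\<close>

definition taylor_form :: "'t \<Rightarrow> 't \<Rightarrow> (('a \<times> 'a \<Rightarrow> complex) \<Rightarrow> complex) \<Rightarrow> nat \<Rightarrow>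
    (nat \<Rightarrow> 'a \<times> 'a \<Rightarrow> complex) \<Rightarrow> complex" where
  "taylor_form \<sigma> \<tau> f n =
     (\<lambda>x\<in>{..<n} \<rightarrow>\<^sub>E Hneg \<tau>. foldr (dir_deriv \<sigma>) (map x [0..<n]) f (\<lambda>\<xi>\<in>Phi. 0) / fact n)"

text \<open>Since the derivatives commute, the one in slot \<open>k\<close> can be taken last, and it is linear in its
  direction.\<close>

lemma taylor_form_multilinear:
  assumes \<sigma>: "\<sigma> \<in> T" and \<tau>: "\<tau> \<in> T" and sub: "Hneg \<tau> \<subseteq> Hneg \<sigma>" and f: "f \<in> entire_locally_bounded \<sigma>"
    and x: "x \<in> {..<n} \<rightarrow>\<^sub>E Hneg \<tau>" and k: "k < n" and \<eta>: "\<eta> \<in> Hneg \<tau>" and \<zeta>: "\<zeta> \<in> Hneg \<tau>"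
  shows "taylor_form \<sigma> \<tau> f n (fun_upd x k (lin_comb a \<eta> b \<zeta>)) =
    a * taylor_form \<sigma> \<tau> f n (fun_upd x k \<eta>) + b * taylor_form \<sigma> \<tau> f n (fun_upd x k \<zeta>)"
proof -
  define g where "g = foldr (dir_deriv \<sigma>) (map x (remove1 k [0..<n])) f"
  have mem: "x i \<in> Hneg \<sigma>" if "i < n" for i using PiE_mem[OF x, of i] that sub by auto
  have rm: "set (remove1 k [0..<n]) \<subseteq> {..<n}" using set_remove1_subset[of k "[0..<n]"] by auto
  have g: "g \<in> entire_locally_bounded \<sigma>"
    unfolding g_def by (rule iterated_dir_deriv_entire[OF \<sigma> f]) (use rm mem in auto)
  have form: "taylor_form \<sigma> \<tau> f n (fun_upd x k \<theta>) = dir_deriv \<sigma> \<theta> g (\<lambda>\<xi>\<in>Phi. 0) / fact n"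
    if \<theta>: "\<theta> \<in> Hneg \<tau>" for \<theta>
  proof -
    have "map (fun_upd x k \<theta>) (remove1 k [0..<n]) = map x (remove1 k [0..<n])"
      by (rule map_cong[OF refl]) (auto simp: set_remove1_eq)
    moreover have "mset [0..<n] = add_mset k (mset (remove1 k [0..<n]))" using k by simp
    ultimately have "mset (map (fun_upd x k \<theta>) [0..<n]) = mset (\<theta> # map x (remove1 k [0..<n]))"
      by (metis fun_upd_same image_mset_add_mset mset.simps(2) mset_map)
    then have "foldr (dir_deriv \<sigma>) (map (fun_upd x k \<theta>) [0..<n]) f
        = foldr (dir_deriv \<sigma>) (\<theta> # map x (remove1 k [0..<n])) f"
      by (rule iterated_dir_deriv_permute[OF \<sigma> f, rotated]) (use mem \<theta> sub in auto)
    then show ?thesis using PiE_upd[OF x k \<theta>] by (simp add: taylor_form_def g_def)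
  qed
  show ?thesis
    unfolding form[OF \<eta>] form[OF \<zeta>] form[OF lin_comb_in_Hneg[OF \<tau> \<eta> \<zeta>]]
    using dir_deriv_linear[OF \<sigma> g zero_in_Hneg[OF \<sigma>], of \<eta> \<zeta> a b] \<eta> \<zeta> sub by (auto simp: field_simps)
qed

lemma taylor_form_symmetric:
  assumes \<sigma>: "\<sigma> \<in> T" and sub: "Hneg \<tau> \<subseteq> Hneg \<sigma>" and f: "f \<in> entire_locally_bounded \<sigma>"
    and x: "x \<in> {..<n} \<rightarrow>\<^sub>E Hneg \<tau>" and \<pi>: "\<pi> permutes {..<n}"
  shows "taylor_form \<sigma> \<tau> f n (x \<circ> \<pi>) = taylor_form \<sigma> \<tau> f n x"
proof -
  have x\<pi>: "x \<circ> \<pi> \<in> {..<n} \<rightarrow>\<^sub>E Hneg \<tau>"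
    using x permutes_in_image[OF \<pi>] by (auto simp: PiE_iff extensional_def)
  have "image_mset \<pi> (mset_set {..<n}) = mset_set {..<n}"
    using image_mset_mset_set[OF permutes_inj_on[OF \<pi>]] permutes_image[OF \<pi>] by simp
  then have "image_mset (x \<circ> \<pi>) (mset_set {..<n}) = image_mset x (mset_set {..<n})"
    by (metis multiset.map_comp)
  then have "mset (map (x \<circ> \<pi>) [0..<n]) = mset (map x [0..<n])"
    by (simp add: atLeast0LessThan)
  then have "foldr (dir_deriv \<sigma>) (map (x \<circ> \<pi>) [0..<n]) f = foldr (dir_deriv \<sigma>) (map x [0..<n]) f"
    by (rule iterated_dir_deriv_permute[OF \<sigma> f, rotated]) (use PiE_mem[OF x\<pi>] sub in auto)
  then show ?thesis using x x\<pi> unfolding taylor_form_def by (simp only: restrict_apply' )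
qed

lemma iterated_dir_deriv_along_line:
  assumes \<sigma>: "\<sigma> \<in> T" and \<omega>: "\<omega> \<in> Hneg \<sigma>"
  shows "foldr (dir_deriv \<sigma>) (replicate n \<omega>) f (lin_comb 1 (\<lambda>\<xi>\<in>Phi. 0) z \<omega>)
    = (deriv ^^ n) (\<lambda>z. f (lin_comb 1 (\<lambda>\<xi>\<in>Phi. 0) z \<omega>)) z"
proof (induction n arbitrary: z)
  case (Suc n)
  define F where "F = foldr (dir_deriv \<sigma>) (replicate n \<omega>) f"
  have "foldr (dir_deriv \<sigma>) (replicate (Suc n) \<omega>) f (lin_comb 1 (\<lambda>\<xi>\<in>Phi. 0) z \<omega>)
      = deriv (\<lambda>s. F (lin_comb 1 (\<lambda>\<xi>\<in>Phi. 0) (z + s) \<omega>)) 0"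
    using lin_comb_in_Hneg[OF \<sigma> zero_in_Hneg[OF \<sigma>] \<omega>]
    by (simp add: F_def dir_deriv_def lin_comb_same_direction)
  also have "\<dots> = deriv (\<lambda>s. F (lin_comb 1 (\<lambda>\<xi>\<in>Phi. 0) s \<omega>)) z"
    using deriv_shift_0[of "\<lambda>s. F (lin_comb 1 (\<lambda>\<xi>\<in>Phi. 0) s \<omega>)" z]
    by (simp add: o_def)
  also have "(\<lambda>s. F (lin_comb 1 (\<lambda>\<xi>\<in>Phi. 0) s \<omega>)) = (deriv ^^ n) (\<lambda>z. f (lin_comb 1 (\<lambda>\<xi>\<in>Phi. 0) z \<omega>))"
    unfolding F_def by (rule ext) (rule Suc.IH)
  finally show ?case by (simp only: funpow.simps o_apply)
qed simp

lemma taylor_series: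
  assumes \<sigma>: "\<sigma> \<in> T" and sub: "Hneg \<tau> \<subseteq> Hneg \<sigma>" and f: "f \<in> entire_locally_bounded \<sigma>"
    and \<omega>: "\<omega> \<in> Hneg \<tau>"
  shows "(\<lambda>n. power_pairing n \<omega> (taylor_form \<sigma> \<tau> f n)) sums f \<omega>"
proof -
  define u where "u = (\<lambda>z. f (lin_comb 1 (\<lambda>\<xi>\<in>Phi. 0) z \<omega>))"
  have \<omega>\<sigma>: "\<omega> \<in> Hneg \<sigma>" using \<omega> sub by auto
  have z0: "lin_comb 1 (\<lambda>\<xi>\<in>Phi. 0) 0 \<omega> = (\<lambda>\<xi>\<in>Phi. 0)" by (rule lin_comb_one_zero) simp
  have "u holomorphic_on ball 0 2"
    unfolding u_def
    using entire_locally_boundedD(2)[OF f zero_in_Hneg[OF \<sigma>] \<omega>\<sigma>] by (rule holomorphic_on_subset) simp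
  then have "(\<lambda>n. (deriv ^^ n) u 0 / fact n * (1 - 0) ^ n) sums u 1"
    by (rule holomorphic_power_series) simp
  moreover have "u 1 = f \<omega>"
    unfolding u_def by (simp add: lin_comb_zero_one Hneg_extensional[OF \<omega>])
  moreover have "power_pairing n \<omega> (taylor_form \<sigma> \<tau> f n) = (deriv ^^ n) u 0 / fact n" for n
  proof -
    have "map (\<lambda>k\<in>{..<n}. \<omega>) [0..<n] = map (\<lambda>k. \<omega>) [0..<n]" by (rule map_cong) auto
    also have "\<dots> = replicate n \<omega>" by (simp add: map_replicate_const)
    finally have "power_pairing n \<omega> (taylor_form \<sigma> \<tau> f n)
        = foldr (dir_deriv \<sigma>) (replicate n \<omega>) f (\<lambda>\<xi>\<in>Phi. 0) / fact n"
      using \<omega> by (simp add: power_pairing_def taylor_form_def)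
    then show ?thesis
      using iterated_dir_deriv_along_line[OF \<sigma> \<omega>\<sigma>, of n f 0] unfolding z0 u_def by simp
  qed
  ultimately show ?thesis by simp
qed

text \<open>A bounded \<open>n\<close>-linear form on \<open>\<H>\<^sub>-\<^sub>\<sigma>\<close> restricts to a Hilbert-Schmidt form on \<open>\<H>\<^sub>-\<^sub>\<tau>\<close>: the sum over
  \<open>n\<close>-tuples of basis vectors is dominated by the \<open>n\<close>-th power of the sum over the basis.\<close>

lemma coeff_sum_bounded_form:
  assumes \<tau>: "\<tau> \<in> T" and F: "F \<in> orthonormal_systems \<tau>"
    and K: "(\<Sum>e\<in>F. (dual_norm \<sigma> (riesz \<tau> e))\<^sup>2) \<le> K"
    and C: "\<And>x. x \<in> {..<n} \<rightarrow>\<^sub>E Hneg \<tau> \<Longrightarrow> cmod (\<phi> x) \<le> C * (\<Prod>k<n. dual_norm \<sigma> (x k))"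
  shows "coeff_sum \<tau> n \<phi> F \<le> C\<^sup>2 * K ^ n"
proof -
  have fin: "finite F" and FH: "F \<subseteq> Hc \<tau>" using F by (auto simp: orthonormal_systems_def)
  have "coeff_sum \<tau> n \<phi> F \<le> (\<Sum>e\<in>{..<n} \<rightarrow>\<^sub>E F. C\<^sup>2 * (\<Prod>k<n. (dual_norm \<sigma> (riesz \<tau> (e k)))\<^sup>2))"
    unfolding coeff_sum_def
  proof (rule sum_mono)
    fix e assume e: "e \<in> {..<n} \<rightarrow>\<^sub>E F"
    have "cmod (\<phi> (\<lambda>k\<in>{..<n}. riesz \<tau> (e k))) \<le> C * (\<Prod>k<n. dual_norm \<sigma> ((\<lambda>k\<in>{..<n}. riesz \<tau> (e k)) k))"
      by (rule C[OF riesz_tuple[OF \<tau> FH e]])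
    also have "\<dots> = C * (\<Prod>k<n. dual_norm \<sigma> (riesz \<tau> (e k)))" by simp
    finally have "(cmod (\<phi> (\<lambda>k\<in>{..<n}. riesz \<tau> (e k))))\<^sup>2 \<le> (C * (\<Prod>k<n. dual_norm \<sigma> (riesz \<tau> (e k))))\<^sup>2"
      by (rule power_mono) simp
    then show "(cmod (\<phi> (\<lambda>k\<in>{..<n}. riesz \<tau> (e k))))\<^sup>2 \<le> C\<^sup>2 * (\<Prod>k<n. (dual_norm \<sigma> (riesz \<tau> (e k)))\<^sup>2)"
      by (simp add: power_mult_distrib prod_power_distrib)
  qed
  also have "\<dots> = C\<^sup>2 * (\<Sum>e\<in>{..<n} \<rightarrow>\<^sub>E F. \<Prod>k<n. (dual_norm \<sigma> (riesz \<tau> (e k)))\<^sup>2)"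
    by (simp add: sum_distrib_left)
  also have "(\<Sum>e\<in>{..<n} \<rightarrow>\<^sub>E F. \<Prod>k<n. (dual_norm \<sigma> (riesz \<tau> (e k)))\<^sup>2)
      = (\<Prod>k<n. \<Sum>e\<in>F. (dual_norm \<sigma> (riesz \<tau> e))\<^sup>2)"
    using fin by (intro prod_sum_PiE[symmetric]) auto
  also have "\<dots> = (\<Sum>e\<in>F. (dual_norm \<sigma> (riesz \<tau> e))\<^sup>2) ^ n" by simp
  also have "C\<^sup>2 * \<dots> \<le> C\<^sup>2 * K ^ n"
    using K by (intro mult_left_mono power_mono sum_nonneg) auto
  finally show ?thesis .
qed

lemma taylor_form_tensor:
  fixes r :: real
  assumes \<sigma>: "\<sigma> \<in> T" and \<tau>: "\<tau> \<in> T" and sub: "Hneg \<tau> \<subseteq> Hneg \<sigma>" and f: "f \<in> entire_locally_bounded \<sigma>"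
    and K: "K \<ge> 0" "\<And>F. F \<in> orthonormal_systems \<tau> \<Longrightarrow> (\<Sum>e\<in>F. (dual_norm \<sigma> (riesz \<tau> e))\<^sup>2) \<le> K"
    and r: "r > 0"
    and M: "\<And>\<zeta>. \<zeta> \<in> Hneg \<sigma> \<Longrightarrow> dual_norm \<sigma> \<zeta> \<le> n * r \<Longrightarrow> cmod (f \<zeta>) \<le> M"
  shows "taylor_form \<sigma> \<tau> f n \<in> sym_tensor_power \<tau> n"
    and "tensor_norm \<tau> n (taylor_form \<sigma> \<tau> f n) \<le> M / (r ^ n * fact n) * sqrt K ^ n"
proof -
  define C where "C = M / (r ^ n * fact n)"
  have "cmod (f (\<lambda>\<xi>\<in>Phi. 0)) \<le> M"
    using M[OF zero_in_Hneg[OF \<sigma>]] dual_norm_zero[OF \<sigma>] r by simp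
  then have M0: "M \<ge> 0" using norm_ge_zero order_trans by blast
  then have C: "C \<ge> 0" using r by (simp add: C_def)
  have bound: "cmod (taylor_form \<sigma> \<tau> f n x) \<le> C * (\<Prod>k<n. dual_norm \<sigma> (x k))"
    if x: "x \<in> {..<n} \<rightarrow>\<^sub>E Hneg \<tau>" for x
  proof -
    define v where "v = foldr (dir_deriv \<sigma>) (map x [0..<n]) f (\<lambda>\<xi>\<in>Phi. 0)"
    have "cmod v \<le> M / r ^ length (map x [0..<n]) * (\<Prod>y\<leftarrow>map x [0..<n]. dual_norm \<sigma> y)"
      unfolding v_def by (rule iterated_dir_deriv_bound[OF \<sigma> f r _ zero_in_Hneg[OF \<sigma>]])
        (use PiE_mem[OF x] sub M dual_norm_zero[OF \<sigma>] in auto)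
    also have "(\<Prod>y\<leftarrow>map x [0..<n]. dual_norm \<sigma> y) = (\<Prod>k<n. dual_norm \<sigma> (x k))"
      by (simp add: prod.list_conv_set_nth atLeast0LessThan)
    finally show ?thesis
      using x by (simp add: taylor_form_def C_def norm_divide field_simps flip: v_def)
  qed
  have le: "coeff_sum \<tau> n (taylor_form \<sigma> \<tau> f n) F \<le> (C * sqrt K ^ n)\<^sup>2" if F: "F \<in> orthonormal_systems \<tau>" for F
  proof -
    have "coeff_sum \<tau> n (taylor_form \<sigma> \<tau> f n) F \<le> C\<^sup>2 * K ^ n"
      by (rule coeff_sum_bounded_form[OF \<tau> F K(2)[OF F] bound])
    also have "\<dots> = (C * sqrt K ^ n)\<^sup>2"
      using K(1) by (simp add: power_mult_distrib power_mult[symmetric] mult.commute[of n 2]) (simp add: power_mult)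
    finally show ?thesis .
  qed
  show "tensor_norm \<tau> n (taylor_form \<sigma> \<tau> f n) \<le> M / (r ^ n * fact n) * sqrt K ^ n"
  proof -
    have "0 \<le> C * sqrt K ^ n" using C K(1) by simp
    from tensor_norm_le[OF le this] show ?thesis unfolding C_def .
  qed
  have "bdd_above (coeff_sum \<tau> n (taylor_form \<sigma> \<tau> f n) ` orthonormal_systems \<tau>)"
    using le by (intro bdd_aboveI2)
  then show "taylor_form \<sigma> \<tau> f n \<in> sym_tensor_power \<tau> n"
    unfolding sym_tensor_power_def tensor_power_def mem_Collect_eq
    by (intro conjI ballI allI impI taylor_form_multilinear[OF \<sigma> \<tau> sub f]
        taylor_form_symmetric[OF \<sigma> sub f]) (simp_all add: taylor_form_def)
qed

end


section \<open>Numerical estimates\<close>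

lemma power_le_fact_exp:
  fixes y :: real
  assumes "y \<ge> 0"
  shows "y ^ n \<le> fact n * exp y"
proof -
  have s: "(\<lambda>n. y ^ n /\<^sub>R fact n) sums exp y" by (rule exp_converges)
  have "(\<Sum>k\<in>{n}. y ^ k /\<^sub>R fact k) \<le> (\<Sum>k. y ^ k /\<^sub>R fact k)"
    using assms s by (intro sum_le_suminf) (auto simp: sums_iff)
  then have "y ^ n / fact n \<le> exp y" using s by (simp add: sums_iff divide_inverse mult.commute)
  then show ?thesis by (simp add: pos_divide_le_eq mult.commute)
qed

text \<open>This is the \<open>\<alpha>\<close>-th root of \<open>y\<^sup>n \<le> n! e\<^sup>y\<close> for \<open>y = (x / b)\<^sup>\<alpha>\<close>.\<close>

lemma power_le_fact_powr_exp:
  fixes x b \<alpha> :: real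
  assumes \<alpha>: "\<alpha> > 0" and b: "b > 0" and x: "x \<ge> 0"
  shows "x ^ n \<le> fact n powr (1 / \<alpha>) * b ^ n * exp (x powr \<alpha> * (b powr (- \<alpha>) / \<alpha>))"
proof (cases "x = 0")
  case True
  then show ?thesis by (cases n) (use b in simp_all)
next
  case False
  define u where "u = x / b"
  have u: "u > 0" using False x b by (simp add: u_def)
  have "u ^ n = ((u powr \<alpha>) ^ n) powr (1 / \<alpha>)"
    using u \<alpha> by (simp add: powr_powr powr_realpow[symmetric] powr_power)
  also have "\<dots> \<le> (fact n * exp (u powr \<alpha>)) powr (1 / \<alpha>)"
    using \<alpha> by (intro powr_mono2 power_le_fact_exp) auto
  also have "\<dots> = fact n powr (1 / \<alpha>) * exp (u powr \<alpha> / \<alpha>)"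
    by (simp add: powr_mult exp_powr_real)
  also have "u powr \<alpha> / \<alpha> = x powr \<alpha> * (b powr (- \<alpha>) / \<alpha>)"
    using x b by (simp add: u_def powr_divide powr_minus_divide)
  finally have "u ^ n \<le> fact n powr (1 / \<alpha>) * exp (x powr \<alpha> * (b powr (- \<alpha>) / \<alpha>))" .
  from mult_right_mono[OF this, of "b ^ n"] b show ?thesis
    by (simp add: u_def power_divide algebra_simps)
qed

text \<open>The radius \<open>n r = (2\<^sup>l\<^sup>' n)\<^sup>1\<^sup>/\<^sup>\<alpha>\<close> makes the growth bound \<open>exp (2\<^sup>-\<^sup>l\<^sup>' (n r)\<^sup>\<alpha>)\<close> equal to \<open>e\<^sup>n\<close>.\<close>

lemma taylor_radius_estimate:
  fixes \<alpha> K N :: real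
  assumes \<alpha>: "\<alpha> > 0" and K: "K \<ge> 0" and N: "N \<ge> 0"
  obtains r where "r > 0" "2 powr (- real l') * (real n * r) powr \<alpha> = real n"
    "fact n powr (1 / \<alpha>) * 2 ^ (l * n) * (N * exp (real n) / (r ^ n * fact n) * sqrt K ^ n)
      \<le> N * (exp 2 * 2 ^ l * sqrt K * (2 powr (- 1 / \<alpha>)) ^ l') ^ n"
proof (cases "n = 0")
  case True
  \<comment> \<open>For the constant term no derivative is taken, and any radius will do.\<close>
  show thesis by (rule that[of 1]) (simp_all add: True)
next
  case False
  define c where "c = 2 powr (real l' / \<alpha>)"
  define p where "p = real n powr (1 / \<alpha>)"
  define r where "r = p * c / real n"
  have n: "real n > 0" using False by simp
  have pos: "c > 0" "p > 0" using n by (simp_all add: c_def p_def)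
  then have r: "r > 0" using n by (simp add: r_def)
  have ppow: "p ^ n = (real n ^ n) powr (1 / \<alpha>)"
    using n by (simp add: p_def powr_powr powr_power powr_realpow[symmetric] mult.commute)
  have "(fact n :: real) \<le> real n ^ n" using fact_le_power[of n, where 'a = real] by simp
  then have 1: "fact n powr (1 / \<alpha>) \<le> p ^ n"
    unfolding ppow using \<alpha> by (intro powr_mono2) auto
  have 2: "real n ^ n \<le> fact n * exp (real n)" by (rule power_le_fact_exp) simp
  have q: "(2 powr (- 1 / \<alpha>)) ^ l' = 1 / c"
    by (simp add: c_def powr_power powr_minus_divide[symmetric])
  show thesis
  proof (rule that[OF r])
    have "(real n * r) powr \<alpha> = (p * c) powr \<alpha>" using n by (simp add: r_def)
    also have "\<dots> = real n * 2 ^ l'"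
      using n \<alpha> by (simp add: p_def c_def powr_mult powr_powr powr_realpow)
    finally show "2 powr (- real l') * (real n * r) powr \<alpha> = real n"
      by (simp add: powr_minus powr_realpow)
    define X where "X = N * exp (real n) * (2 ^ l * sqrt K / c) ^ n"
    have X: "X \<ge> 0" using N K pos by (simp add: X_def)
    have "fact n powr (1 / \<alpha>) * 2 ^ (l * n) * (N * exp (real n) / (r ^ n * fact n) * sqrt K ^ n)
        = (fact n powr (1 / \<alpha>) / p ^ n) * (real n ^ n / fact n) * X"
      using pos n by (simp add: r_def X_def power_mult_distrib power_divide power_mult mult_ac)
    also have "\<dots> \<le> 1 * exp (real n) * X"
      using 1 2 pos X by (intro mult_right_mono mult_mono) (auto simp: pos_divide_le_eq mult.commute)
    also have "\<dots> = N * (exp 2 * 2 ^ l * sqrt K * (2 powr (- 1 / \<alpha>)) ^ l') ^ n"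
    proof -
      have "exp (real n) * exp (real n) = exp 2 ^ n"
        by (simp add: exp_of_nat_mult[symmetric] exp_add[symmetric])
      then show ?thesis unfolding q X_def by (simp add: power_mult_distrib power_divide)
    qed
    finally show "fact n powr (1 / \<alpha>) * 2 ^ (l * n) * (N * exp (real n) / (r ^ n * fact n) * sqrt K ^ n)
      \<le> N * (exp 2 * 2 ^ l * sqrt K * (2 powr (- 1 / \<alpha>)) ^ l') ^ n" .
  qed
qed

section \<open>Comparison of the two families of norms\<close>

context hilbert_rigging
begin

text \<open>The points of the topology of \<open>\<H>\<^sub>-\<^sub>\<tau>\<close> can be read off its definition only once the distance is known
  to be a metric.\<close>

lemma Hneg_metric:
  assumes \<tau>: "\<tau> \<in> T"
  shows "Metric_space (Hneg \<tau>) (dist_on (Hneg \<tau>) (\<lambda>\<omega> \<eta>. dual_norm \<tau> (lin_comb 1 \<omega> (-1) \<eta>)))"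
proof -
  have comm: "dual_norm \<tau> (lin_comb 1 \<eta> (-1) \<omega>) \<le> dual_norm \<tau> (lin_comb 1 \<omega> (-1) \<eta>)"
    if "\<omega> \<in> Hneg \<tau>" "\<eta> \<in> Hneg \<tau>" for \<omega> \<eta>
  proof -
    have "lin_comb 1 \<eta> (-1) \<omega> = lin_comb (-1) (lin_comb 1 \<omega> (-1) \<eta>) 0 (lin_comb 1 \<omega> (-1) \<eta>)"
      by (auto simp: lin_comb_def restrict_def fun_eq_iff)
    then show ?thesis
      using dual_norm_lin_comb[OF \<tau> lin_comb_in_Hneg[OF \<tau> that] lin_comb_in_Hneg[OF \<tau> that], of "-1" 1 "-1" 0 1 "-1"]
      by simp
  qed
  show ?thesis
  proof
    show "0 \<le> dist_on (Hneg \<tau>) (\<lambda>\<omega> \<eta>. dual_norm \<tau> (lin_comb 1 \<omega> (-1) \<eta>)) x y" for x y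
      using dual_norm_nonneg[OF \<tau> lin_comb_in_Hneg[OF \<tau>]] by (simp add: dist_on_def)
    show "dist_on (Hneg \<tau>) (\<lambda>\<omega> \<eta>. dual_norm \<tau> (lin_comb 1 \<omega> (-1) \<eta>)) x y =
        dist_on (Hneg \<tau>) (\<lambda>\<omega> \<eta>. dual_norm \<tau> (lin_comb 1 \<omega> (-1) \<eta>)) y x" for x y
      using comm[of x y] comm[of y x] by (auto simp: dist_on_def)
    show "dist_on (Hneg \<tau>) (\<lambda>\<omega> \<eta>. dual_norm \<tau> (lin_comb 1 \<omega> (-1) \<eta>)) x y = 0 \<longleftrightarrow> x = y"
      if xy: "x \<in> Hneg \<tau>" "y \<in> Hneg \<tau>" for x y
    proof
      assume "x = y"
      then have "lin_comb 1 x (-1) y = (\<lambda>\<xi>\<in>Phi. 0)" by (auto simp: lin_comb_def)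
      then show "dist_on (Hneg \<tau>) (\<lambda>\<omega> \<eta>. dual_norm \<tau> (lin_comb 1 \<omega> (-1) \<eta>)) x y = 0"
        using dual_norm_zero[OF \<tau>] by (simp only: dist_on_def if_cancel)
    next
      assume "dist_on (Hneg \<tau>) (\<lambda>\<omega> \<eta>. dual_norm \<tau> (lin_comb 1 \<omega> (-1) \<eta>)) x y = 0"
      then have "dual_norm \<tau> (lin_comb 1 x (-1) y) = 0" using xy by (simp add: dist_on_def)
      from dual_norm_eq_0[OF \<tau> lin_comb_in_Hneg[OF \<tau> xy] this]
      have z: "lin_comb 1 x (-1) y \<xi> = 0" if "\<xi> \<in> Phi" for \<xi> using that by simp
      show "x = y"
      proof (rule extensionalityI[OF Hneg_extensional[OF xy(1)] Hneg_extensional[OF xy(2)]])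
        show "x \<xi> = y \<xi>" if "\<xi> \<in> Phi" for \<xi> using z[OF that] that by (simp add: lin_comb_def)
      qed
    qed
    show "dist_on (Hneg \<tau>) (\<lambda>\<omega> \<eta>. dual_norm \<tau> (lin_comb 1 \<omega> (-1) \<eta>)) x z
        \<le> dist_on (Hneg \<tau>) (\<lambda>\<omega> \<eta>. dual_norm \<tau> (lin_comb 1 \<omega> (-1) \<eta>)) x y +
          dist_on (Hneg \<tau>) (\<lambda>\<omega> \<eta>. dual_norm \<tau> (lin_comb 1 \<omega> (-1) \<eta>)) y z"
      if xyz: "x \<in> Hneg \<tau>" "y \<in> Hneg \<tau>" "z \<in> Hneg \<tau>" for x y z
    proof -
      have "lin_comb 1 x (-1) z = lin_comb 1 (lin_comb 1 x (-1) y) 1 (lin_comb 1 y (-1) z)"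
        by (auto simp: lin_comb_def restrict_def fun_eq_iff)
      then show ?thesis
        using dual_norm_lin_comb[OF \<tau> lin_comb_in_Hneg[OF \<tau> xyz(1,2)] lin_comb_in_Hneg[OF \<tau> xyz(2,3)], of 1 1 "-1" 1 1 "-1"] xyz
        by (simp add: dist_on_def)
    qed
  qed
qed

lemma topspace_Hneg_topology: "\<tau> \<in> T \<Longrightarrow> topspace (Hneg_topology \<tau>) = Hneg \<tau>"
  unfolding Hneg_topology_def topology_on_def by (rule Metric_space.topspace_mtopology[OF Hneg_metric])

definition fun_add_scaled :: "'t \<Rightarrow> (('a \<times> 'a \<Rightarrow> complex) \<Rightarrow> complex) \<Rightarrow> complex \<Rightarrow>
    (('a \<times> 'a \<Rightarrow> complex) \<Rightarrow> complex) \<Rightarrow> (('a \<times> 'a \<Rightarrow> complex) \<Rightarrow> complex)" where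
  "fun_add_scaled \<tau> f c g = (\<lambda>\<omega>\<in>Hneg \<tau>. f \<omega> + c * g \<omega>)"

lemma entire_onD:
  assumes "f \<in> entire_on \<tau>"
  shows "f \<in> extensional (Hneg \<tau>)" "continuous_map (Hneg_topology \<tau>) euclidean f"
    "\<omega> \<in> Hneg \<tau> \<Longrightarrow> \<eta> \<in> Hneg \<tau> \<Longrightarrow> (\<lambda>z. f (lin_comb 1 \<omega> z \<eta>)) holomorphic_on UNIV"
  using assms unfolding entire_on_def by blast+

lemma entire_on_add_scaled:
  assumes \<tau>: "\<tau> \<in> T" and f: "f \<in> entire_on \<tau>" and g: "g \<in> entire_on \<tau>"
  shows "fun_add_scaled \<tau> f c g \<in> entire_on \<tau>"
  unfolding entire_on_def mem_Collect_eq
proof (intro conjI ballI)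
  show "fun_add_scaled \<tau> f c g \<in> extensional (Hneg \<tau>)" by (simp add: fun_add_scaled_def)
  have "continuous_map (Hneg_topology \<tau>) euclidean ((\<lambda>z. c * z) \<circ> g)"
    by (rule continuous_map_compose[OF entire_onD(2)[OF g]]) (simp add: continuous_on_mult_left continuous_on_id)
  then have "continuous_map (Hneg_topology \<tau>) euclidean (\<lambda>\<omega>. f \<omega> + c * g \<omega>)"
    using continuous_map_add[OF entire_onD(2)[OF f]] by (simp add: o_def)
  then show "continuous_map (Hneg_topology \<tau>) euclidean (fun_add_scaled \<tau> f c g)"
    by (rule continuous_map_eq) (simp add: topspace_Hneg_topology[OF \<tau>] fun_add_scaled_def)
  fix \<omega> \<eta> assume h: "\<omega> \<in> Hneg \<tau>" "\<eta> \<in> Hneg \<tau>"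
  have "(\<lambda>z. f (lin_comb 1 \<omega> z \<eta>) + c * g (lin_comb 1 \<omega> z \<eta>)) holomorphic_on UNIV"
    by (intro holomorphic_intros entire_onD(3)[OF f h] entire_onD(3)[OF g h])
  then show "(\<lambda>z. fun_add_scaled \<tau> f c g (lin_comb 1 \<omega> z \<eta>)) holomorphic_on UNIV"
    using lin_comb_in_Hneg[OF \<tau> h] by (simp add: fun_add_scaled_def)
qed

definition weighted :: "real \<Rightarrow> 't \<Rightarrow> nat \<Rightarrow> (('a \<times> 'a \<Rightarrow> complex) \<Rightarrow> complex) \<Rightarrow> ('a \<times> 'a \<Rightarrow> complex) \<Rightarrow> real" where
  "weighted \<alpha> \<tau> l f \<omega> = cmod (f \<omega>) * exp (- (2 powr (- real l) * dual_norm \<tau> \<omega> powr \<alpha>))"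

lemma growth_spaceI:
  assumes "\<tau> \<in> T" "f \<in> entire_on \<tau>" and N: "\<And>\<omega>. \<omega> \<in> Hneg \<tau> \<Longrightarrow> weighted \<alpha> \<tau> l f \<omega> \<le> N"
  shows "f \<in> growth_space \<alpha> \<tau> l" "growth_norm \<alpha> \<tau> l f \<le> N"
proof -
  have "bdd_above (weighted \<alpha> \<tau> l f ` Hneg \<tau>)" using N by (intro bdd_aboveI2)
  then show "f \<in> growth_space \<alpha> \<tau> l" using assms(2) unfolding growth_space_def weighted_def by simp
  have "(SUP \<omega>\<in>Hneg \<tau>. weighted \<alpha> \<tau> l f \<omega>) \<le> N"
    using N zero_in_Hneg[OF assms(1)] by (intro cSUP_least) auto
  then show "growth_norm \<alpha> \<tau> l f \<le> N" by (simp add: growth_norm_def weighted_def)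
qed

lemma growth_spaceD:
  assumes "f \<in> growth_space \<alpha> \<tau> l"
  shows "f \<in> entire_on \<tau>" "\<omega> \<in> Hneg \<tau> \<Longrightarrow> weighted \<alpha> \<tau> l f \<omega> \<le> growth_norm \<alpha> \<tau> l f"
proof -
  show "f \<in> entire_on \<tau>" using assms unfolding growth_space_def by blast
  have "bdd_above (weighted \<alpha> \<tau> l f ` Hneg \<tau>)"
    using assms unfolding growth_space_def weighted_def mem_Collect_eq by (elim conjE)
  then have "weighted \<alpha> \<tau> l f \<omega> \<le> (SUP \<omega>\<in>Hneg \<tau>. weighted \<alpha> \<tau> l f \<omega>)" if "\<omega> \<in> Hneg \<tau>"
    using that by (intro cSUP_upper)
  then show "\<omega> \<in> Hneg \<tau> \<Longrightarrow> weighted \<alpha> \<tau> l f \<omega> \<le> growth_norm \<alpha> \<tau> l f"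
    by (simp add: growth_norm_def weighted_def)
qed

lemma growth_add_scaled:
  assumes \<tau>: "\<tau> \<in> T" and f: "f \<in> growth_space \<alpha> \<tau> l" and g: "g \<in> growth_space \<alpha> \<tau> l"
  shows "fun_add_scaled \<tau> f c g \<in> growth_space \<alpha> \<tau> l"
    and "growth_norm \<alpha> \<tau> l (fun_add_scaled \<tau> f c g) \<le> growth_norm \<alpha> \<tau> l f + cmod c * growth_norm \<alpha> \<tau> l g"
proof -
  have "weighted \<alpha> \<tau> l (fun_add_scaled \<tau> f c g) \<omega> \<le> growth_norm \<alpha> \<tau> l f + cmod c * growth_norm \<alpha> \<tau> l g"
    if \<omega>: "\<omega> \<in> Hneg \<tau>" for \<omega>
  proof -
    have "weighted \<alpha> \<tau> l (fun_add_scaled \<tau> f c g) \<omega>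
        \<le> (cmod (f \<omega>) + cmod c * cmod (g \<omega>)) * exp (- (2 powr (- real l) * dual_norm \<tau> \<omega> powr \<alpha>))"
      using \<omega> norm_triangle_ineq[of "f \<omega>" "c * g \<omega>"]
      unfolding weighted_def by (intro mult_right_mono) (auto simp: fun_add_scaled_def norm_mult)
    also have "\<dots> = weighted \<alpha> \<tau> l f \<omega> + cmod c * weighted \<alpha> \<tau> l g \<omega>"
      by (simp add: weighted_def algebra_simps)
    also have "\<dots> \<le> growth_norm \<alpha> \<tau> l f + cmod c * growth_norm \<alpha> \<tau> l g"
      using growth_spaceD(2)[OF f \<omega>] growth_spaceD(2)[OF g \<omega>] by (intro add_mono mult_left_mono) auto
    finally show ?thesis .
  qed
  from growth_spaceI[OF \<tau> entire_on_add_scaled[OF \<tau> growth_spaceD(1)[OF f] growth_spaceD(1)[OF g]] this]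
  show "fun_add_scaled \<tau> f c g \<in> growth_space \<alpha> \<tau> l"
    and "growth_norm \<alpha> \<tau> l (fun_add_scaled \<tau> f c g) \<le> growth_norm \<alpha> \<tau> l f + cmod c * growth_norm \<alpha> \<tau> l g"
    by blast+
qed

definition kernel_term :: "real \<Rightarrow> 't \<Rightarrow> nat \<Rightarrow> (nat \<Rightarrow> (nat \<Rightarrow> 'a \<times> 'a \<Rightarrow> complex) \<Rightarrow> complex) \<Rightarrow> nat \<Rightarrow> real" where
  "kernel_term \<alpha> \<tau> l \<phi> n = fact n powr (1 / \<alpha>) * 2 ^ (l * n) * tensor_norm \<tau> n (\<phi> n)"

lemma kernel_term_nonneg: "has_kernels \<tau> f \<phi> \<Longrightarrow> 0 \<le> kernel_term \<alpha> \<tau> l \<phi> n"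
  unfolding kernel_term_def
  by (intro mult_nonneg_nonneg tensor_norm_nonneg sym_tensor_powerD) (auto simp: has_kernels_def)

lemma kernel_spaceI:
  assumes "\<tau> \<in> T" "f \<in> entire_on \<tau>" "has_kernels \<tau> f \<phi>" "summable (kernel_term \<alpha> \<tau> l \<phi>)"
  shows "f \<in> kernel_space \<alpha> \<tau> l" "kernel_norm \<alpha> \<tau> l f = (\<Sum>n. kernel_term \<alpha> \<tau> l \<phi> n)"
proof -
  have "summable (\<lambda>n. fact n powr (1 / \<alpha>) * 2 ^ (l * n) * tensor_norm \<tau> n (\<phi> n))"
    using assms(4) unfolding kernel_term_def[abs_def] .
  then show "f \<in> kernel_space \<alpha> \<tau> l" using assms(2,3) unfolding kernel_space_def by blast
  show "kernel_norm \<alpha> \<tau> l f = (\<Sum>n. kernel_term \<alpha> \<tau> l \<phi> n)"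
    unfolding kernel_norm_def kernel_term_def kernels_eq[OF assms(1,3)] ..
qed

lemma kernel_spaceE:
  assumes "\<tau> \<in> T" "f \<in> kernel_space \<alpha> \<tau> l"
  obtains \<phi> where "f \<in> entire_on \<tau>" "has_kernels \<tau> f \<phi>" "summable (kernel_term \<alpha> \<tau> l \<phi>)"
    "kernel_norm \<alpha> \<tau> l f = (\<Sum>n. kernel_term \<alpha> \<tau> l \<phi> n)"
proof -
  obtain \<phi> where \<phi>: "f \<in> entire_on \<tau>" "has_kernels \<tau> f \<phi>"
    "summable (\<lambda>n. fact n powr (1 / \<alpha>) * 2 ^ (l * n) * tensor_norm \<tau> n (\<phi> n))"
    using assms(2) unfolding kernel_space_def by blast
  have s: "summable (kernel_term \<alpha> \<tau> l \<phi>)" using \<phi>(3) unfolding kernel_term_def[abs_def] .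
  show thesis by (rule that[OF \<phi>(1,2) s kernel_spaceI(2)[OF assms(1) \<phi>(1,2) s]])
qed

lemma kernel_add_scaled:
  assumes \<tau>: "\<tau> \<in> T" and f: "f \<in> kernel_space \<alpha> \<tau> l" and g: "g \<in> kernel_space \<alpha> \<tau> l"
  shows "fun_add_scaled \<tau> f c g \<in> kernel_space \<alpha> \<tau> l"
    and "kernel_norm \<alpha> \<tau> l (fun_add_scaled \<tau> f c g) \<le> kernel_norm \<alpha> \<tau> l f + cmod c * kernel_norm \<alpha> \<tau> l g"
proof -
  obtain \<phi> where \<phi>: "f \<in> entire_on \<tau>" "has_kernels \<tau> f \<phi>" "summable (kernel_term \<alpha> \<tau> l \<phi>)"
    "kernel_norm \<alpha> \<tau> l f = (\<Sum>n. kernel_term \<alpha> \<tau> l \<phi> n)" using kernel_spaceE[OF \<tau> f] .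
  obtain \<psi> where \<psi>: "g \<in> entire_on \<tau>" "has_kernels \<tau> g \<psi>" "summable (kernel_term \<alpha> \<tau> l \<psi>)"
    "kernel_norm \<alpha> \<tau> l g = (\<Sum>n. kernel_term \<alpha> \<tau> l \<psi> n)" using kernel_spaceE[OF \<tau> g] .
  define \<theta> where "\<theta> = (\<lambda>n. tensor_add_scaled \<tau> n (\<phi> n) c (\<psi> n))"
  have \<theta>: "has_kernels \<tau> (fun_add_scaled \<tau> f c g) \<theta>"
    unfolding fun_add_scaled_def \<theta>_def by (rule has_kernels_add_scaled[OF \<tau> \<phi>(2) \<psi>(2)])
  have le: "kernel_term \<alpha> \<tau> l \<theta> n \<le> kernel_term \<alpha> \<tau> l \<phi> n + cmod c * kernel_term \<alpha> \<tau> l \<psi> n" for n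
  proof -
    have "tensor_norm \<tau> n (\<theta> n) \<le> tensor_norm \<tau> n (\<phi> n) + cmod c * tensor_norm \<tau> n (\<psi> n)"
      unfolding \<theta>_def using \<phi>(2) \<psi>(2)
      by (intro tensor_norm_add_scaled[OF \<tau>] sym_tensor_powerD) (auto simp: has_kernels_def)
    from mult_left_mono[OF this, of "fact n powr (1 / \<alpha>) * 2 ^ (l * n)"] show ?thesis
      by (simp add: kernel_term_def algebra_simps)
  qed
  have s2: "summable (\<lambda>n. kernel_term \<alpha> \<tau> l \<phi> n + cmod c * kernel_term \<alpha> \<tau> l \<psi> n)"
    by (intro summable_add summable_mult \<phi> \<psi>)
  have s: "summable (kernel_term \<alpha> \<tau> l \<theta>)"
    using s2 by (rule summable_comparison_test'[where N = 0]) (use le kernel_term_nonneg[OF \<theta>] in simp)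
  have e: "fun_add_scaled \<tau> f c g \<in> entire_on \<tau>" by (rule entire_on_add_scaled[OF \<tau> \<phi>(1) \<psi>(1)])
  show "fun_add_scaled \<tau> f c g \<in> kernel_space \<alpha> \<tau> l" by (rule kernel_spaceI(1)[OF \<tau> e \<theta> s])
  have "kernel_norm \<alpha> \<tau> l (fun_add_scaled \<tau> f c g) = (\<Sum>n. kernel_term \<alpha> \<tau> l \<theta> n)"
    by (rule kernel_spaceI(2)[OF \<tau> e \<theta> s])
  also have "\<dots> \<le> (\<Sum>n. kernel_term \<alpha> \<tau> l \<phi> n + cmod c * kernel_term \<alpha> \<tau> l \<psi> n)"
    by (rule suminf_le[OF le s s2])
  also have "\<dots> = kernel_norm \<alpha> \<tau> l f + cmod c * kernel_norm \<alpha> \<tau> l g"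
    unfolding \<phi>(4) \<psi>(4) using \<phi>(3) \<psi>(3) by (simp add: suminf_add[symmetric] suminf_mult summable_mult)
  finally show "kernel_norm \<alpha> \<tau> l (fun_add_scaled \<tau> f c g) \<le> kernel_norm \<alpha> \<tau> l f + cmod c * kernel_norm \<alpha> \<tau> l g" .
qed

text \<open>The \<open>n\<close>-th term of the series at \<open>\<omega>\<close> is at most \<open>\<parallel>\<omega>\<parallel>\<^sup>n\<close> times the norm of the kernel, and the weight
  \<open>(n!)\<^sup>1\<^sup>/\<^sup>\<alpha> 2\<^sup>l\<^sup>'\<^sup>n\<close> absorbs \<open>\<parallel>\<omega>\<parallel>\<^sup>n\<close> up to \<open>exp (2\<^sup>-\<^sup>l\<^sup>'\<^sup>\<alpha> \<parallel>\<omega>\<parallel>\<^sup>\<alpha> / \<alpha>)\<close>. The exponent is below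
  \<open>2\<^sup>-\<^sup>l \<parallel>\<omega>\<parallel>\<^sup>\<alpha>\<close> once \<open>l'\<close> is large.\<close>

lemma kernel_space_growth:
  assumes \<tau>: "\<tau> \<in> T" and \<alpha>: "\<alpha> > 0"
  obtains l' where "\<And>f. f \<in> kernel_space \<alpha> \<tau> l' \<Longrightarrow>
    f \<in> growth_space \<alpha> \<tau> l \<and> growth_norm \<alpha> \<tau> l f \<le> kernel_norm \<alpha> \<tau> l' f"
proof -
  have "\<exists>m. (2 powr (- \<alpha>)) ^ m < \<alpha> * 2 powr (- real l)"
    using \<alpha> by (intro real_arch_pow_inv) (auto simp: powr_less_one)
  then obtain l' where l': "(2 powr (- \<alpha>)) ^ l' < \<alpha> * 2 powr (- real l)" ..
  have "(2 ^ l') powr (- \<alpha>) = (2 powr (- \<alpha>)) ^ l'"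
    by (simp add: powr_power powr_powr powr_realpow[symmetric] mult.commute)
  then have b: "(2 ^ l') powr (- \<alpha>) / \<alpha> \<le> 2 powr (- real l)"
    using l' \<alpha> by (simp add: pos_divide_le_eq mult.commute)
  show thesis
  proof (rule that)
    fix f assume "f \<in> kernel_space \<alpha> \<tau> l'"
    then obtain \<phi> where f: "f \<in> entire_on \<tau>" and \<phi>: "has_kernels \<tau> f \<phi>"
      and s: "summable (kernel_term \<alpha> \<tau> l' \<phi>)" and kn: "kernel_norm \<alpha> \<tau> l' f = (\<Sum>n. kernel_term \<alpha> \<tau> l' \<phi> n)"
      using kernel_spaceE[OF \<tau>] by blast
    have "weighted \<alpha> \<tau> l f \<omega> \<le> kernel_norm \<alpha> \<tau> l' f" if \<omega>: "\<omega> \<in> Hneg \<tau>" for \<omega>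
    proof -
      define x where "x = dual_norm \<tau> \<omega>"
      define y where "y = 2 powr (- real l) * x powr \<alpha>"
      have x: "x \<ge> 0" unfolding x_def by (rule dual_norm_nonneg[OF \<tau> \<omega>])
      have term_le: "cmod (power_pairing n \<omega> (\<phi> n)) \<le> exp y * kernel_term \<alpha> \<tau> l' \<phi> n" for n
      proof -
        have t: "\<phi> n \<in> tensor_power \<tau> n" by (rule sym_tensor_powerD[OF has_kernelsD(1)[OF \<phi>]])
        have "cmod (power_pairing n \<omega> (\<phi> n)) \<le> x ^ n * tensor_norm \<tau> n (\<phi> n)"
          unfolding x_def by (rule power_pairing_le[OF \<tau> t \<omega>])
        also have "x ^ n \<le> fact n powr (1 / \<alpha>) * (2 ^ l') ^ n * exp (x powr \<alpha> * ((2 ^ l') powr (- \<alpha>) / \<alpha>))"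
          by (rule power_le_fact_powr_exp[OF \<alpha> _ x]) simp
        also have "exp (x powr \<alpha> * ((2 ^ l') powr (- \<alpha>) / \<alpha>)) \<le> exp y"
          using b mult_left_mono[OF b, of "x powr \<alpha>"] by (simp add: y_def mult.commute)
        finally show ?thesis
          using tensor_norm_nonneg[OF t] by (simp add: kernel_term_def power_mult mult_right_mono mult_left_mono algebra_simps)
      qed
      have "cmod (f \<omega>) = cmod (\<Sum>n. power_pairing n \<omega> (\<phi> n))"
        using has_kernelsD(2)[OF \<phi> \<omega>] by (simp add: sums_iff)
      also have "\<dots> \<le> (\<Sum>n. exp y * kernel_term \<alpha> \<tau> l' \<phi> n)"
        by (rule norm_suminf_le[OF term_le summable_mult[OF s]])
      also have "\<dots> = exp y * kernel_norm \<alpha> \<tau> l' f"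
        unfolding kn by (rule suminf_mult[OF s])
      finally have "cmod (f \<omega>) / exp y \<le> kernel_norm \<alpha> \<tau> l' f"
        by (simp add: pos_divide_le_eq mult.commute)
      moreover have "weighted \<alpha> \<tau> l f \<omega> = cmod (f \<omega>) / exp y"
        by (simp add: weighted_def y_def x_def exp_minus divide_inverse)
      ultimately show ?thesis by simp
    qed
    then show "f \<in> growth_space \<alpha> \<tau> l \<and> growth_norm \<alpha> \<tau> l f \<le> kernel_norm \<alpha> \<tau> l' f"
      using growth_spaceI[OF \<tau> f] by blast
  qed
qed

lemma
  assumes \<sigma>: "\<sigma> \<in> T" and \<alpha>: "\<alpha> > 0" and f: "f \<in> growth_space \<alpha> \<sigma> l"
  shows growth_bound: "\<omega> \<in> Hneg \<sigma> \<Longrightarrow> dual_norm \<sigma> \<omega> \<le> R \<Longrightarrow>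
      cmod (f \<omega>) \<le> growth_norm \<alpha> \<sigma> l f * exp (2 powr (- real l) * R powr \<alpha>)"
    and growth_space_entire_locally_bounded: "f \<in> entire_locally_bounded \<sigma>"
    and growth_norm_nonneg: "growth_norm \<alpha> \<sigma> l f \<ge> 0"
proof -
  have "0 \<le> weighted \<alpha> \<sigma> l f (\<lambda>\<xi>\<in>Phi. 0)" by (simp add: weighted_def)
  then show N: "growth_norm \<alpha> \<sigma> l f \<ge> 0" using growth_spaceD(2)[OF f zero_in_Hneg[OF \<sigma>]] by linarith
  show bound: "cmod (f \<omega>) \<le> growth_norm \<alpha> \<sigma> l f * exp (2 powr (- real l) * R powr \<alpha>)"
    if "\<omega> \<in> Hneg \<sigma>" "dual_norm \<sigma> \<omega> \<le> R" for \<omega> R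
  proof -
    have "cmod (f \<omega>) \<le> growth_norm \<alpha> \<sigma> l f * exp (2 powr (- real l) * dual_norm \<sigma> \<omega> powr \<alpha>)"
      using growth_spaceD(2)[OF f that(1)]
      by (simp add: weighted_def exp_minus pos_divide_le_eq flip: divide_inverse)
    also have "\<dots> \<le> growth_norm \<alpha> \<sigma> l f * exp (2 powr (- real l) * R powr \<alpha>)"
      using N that(2) dual_norm_nonneg[OF \<sigma> that(1)] \<alpha> by (intro mult_left_mono) (auto intro: powr_mono2)
    finally show ?thesis .
  qed
  show "f \<in> entire_locally_bounded \<sigma>"
    unfolding entire_locally_bounded_def mem_Collect_eq
    using entire_onD(1,3)[OF growth_spaceD(1)[OF f]] bound by blast
qed

text \<open>Here \<open>\<sigma>\<close> is an index for which \<open>\<H>\<^sub>\<sigma> \<subseteq> \<H>\<^sub>\<tau>\<close> is Hilbert-Schmidt. By Cauchy's estimate the Taylor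
  forms of \<open>f\<close> on \<open>\<H>\<^sub>-\<^sub>\<sigma>\<close> are bounded, so they are Hilbert-Schmidt on \<open>\<H>\<^sub>-\<^sub>\<tau>\<close>, and the weighted norms are
  dominated by a geometric series. Its ratio contains the factor \<open>2\<^sup>-\<^sup>l\<^sup>'\<^sup>/\<^sup>\<alpha>\<close>, which makes it as small as
  desired.\<close>

lemma growth_space_kernel:
  assumes \<tau>: "\<tau> \<in> T" and \<alpha>: "\<alpha> > 0"
  obtains \<sigma> l' where "\<sigma> \<in> T" "Hneg \<tau> \<subseteq> Hneg \<sigma>"
    "\<And>f. f \<in> growth_space \<alpha> \<sigma> l' \<Longrightarrow> restrict f (Hneg \<tau>) \<in> entire_on \<tau> \<Longrightarrow>
      restrict f (Hneg \<tau>) \<in> kernel_space \<alpha> \<tau> l \<and>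
      kernel_norm \<alpha> \<tau> l (restrict f (Hneg \<tau>)) \<le> 2 * growth_norm \<alpha> \<sigma> l' f"
proof -
  obtain \<sigma> where \<sigma>: "\<sigma> \<in> T" and HS: "hilbert_schmidt_embedded (H \<sigma>) (ip \<sigma>) (H \<tau>) (ip \<tau>)"
    using nuclear[OF \<tau>] by blast
  have emb: "continuously_embedded (H \<sigma>) (ip \<sigma>) (H \<tau>) (ip \<tau>)"
    using HS by (simp add: hilbert_schmidt_embedded_def)
  have sub: "Hneg \<tau> \<subseteq> Hneg \<sigma>" using Hneg_mono[OF \<sigma> \<tau> emb] by blast
  obtain K where K: "K \<ge> 0" "\<And>F. F \<in> orthonormal_systems \<tau> \<Longrightarrow> (\<Sum>e\<in>F. (dual_norm \<sigma> (riesz \<tau> e))\<^sup>2) \<le> K"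
    using hilbert_schmidt_dual[OF \<sigma> \<tau> HS] by blast
  define a where "a = exp 2 * 2 ^ l * sqrt K"
  have a: "a \<ge> 0" using K by (simp add: a_def)
  have "\<exists>m. (2 powr (- 1 / \<alpha>)) ^ m < 1 / (2 * (a + 1))"
    using \<alpha> a by (intro real_arch_pow_inv) (auto simp: powr_less_one)
  then obtain l' where l': "(2 powr (- 1 / \<alpha>)) ^ l' < 1 / (2 * (a + 1))" ..
  define q where "q = a * (2 powr (- 1 / \<alpha>)) ^ l'"
  have q0: "q \<ge> 0" using a by (simp add: q_def)
  have q: "q \<le> 1 / 2"
  proof -
    have "q \<le> a * (1 / (2 * (a + 1)))" unfolding q_def using l' a by (intro mult_left_mono) auto
    also have "\<dots> \<le> 1 / 2" using a by (simp add: field_simps)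
    finally show ?thesis .
  qed
  show thesis
  proof (rule that[OF \<sigma> sub])
    fix f assume f: "f \<in> growth_space \<alpha> \<sigma> l'" and fe: "restrict f (Hneg \<tau>) \<in> entire_on \<tau>"
    define N where "N = growth_norm \<alpha> \<sigma> l' f"
    have N: "N \<ge> 0" unfolding N_def by (rule growth_norm_nonneg[OF \<sigma> \<alpha> f])
    have ef: "f \<in> entire_locally_bounded \<sigma>" by (rule growth_space_entire_locally_bounded[OF \<sigma> \<alpha> f])
    define \<phi> where "\<phi> = taylor_form \<sigma> \<tau> f"
    have \<phi>: "\<phi> n \<in> sym_tensor_power \<tau> n \<and> kernel_term \<alpha> \<tau> l \<phi> n \<le> N * q ^ n" for n
    proof -
      obtain r where r: "r > 0" "2 powr (- real l') * (real n * r) powr \<alpha> = real n"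
        "fact n powr (1 / \<alpha>) * 2 ^ (l * n) * (N * exp (real n) / (r ^ n * fact n) * sqrt K ^ n)
          \<le> N * (exp 2 * 2 ^ l * sqrt K * (2 powr (- 1 / \<alpha>)) ^ l') ^ n"
        using taylor_radius_estimate[OF \<alpha> K(1) N] by blast
      have M: "cmod (f \<zeta>) \<le> N * exp (real n)" if "\<zeta> \<in> Hneg \<sigma>" "dual_norm \<sigma> \<zeta> \<le> n * r" for \<zeta>
        using growth_bound[OF \<sigma> \<alpha> f that] unfolding r(2) N_def .
      have s: "\<phi> n \<in> sym_tensor_power \<tau> n"
        unfolding \<phi>_def by (rule taylor_form_tensor(1)[OF \<sigma> \<tau> sub ef K r(1) M])
      have "tensor_norm \<tau> n (\<phi> n) \<le> N * exp (real n) / (r ^ n * fact n) * sqrt K ^ n"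
        unfolding \<phi>_def by (rule taylor_form_tensor(2)[OF \<sigma> \<tau> sub ef K r(1) M])
      then have "kernel_term \<alpha> \<tau> l \<phi> n
          \<le> fact n powr (1 / \<alpha>) * 2 ^ (l * n) * (N * exp (real n) / (r ^ n * fact n) * sqrt K ^ n)"
        unfolding kernel_term_def by (intro mult_left_mono) auto
      also note r(3)
      finally show ?thesis using s by (simp add: q_def a_def)
    qed
    have hk: "has_kernels \<tau> (restrict f (Hneg \<tau>)) \<phi>"
      unfolding has_kernels_def using \<phi> taylor_series[OF \<sigma> sub ef] by (simp add: \<phi>_def)
    have geo: "summable (\<lambda>n. N * q ^ n)" "(\<Sum>n. N * q ^ n) = N * (1 / (1 - q))"
      using q q0 by (auto intro!: summable_mult summable_geometric simp: suminf_mult suminf_geometric)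
    have s: "summable (kernel_term \<alpha> \<tau> l \<phi>)"
      using geo(1) by (rule summable_comparison_test'[where N = 0]) (use \<phi> kernel_term_nonneg[OF hk] in simp)
    have "(\<Sum>n. kernel_term \<alpha> \<tau> l \<phi> n) \<le> (\<Sum>n. N * q ^ n)"
      using \<phi> s geo(1) by (intro suminf_le) auto
    also have "\<dots> \<le> N * 2"
      unfolding geo(2) using q N by (intro mult_left_mono) (auto simp: divide_le_eq)
    finally have "(\<Sum>n. kernel_term \<alpha> \<tau> l \<phi> n) \<le> 2 * growth_norm \<alpha> \<sigma> l' f" by (simp add: N_def)
    then show "restrict f (Hneg \<tau>) \<in> kernel_space \<alpha> \<tau> l \<and>
        kernel_norm \<alpha> \<tau> l (restrict f (Hneg \<tau>)) \<le> 2 * growth_norm \<alpha> \<sigma> l' f"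
      using kernel_spaceI[OF \<tau> fe hk s] by simp
  qed
qed

end

section \<open>Equality of the projective limits\<close>

context hilbert_family
begin

lemma proj_limD:
  assumes "f \<in> proj_lim S"
  shows "f \<in> extensional Phi_dual" "\<tau> \<in> T \<Longrightarrow> restrict f (Hneg \<tau>) \<in> S \<tau> l"
  using assms unfolding proj_lim_def by blast+

definition diff_on :: "'t \<Rightarrow> (('a \<times> 'a \<Rightarrow> complex) \<Rightarrow> complex) \<Rightarrow> (('a \<times> 'a \<Rightarrow> complex) \<Rightarrow> complex) \<Rightarrow>
    (('a \<times> 'a \<Rightarrow> complex) \<Rightarrow> complex)" where
  "diff_on \<tau> g f = (\<lambda>\<omega>\<in>Hneg \<tau>. g \<omega> - f \<omega>)"

text \<open>Around each of its points \<open>g0\<close> the ball contains a ball for the dominating norm.\<close>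

lemma ball_open_in_finer_proj_lim:
  assumes E: "proj_lim S1 = E" "proj_lim S2 = E"
    and "\<tau> \<in> T" "f \<in> E" "\<sigma> \<in> T" and C: "C > 0"
    and triangle: "\<And>f g h. f \<in> E \<Longrightarrow> g \<in> E \<Longrightarrow> h \<in> E \<Longrightarrow>
      N1 \<tau> l (diff_on \<tau> g f) \<le> N1 \<tau> l (diff_on \<tau> g h) + N1 \<tau> l (diff_on \<tau> h f)"
    and zero: "\<And>f. f \<in> E \<Longrightarrow> N2 \<sigma> l' (diff_on \<sigma> f f) \<le> 0"
    and dom: "\<And>f g. f \<in> E \<Longrightarrow> g \<in> E \<Longrightarrow> N1 \<tau> l (diff_on \<tau> g f) \<le> C * N2 \<sigma> l' (diff_on \<sigma> g f)"
  shows "openin (proj_lim_topology S2 N2) {g \<in> E. N1 \<tau> l (diff_on \<tau> g f) < \<epsilon>}"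
proof (subst openin_subopen, intro ballI)
  fix g0 assume g0: "g0 \<in> {g \<in> E. N1 \<tau> l (diff_on \<tau> g f) < \<epsilon>}"
  define \<delta> where "\<delta> = (\<epsilon> - N1 \<tau> l (diff_on \<tau> g0 f)) / C"
  have \<delta>: "\<delta> > 0" using g0 C by (simp add: \<delta>_def)
  define V where "V = {g \<in> E. N2 \<sigma> l' (diff_on \<sigma> g g0) < \<delta>}"
  have "openin (proj_lim_topology S2 N2) V"
    unfolding proj_lim_topology_def
    by (rule topology_generated_by_Basis)
      (use g0 \<delta> \<open>\<sigma> \<in> T\<close> E in \<open>unfold V_def diff_on_def E(2); blast\<close>)
  moreover have "g0 \<in> V" using g0 zero[of g0] \<delta> by (simp add: V_def)
  moreover have "V \<subseteq> {g \<in> E. N1 \<tau> l (diff_on \<tau> g f) < \<epsilon>}"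
  proof
    fix g assume g: "g \<in> V"
    then have gE: "g \<in> E" "N2 \<sigma> l' (diff_on \<sigma> g g0) < \<delta>" by (auto simp: V_def)
    have "C * N2 \<sigma> l' (diff_on \<sigma> g g0) < \<epsilon> - N1 \<tau> l (diff_on \<tau> g0 f)"
      using gE(2) C by (simp add: \<delta>_def pos_less_divide_eq mult.commute)
    then have "N1 \<tau> l (diff_on \<tau> g f) < \<epsilon>"
      using triangle[OF \<open>f \<in> E\<close> gE(1), of g0] dom[OF _ gE(1), of g0] g0 by auto
    then show "g \<in> {g \<in> E. N1 \<tau> l (diff_on \<tau> g f) < \<epsilon>}" using gE(1) by simp
  qed
  ultimately show "\<exists>V. openin (proj_lim_topology S2 N2) V \<and> g0 \<in> V \<and> V \<subseteq> {g \<in> E. N1 \<tau> l (diff_on \<tau> g f) < \<epsilon>}"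
    by blast
qed

lemma proj_lim_topology_finer:
  assumes E: "proj_lim S1 = E" "proj_lim S2 = E"
    and balls: "\<And>f \<tau> l \<epsilon>. f \<in> E \<Longrightarrow> \<tau> \<in> T \<Longrightarrow> openin (proj_lim_topology S2 N2) {g \<in> E. N1 \<tau> l (diff_on \<tau> g f) < \<epsilon>}"
    and U: "openin (proj_lim_topology S1 N1) U"
  shows "openin (proj_lim_topology S2 N2) U"
proof (rule generate_topology_on_coarsest[OF istopology_openin])
  show "generate_topology_on {{g \<in> proj_lim S1. N1 \<tau> l (\<lambda>\<omega>\<in>Hneg \<tau>. g \<omega> - f \<omega>) < \<epsilon>} | f \<tau> l \<epsilon>.
        f \<in> proj_lim S1 \<and> \<tau> \<in> T \<and> \<epsilon> > 0} U"
    using U unfolding proj_lim_topology_def openin_topology_generated_by_iff .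
  fix V assume "V \<in> {{g \<in> proj_lim S1. N1 \<tau> l (\<lambda>\<omega>\<in>Hneg \<tau>. g \<omega> - f \<omega>) < \<epsilon>} | f \<tau> l \<epsilon>.
        f \<in> proj_lim S1 \<and> \<tau> \<in> T \<and> \<epsilon> > 0}"
  then obtain f \<tau> l \<epsilon> where "f \<in> E" "\<tau> \<in> T" "V = {g \<in> E. N1 \<tau> l (diff_on \<tau> g f) < \<epsilon>}"
    unfolding diff_on_def E(1) by blast
  then show "openin (proj_lim_topology S2 N2) V" using balls by blast
qed

end

context hilbert_rigging
begin

lemma diff_on_eq: "diff_on \<tau> g f = fun_add_scaled \<tau> (restrict g (Hneg \<tau>)) (-1) (restrict f (Hneg \<tau>))"
  by (auto simp: diff_on_def fun_add_scaled_def)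

lemma diff_on_split: "diff_on \<tau> g f = fun_add_scaled \<tau> (diff_on \<tau> g h) 1 (diff_on \<tau> h f)"
  by (auto simp: diff_on_def fun_add_scaled_def)

lemma E_min_eq_E_kernel:
  assumes \<alpha>: "\<alpha> > 0"
  shows "E_min \<alpha> = E_kernel \<alpha>"
proof
  show "E_min \<alpha> \<subseteq> E_kernel \<alpha>"
  proof
    fix f assume "f \<in> E_min \<alpha>"
    then have f: "f \<in> proj_lim (growth_space \<alpha>)" by (simp add: E_min_def)
    have "restrict f (Hneg \<tau>) \<in> kernel_space \<alpha> \<tau> l" if \<tau>: "\<tau> \<in> T" for \<tau> l
    proof -
      obtain \<sigma> l' where \<sigma>: "\<sigma> \<in> T" and sub: "Hneg \<tau> \<subseteq> Hneg \<sigma>"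
        and ker: "\<And>f. f \<in> growth_space \<alpha> \<sigma> l' \<Longrightarrow> restrict f (Hneg \<tau>) \<in> entire_on \<tau> \<Longrightarrow>
          restrict f (Hneg \<tau>) \<in> kernel_space \<alpha> \<tau> l \<and>
          kernel_norm \<alpha> \<tau> l (restrict f (Hneg \<tau>)) \<le> 2 * growth_norm \<alpha> \<sigma> l' f"
        using growth_space_kernel[OF \<tau> \<alpha>, of l] by blast
      have r: "restrict (restrict f (Hneg \<sigma>)) (Hneg \<tau>) = restrict f (Hneg \<tau>)"
        using sub by (simp add: Int_absorb1)
      have "restrict f (Hneg \<tau>) \<in> entire_on \<tau>"
        by (rule growth_spaceD(1)[OF proj_limD(2)[OF f \<tau>, of 0]])
      then show ?thesis using ker[OF proj_limD(2)[OF f \<sigma>]] unfolding r by blast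
    qed
    then show "f \<in> E_kernel \<alpha>"
      unfolding E_kernel_def proj_lim_def using proj_limD(1)[OF f] by blast
  qed
  show "E_kernel \<alpha> \<subseteq> E_min \<alpha>"
  proof
    fix f assume "f \<in> E_kernel \<alpha>"
    then have f: "f \<in> proj_lim (kernel_space \<alpha>)" by (simp add: E_kernel_def)
    have "restrict f (Hneg \<tau>) \<in> growth_space \<alpha> \<tau> l" if \<tau>: "\<tau> \<in> T" for \<tau> l
      using kernel_space_growth[OF \<tau> \<alpha>, of l] proj_limD(2)[OF f \<tau>] by blast
    then show "f \<in> E_min \<alpha>"
      unfolding E_min_def proj_lim_def using proj_limD(1)[OF f] by blast
  qed
qed

lemma E_min_topology_eq_E_kernel_topology:
  assumes \<alpha>: "\<alpha> > 0"
  shows "E_min_topology \<alpha> = E_kernel_topology \<alpha>"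
proof -
  define E where "E = E_min \<alpha>"
  have E1: "proj_lim (growth_space \<alpha>) = E" by (simp add: E_def E_min_def)
  have E2: "proj_lim (kernel_space \<alpha>) = E" using E_min_eq_E_kernel[OF \<alpha>] by (simp add: E_def E_kernel_def)
  have g: "restrict f (Hneg \<tau>) \<in> growth_space \<alpha> \<tau> l" and k: "restrict f (Hneg \<tau>) \<in> kernel_space \<alpha> \<tau> l"
    if "f \<in> E" "\<tau> \<in> T" for f \<tau> l
    using that E1 E2 proj_limD(2) by blast+
  have dg: "diff_on \<tau> g f \<in> growth_space \<alpha> \<tau> l" if "f \<in> E" "g \<in> E" "\<tau> \<in> T" for f g \<tau> l
    unfolding diff_on_eq by (rule growth_add_scaled(1)[OF that(3) g[OF that(2,3)] g[OF that(1,3)]])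
  have dk: "diff_on \<tau> g f \<in> kernel_space \<alpha> \<tau> l" if "f \<in> E" "g \<in> E" "\<tau> \<in> T" for f g \<tau> l
    unfolding diff_on_eq by (rule kernel_add_scaled(1)[OF that(3) k[OF that(2,3)] k[OF that(1,3)]])
  have tg: "growth_norm \<alpha> \<tau> l (diff_on \<tau> g f) \<le> growth_norm \<alpha> \<tau> l (diff_on \<tau> g h) + growth_norm \<alpha> \<tau> l (diff_on \<tau> h f)"
    if "f \<in> E" "g \<in> E" "h \<in> E" "\<tau> \<in> T" for f g h \<tau> l
    using growth_add_scaled(2)[OF that(4) dg[OF that(3,2,4)] dg[OF that(1,3,4)], of l 1]
    unfolding diff_on_split[of \<tau> g f h] by simp
  have tk: "kernel_norm \<alpha> \<tau> l (diff_on \<tau> g f) \<le> kernel_norm \<alpha> \<tau> l (diff_on \<tau> g h) + kernel_norm \<alpha> \<tau> l (diff_on \<tau> h f)"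
    if "f \<in> E" "g \<in> E" "h \<in> E" "\<tau> \<in> T" for f g h \<tau> l
    using kernel_add_scaled(2)[OF that(4) dk[OF that(3,2,4)] dk[OF that(1,3,4)], of l 1]
    unfolding diff_on_split[of \<tau> g f h] by simp
  have zg: "growth_norm \<alpha> \<tau> l (diff_on \<tau> f f) \<le> 0" if "f \<in> E" "\<tau> \<in> T" for f \<tau> l
    by (rule growth_spaceI(2)[OF that(2) growth_spaceD(1)[OF dg[OF that(1,1,2), of 0]]])
      (simp add: weighted_def diff_on_def)
  have kg: "\<exists>\<sigma>\<in>T. \<exists>l'. \<forall>f\<in>E. \<forall>g\<in>E. kernel_norm \<alpha> \<tau> l (diff_on \<tau> g f) \<le> 2 * growth_norm \<alpha> \<sigma> l' (diff_on \<sigma> g f)"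
    if \<tau>: "\<tau> \<in> T" for \<tau> l
  proof -
    obtain \<sigma> l' where \<sigma>: "\<sigma> \<in> T" and sub: "Hneg \<tau> \<subseteq> Hneg \<sigma>"
      and ker: "\<And>f. f \<in> growth_space \<alpha> \<sigma> l' \<Longrightarrow> restrict f (Hneg \<tau>) \<in> entire_on \<tau> \<Longrightarrow>
        restrict f (Hneg \<tau>) \<in> kernel_space \<alpha> \<tau> l \<and>
        kernel_norm \<alpha> \<tau> l (restrict f (Hneg \<tau>)) \<le> 2 * growth_norm \<alpha> \<sigma> l' f"
      using growth_space_kernel[OF \<tau> \<alpha>, of l] by blast
    have "kernel_norm \<alpha> \<tau> l (diff_on \<tau> g f) \<le> 2 * growth_norm \<alpha> \<sigma> l' (diff_on \<sigma> g f)"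
      if "f \<in> E" "g \<in> E" for f g
    proof -
      have "restrict (diff_on \<sigma> g f) (Hneg \<tau>) = diff_on \<tau> g f"
        unfolding diff_on_def by (rule extensionalityI[where A = "Hneg \<tau>"]) (use sub in auto)
      then show ?thesis
        using ker[OF dg[OF that \<sigma>]] growth_spaceD(1)[OF dg[OF that \<tau>, of 0]] by simp
    qed
    then show ?thesis using \<sigma> by blast
  qed
  have zk: "kernel_norm \<alpha> \<tau> l (diff_on \<tau> f f) \<le> 0" if f: "f \<in> E" and \<tau>: "\<tau> \<in> T" for f \<tau> l
  proof -
    obtain \<sigma> l' where "\<sigma> \<in> T" "kernel_norm \<alpha> \<tau> l (diff_on \<tau> f f) \<le> 2 * growth_norm \<alpha> \<sigma> l' (diff_on \<sigma> f f)"
      using kg[OF \<tau>, of l] f by blast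
    then show ?thesis using zg[OF f, of \<sigma> l'] by linarith
  qed
  have "openin (proj_lim_topology (kernel_space \<alpha>) (kernel_norm \<alpha>)) {g \<in> E. growth_norm \<alpha> \<tau> l (diff_on \<tau> g f) < \<epsilon>}"
    if f: "f \<in> E" and \<tau>: "\<tau> \<in> T" for f \<tau> l \<epsilon>
  proof -
    obtain l' where l': "\<And>f. f \<in> kernel_space \<alpha> \<tau> l' \<Longrightarrow>
        f \<in> growth_space \<alpha> \<tau> l \<and> growth_norm \<alpha> \<tau> l f \<le> kernel_norm \<alpha> \<tau> l' f"
      using kernel_space_growth[OF \<tau> \<alpha>, of l] by blast
    show ?thesis
      by (rule ball_open_in_finer_proj_lim[OF E1 E2 \<tau> f \<tau> zero_less_one, of "growth_norm \<alpha>" l "kernel_norm \<alpha>" l'])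
        (use tg[OF _ _ _ \<tau>] zk[OF _ \<tau>] l' dk[OF _ _ \<tau>] in auto)
  qed
  note 1 = proj_lim_topology_finer[OF E1 E2 this]
  have "openin (proj_lim_topology (growth_space \<alpha>) (growth_norm \<alpha>)) {g \<in> E. kernel_norm \<alpha> \<tau> l (diff_on \<tau> g f) < \<epsilon>}"
    if f: "f \<in> E" and \<tau>: "\<tau> \<in> T" for f \<tau> l \<epsilon>
  proof -
    obtain \<sigma> l' where \<sigma>: "\<sigma> \<in> T"
      and dom: "\<forall>f\<in>E. \<forall>g\<in>E. kernel_norm \<alpha> \<tau> l (diff_on \<tau> g f) \<le> 2 * growth_norm \<alpha> \<sigma> l' (diff_on \<sigma> g f)"
      using kg[OF \<tau>, of l] by blast
    show ?thesis
      by (rule ball_open_in_finer_proj_lim[OF E2 E1 \<tau> f \<sigma> zero_less_two, of "kernel_norm \<alpha>" l "growth_norm \<alpha>" l'])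
        (use tk[OF _ _ _ \<tau>] zg[OF _ \<sigma>] dom in auto)
  qed
  note 2 = proj_lim_topology_finer[OF E2 E1 this]
  show ?thesis
    unfolding E_min_topology_def E_kernel_topology_def topology_eq
    by (intro allI iffI; (rule 1 | rule 2); assumption)
qed

end

theorem theorem2p8:
  fixes T :: "'t set"
    and H :: "'t \<Rightarrow> 'a::real_vector set"
    and ip :: "'t \<Rightarrow> 'a \<Rightarrow> 'a \<Rightarrow> real"
    and \<tau>\<^sub>0 :: 't
    and \<alpha> :: real
  assumes "hilbert_rigging T H ip \<tau>\<^sub>0"
    and "\<alpha> > 0"
  shows "hilbert_family.E_min T H ip \<alpha> = hilbert_family.E_kernel T H ip \<alpha> \<and>
         hilbert_family.E_min_topology T H ip \<alpha> = hilbert_family.E_kernel_topology T H ip \<alpha>"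
proof -
  interpret hilbert_rigging T H ip \<tau>\<^sub>0 by fact
  show ?thesis
    using E_min_eq_E_kernel[OF assms(2)] E_min_topology_eq_E_kernel_topology[OF assms(2)] by blast
qed

end
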